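(* Work in $\mathsf{ZF}$. The following statements are equivalent: (1) Kőnig's Lemma: every infinite locally finite connected graph has a ray. (2) Every infinite locally finite connected graph has an irreducible proper coloring. (3) Every infinite locally finite connected graph has a minimal dominating set. (4) Every infinite locally finite connected graph has a minimal edge cover. (5) Every infinite locally finite connected graph has a maximal matching.
   Context: Graphs are simple. A proper vertex coloring $f:V_G\to C$ (adjacent vertices get distinct colors) is an irreducible proper coloring if for all distinct $c_1,c_2\in C$ the set $f^{-1}(c_1)\cup f^{-1}(c_2)$ is dependent, i.e. contains two adjacent vertices. A dominating set is a set $D$ of vertices such that every vertex is in $D$ or adjacent to a vertex of $D$; it is minimal if no proper subset is dominating. A matching is a set of pairwise non-adjacent edges (no shared endpoints); it is maximal if not properly contained in another matching. An edge cover is a set of edges such that every vertex is incident with one of them; it is minimal if no proper subset is an edge cover. *)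

theory Defs
  imports Main
begin

text \<open>
  In HOL every one of the five principles about graphs on a type is provable outright, because of
  Hilbert choice.  ``Working in ZF'' is therefore rendered as truth in every model of first-order
  ZF: a type \<^typ>\<open>'a\<close> of ``sets'' with a binary relation \<open>\<epsilon>\<close>.  All set-theoretic notions below
  (function, natural number, finite, ...) are the ones of the model, so every quantifier ranges
  over elements of the model.  \<open>els a\<close>, the external extension of \<open>a\<close>, is only used to write
  first-order formulas in set notation; a HOL set need not be the extension of any element.
\<close>

datatype fm = Mem nat nat | Eq nat nat | Neg fm | Conj fm fm | Forall nat fm

locale membership =
  fixes mem :: "'a \<Rightarrow> 'a \<Rightarrow> bool"  (infix "\<epsilon>" 50)
begin

definition els :: "'a \<Rightarrow> 'a set" where
  "els a = {x. x \<epsilon> a}"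

primrec sat :: "(nat \<Rightarrow> 'a) \<Rightarrow> fm \<Rightarrow> bool" where
  "sat e (Mem i j) \<longleftrightarrow> e i \<epsilon> e j"
| "sat e (Eq i j) \<longleftrightarrow> e i = e j"
| "sat e (Neg p) \<longleftrightarrow> \<not> sat e p"
| "sat e (Conj p q) \<longleftrightarrow> sat e p \<and> sat e q"
| "sat e (Forall i p) \<longleftrightarrow> (\<forall>x. sat (e(i := x)) p)"

definition is_succ :: "'a \<Rightarrow> 'a \<Rightarrow> bool" where
  "is_succ s n \<longleftrightarrow> els s = insert n (els n)"

definition is_inductive :: "'a \<Rightarrow> bool" where
  "is_inductive w \<longleftrightarrow>
     (\<exists>z\<in>els w. els z = {}) \<and> (\<forall>n\<in>els w. \<exists>s\<in>els w. is_succ s n)"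

end

text \<open>
  Separation and replacement are first-order schemes: one instance for each formula, the valuation
  \<open>e\<close> supplying the parameters.  Allowing arbitrary HOL predicates instead would make every model
  satisfy the axiom of choice.
\<close>

locale ZF_model = membership mem for mem :: "'a \<Rightarrow> 'a \<Rightarrow> bool"  (infix "\<epsilon>" 50) +
  assumes extensionality: "\<And>a b. els a = els b \<Longrightarrow> a = b"
    and foundation: "\<And>a. els a \<noteq> {} \<Longrightarrow> \<exists>x\<in>els a. els x \<inter> els a = {}"
    and pairing: "\<And>a b. \<exists>c. els c = {a, b}"
    and union: "\<And>a. \<exists>u. els u = (\<Union>x\<in>els a. els x)"
    and power_set: "\<And>a. \<exists>p. els p = {x. els x \<subseteq> els a}"
    and infinity: "\<exists>w. is_inductive w"
    and separation: "\<And>\<phi> e a. \<exists>b. els b = {x \<in> els a. sat (e(0 := x)) \<phi>}"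
    and replacement: "\<And>\<phi> e a.
          (\<forall>x y y'. sat (e(0 := x, 1 := y)) \<phi> \<and> sat (e(0 := x, 1 := y')) \<phi> \<longrightarrow> y = y') \<Longrightarrow>
          \<exists>b. els b = {y. \<exists>x\<in>els a. sat (e(0 := x, 1 := y)) \<phi>}"

context membership
begin

definition is_nat :: "'a \<Rightarrow> bool" where
  "is_nat n \<longleftrightarrow> (\<forall>w. is_inductive w \<longrightarrow> n \<epsilon> w)"

definition is_omega :: "'a \<Rightarrow> bool" where
  "is_omega w \<longleftrightarrow> els w = {n. is_nat n}"

text \<open>Kuratowski pairs; functions are sets of such pairs.\<close>

definition is_pair :: "'a \<Rightarrow> 'a \<Rightarrow> 'a \<Rightarrow> bool" where
  "is_pair z a b \<longleftrightarrow> (\<exists>u v. els u = {a} \<and> els v = {a, b} \<and> els z = {u, v})"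

definition maps_to :: "'a \<Rightarrow> 'a \<Rightarrow> 'a \<Rightarrow> bool" where
  "maps_to f x y \<longleftrightarrow> (\<exists>z\<in>els f. is_pair z x y)"

definition is_fun :: "'a \<Rightarrow> 'a \<Rightarrow> 'a \<Rightarrow> bool" where
  "is_fun f A B \<longleftrightarrow>
     (\<forall>z\<in>els f. \<exists>x\<in>els A. \<exists>y\<in>els B. is_pair z x y) \<and> (\<forall>x\<in>els A. \<exists>!y. maps_to f x y)"

definition is_inj :: "'a \<Rightarrow> 'a \<Rightarrow> 'a \<Rightarrow> bool" where
  "is_inj f A B \<longleftrightarrow>
     is_fun f A B \<and> (\<forall>x x' y. maps_to f x y \<and> maps_to f x' y \<longrightarrow> x = x')"

definition is_bij :: "'a \<Rightarrow> 'a \<Rightarrow> 'a \<Rightarrow> bool" where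
  "is_bij f A B \<longleftrightarrow> is_inj f A B \<and> (\<forall>y\<in>els B. \<exists>x. maps_to f x y)"

definition fin :: "'a \<Rightarrow> bool" where
  "fin a \<longleftrightarrow> (\<exists>n f. is_nat n \<and> is_bij f n a)"

text \<open>A graph is given by its vertex set \<open>V\<close> and its set \<open>E\<close> of two-element subsets of \<open>V\<close>.\<close>

definition is_graph :: "'a \<Rightarrow> 'a \<Rightarrow> bool" where
  "is_graph V E \<longleftrightarrow> (\<forall>e\<in>els E. \<exists>x\<in>els V. \<exists>y\<in>els V. x \<noteq> y \<and> els e = {x, y})"

definition adj :: "'a \<Rightarrow> 'a \<Rightarrow> 'a \<Rightarrow> bool" where
  "adj E x y \<longleftrightarrow> (\<exists>e\<in>els E. els e = {x, y})"

definition locally_finite :: "'a \<Rightarrow> 'a \<Rightarrow> bool" where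
  "locally_finite V E \<longleftrightarrow> (\<forall>v\<in>els V. \<exists>N. els N = {x. adj E v x} \<and> fin N)"

text \<open>A path from \<open>x\<close> to \<open>y\<close> with \<open>n\<close> edges is an injection of \<open>n + 1 = {0, ..., n}\<close> into \<open>V\<close>.\<close>

definition is_path :: "'a \<Rightarrow> 'a \<Rightarrow> 'a \<Rightarrow> 'a \<Rightarrow> 'a \<Rightarrow> 'a \<Rightarrow> bool" where
  "is_path V E n p x y \<longleftrightarrow>
     is_nat n \<and> (\<exists>d. is_succ d n \<and> is_inj p d V) \<and>
     (\<exists>z. els z = {} \<and> maps_to p z x) \<and> maps_to p n y \<and>
     (\<forall>i s u v. i \<epsilon> n \<and> is_succ s i \<and> maps_to p i u \<and> maps_to p s v \<longrightarrow> adj E u v)"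

definition connected :: "'a \<Rightarrow> 'a \<Rightarrow> bool" where
  "connected V E \<longleftrightarrow> (\<forall>x\<in>els V. \<forall>y\<in>els V. \<exists>n p. is_path V E n p x y)"

definition inf_lf_conn_graph :: "'a \<Rightarrow> 'a \<Rightarrow> bool" where
  "inf_lf_conn_graph V E \<longleftrightarrow>
     is_graph V E \<and> \<not> fin V \<and> locally_finite V E \<and> connected V E"

definition is_ray :: "'a \<Rightarrow> 'a \<Rightarrow> 'a \<Rightarrow> bool" where
  "is_ray V E r \<longleftrightarrow>
     (\<exists>w. is_omega w \<and> is_inj r w V) \<and>
     (\<forall>i s u v. is_nat i \<and> is_succ s i \<and> maps_to r i u \<and> maps_to r s v \<longrightarrow> adj E u v)"

definition dependent :: "'a \<Rightarrow> 'a \<Rightarrow> bool" where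
  "dependent E S \<longleftrightarrow> (\<exists>x\<in>els S. \<exists>y\<in>els S. adj E x y)"

definition proper_coloring :: "'a \<Rightarrow> 'a \<Rightarrow> 'a \<Rightarrow> 'a \<Rightarrow> bool" where
  "proper_coloring V E C f \<longleftrightarrow>
     is_fun f V C \<and>
     (\<forall>x y c c'. adj E x y \<and> maps_to f x c \<and> maps_to f y c' \<longrightarrow> c \<noteq> c')"

definition irreducible_proper_coloring :: "'a \<Rightarrow> 'a \<Rightarrow> 'a \<Rightarrow> 'a \<Rightarrow> bool" where
  "irreducible_proper_coloring V E C f \<longleftrightarrow>
     proper_coloring V E C f \<and>
     (\<forall>c1\<in>els C. \<forall>c2\<in>els C. c1 \<noteq> c2 \<longrightarrow>
        (\<exists>S. els S = {x. maps_to f x c1} \<union> {x. maps_to f x c2} \<and> dependent E S))"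

definition dominating :: "'a \<Rightarrow> 'a \<Rightarrow> 'a \<Rightarrow> bool" where
  "dominating V E D \<longleftrightarrow>
     els D \<subseteq> els V \<and> (\<forall>v\<in>els V. v \<epsilon> D \<or> (\<exists>d\<in>els D. adj E v d))"

definition minimal_dominating :: "'a \<Rightarrow> 'a \<Rightarrow> 'a \<Rightarrow> bool" where
  "minimal_dominating V E D \<longleftrightarrow>
     dominating V E D \<and> \<not> (\<exists>D'. els D' \<subset> els D \<and> dominating V E D')"

definition edge_cover :: "'a \<Rightarrow> 'a \<Rightarrow> 'a \<Rightarrow> bool" where
  "edge_cover V E F \<longleftrightarrow> els F \<subseteq> els E \<and> (\<forall>v\<in>els V. \<exists>e\<in>els F. v \<epsilon> e)"

definition minimal_edge_cover :: "'a \<Rightarrow> 'a \<Rightarrow> 'a \<Rightarrow> bool" where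
  "minimal_edge_cover V E F \<longleftrightarrow>
     edge_cover V E F \<and> \<not> (\<exists>F'. els F' \<subset> els F \<and> edge_cover V E F')"

definition matching :: "'a \<Rightarrow> 'a \<Rightarrow> bool" where
  "matching E M \<longleftrightarrow>
     els M \<subseteq> els E \<and> (\<forall>e\<in>els M. \<forall>e'\<in>els M. e \<noteq> e' \<longrightarrow> els e \<inter> els e' = {})"

definition maximal_matching :: "'a \<Rightarrow> 'a \<Rightarrow> bool" where
  "maximal_matching E M \<longleftrightarrow>
     matching E M \<and> \<not> (\<exists>M'. els M \<subset> els M' \<and> matching E M')"

definition Koenig_lemma :: bool where
  "Koenig_lemma \<longleftrightarrow> (\<forall>V E. inf_lf_conn_graph V E \<longrightarrow> (\<exists>r. is_ray V E r))"

definition coloring_principle :: bool where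
  "coloring_principle \<longleftrightarrow>
     (\<forall>V E. inf_lf_conn_graph V E \<longrightarrow> (\<exists>C f. irreducible_proper_coloring V E C f))"

definition dominating_set_principle :: bool where
  "dominating_set_principle \<longleftrightarrow>
     (\<forall>V E. inf_lf_conn_graph V E \<longrightarrow> (\<exists>D. minimal_dominating V E D))"

definition edge_cover_principle :: bool where
  "edge_cover_principle \<longleftrightarrow>
     (\<forall>V E. inf_lf_conn_graph V E \<longrightarrow> (\<exists>F. minimal_edge_cover V E F))"

definition matching_principle :: bool where
  "matching_principle \<longleftrightarrow>
     (\<forall>V E. inf_lf_conn_graph V E \<longrightarrow> (\<exists>M. maximal_matching E M))"

end

end

theory Submission
  imports Defs
begin

text \<open>
  All five principles are equivalent to partial choice: every sequence of nonempty finite sets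
  \<open>A n\<close> has a choice function on some infinite set of indices.

  Partial choice well-orders the vertices of an infinite locally finite connected graph: apply it
  to the sets of linear orderings of the balls around a fixed vertex.  With a well-ordering of the
  vertices, rays, colorings, dominating sets, matchings and edge covers are found greedily.  A
  greedy construction is the kernel \<open>K\<close> of a well-founded relation \<open>R\<close>, that is
  \<open>x \<in> K \<longleftrightarrow> (\<forall>y\<in>K. \<not> R y x)\<close>.

  Conversely, given \<open>A\<close>, join two points of the \<open>A n\<close> if their indices differ by at most one.  A
  ray chooses the first point it visits in \<open>A n\<close>.  The points of \<open>A n\<close> are twins, so a minimal
  dominating set contains at most one of them.  In an irreducible coloring some color class meets
  infinitely many \<open>A n\<close>, each in one point, unless there are only finitely many colors, and then
  the least color in \<open>A n\<close> can be taken.  For matchings, join instead a hub \<open>n\<close> to all points of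
  \<open>A n\<close> and \<open>A (n + 1)\<close>; for edge covers, attach moreover a pendant vertex to each point, which
  leaves exactly one edge of a minimal cover at each hub.
\<close>

section \<open>Definable predicates\<close>

text \<open>Separation and replacement, and hence induction, are available in the model only for
  first-order formulas with parameters. A HOL predicate is therefore useful only once it is known to
  be \<open>definable\<close>, and this hypothesis shapes most statements. Nor does the model come
  with recursion: a single lemma on kernels, proved by gluing partial solutions, serves all greedy
  constructions instead of a recursion theorem.

  Choice on an infinite set of indices is enough because the balls increase: an ordering of a large
  ball also orders all smaller ones. In the converse direction a structure on the graph in general
  singles out a point in unboundedly many layers only.

  The dichotomy for colorings arises as follows. If a color occurs only in layers below
  \<open>n\<close>, irreducibility gives every other color a vertex adjacent to one of that color,
  so all colors occur in layers up to \<open>n\<close> and there are only finitely many. The pendant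
  vertices work because every edge cover must contain their edges, which already cover the points; a
  hub edge of a minimal cover can then be justified by its hub alone.\<close>

primrec rename_fm :: "(nat \<Rightarrow> nat) \<Rightarrow> fm \<Rightarrow> fm" where
  "rename_fm r (Mem i j) = Mem (r i) (r j)"
| "rename_fm r (Eq i j) = Eq (r i) (r j)"
| "rename_fm r (Neg p) = Neg (rename_fm r p)"
| "rename_fm r (Conj p q) = Conj (rename_fm r p) (rename_fm r q)"
| "rename_fm r (Forall i p) = Forall (r i) (rename_fm r p)"

definition mix :: "(nat \<Rightarrow> 'b) \<Rightarrow> (nat \<Rightarrow> 'b) \<Rightarrow> nat \<Rightarrow> 'b" where
  "mix e c k = (if even k then e (k div 2) else c (k div 2))"

lemma inj_parity:
  fixes f g :: "nat \<Rightarrow> nat"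
  assumes "inj f" "inj g"
  shows "inj (\<lambda>k. if even k then 2 * f (k div 2) else 2 * g (k div 2) + 1)"
proof (rule injI)
  fix x y :: nat
  assume eq: "(if even x then 2 * f (x div 2) else 2 * g (x div 2) + 1) =
              (if even y then 2 * f (y div 2) else 2 * g (y div 2) + 1)"
  then have par: "even x \<longleftrightarrow> even y"
    by (cases "even x"; cases "even y") (simp_all, (metis even_Suc dvd_triv_left)+)
  then have "x div 2 = y div 2"
    using eq assms by (auto split: if_splits dest: injD)
  then show "x = y"
    using par by (metis odd_two_times_div_two_succ dvd_mult_div_cancel)
qed

named_theorems definable_intros

context membership
begin

text \<open>Injectivity prevents capture: updating the variable \<open>r i\<close> must not be
  visible at any \<open>r n\<close> with \<open>n\<close> different from \<open>i\<close>.\<close>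

lemma sat_rename_fm: "inj r \<Longrightarrow> sat e (rename_fm r p) \<longleftrightarrow> sat (\<lambda>n. e (r n)) p"
proof (induction p arbitrary: e)
  case (Forall i p)
  have "(\<lambda>n. (e(r i := x)) (r n)) = (\<lambda>n. e (r n))(i := x)" for x
    using Forall.prems by (auto simp: fun_eq_iff inj_eq)
  then show ?case using Forall by simp
qed auto

text \<open>
  Environments are read in de Bruijn style: the value of the innermost quantified variable is
  \<open>e 0\<close>, and \<open>\<lambda>n. e (Suc n)\<close> is the environment outside of it.  The even variables of the formula
  hold the environment and the odd ones its parameters, so a definable predicate may mention
  arbitrary elements of the model.
\<close>

definition definable :: "((nat \<Rightarrow> 'a) \<Rightarrow> bool) \<Rightarrow> bool" where
  "definable P \<longleftrightarrow> (\<exists>p c. \<forall>e. P e \<longleftrightarrow> sat (mix e c) p)"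

lemma definable_not [definable_intros]: "definable P \<Longrightarrow> definable (\<lambda>e. \<not> P e)"
  unfolding definable_def by (metis sat.simps(3))

lemma definable_conj [definable_intros]:
  assumes "definable P" "definable Q"
  shows "definable (\<lambda>e. P e \<and> Q e)"
proof -
  obtain p c q d where p: "\<And>e. P e \<longleftrightarrow> sat (mix e c) p" and q: "\<And>e. Q e \<longleftrightarrow> sat (mix e d) q"
    using assms unfolding definable_def by metis
  \<comment> \<open>The two formulas come with their own parameters. These are interleaved as
    \<open>mix c d\<close>, and the renamings send the odd variables of the formulas to the two
    halves of that list; the even variables stay.\<close>
  define r1 where "r1 = (\<lambda>k :: nat. if even k then 2 * (k div 2) else 2 * (2 * (k div 2)) + 1)"
  define r2 where "r2 = (\<lambda>k :: nat. if even k then 2 * (k div 2) else 2 * (2 * (k div 2) + 1) + 1)"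
  have inj: "inj r1" "inj r2"
    unfolding r1_def r2_def
    by (rule inj_parity[of "\<lambda>k. k" "\<lambda>k. 2 * k"], simp_all add: injI)
       (rule inj_parity[of "\<lambda>k. k" "\<lambda>k. 2 * k + 1", simplified], simp_all add: injI)
  have "(\<lambda>n. mix e (mix c d) (r1 n)) = mix e c" "(\<lambda>n. mix e (mix c d) (r2 n)) = mix e d" for e
    by (auto simp: mix_def r1_def r2_def fun_eq_iff elim!: oddE)
  then have "P e \<and> Q e \<longleftrightarrow> sat (mix e (mix c d)) (Conj (rename_fm r1 p) (rename_fm r2 q))" for e
    by (simp add: p q sat_rename_fm inj)
  then show ?thesis unfolding definable_def by blast
qed

lemma definable_all [definable_intros]:
  assumes "definable (\<lambda>e. P (e 0) (\<lambda>n. e (Suc n)))"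
  shows "definable (\<lambda>e. \<forall>x. P x e)"
proof -
  obtain p c where p: "\<And>e. P (e 0) (\<lambda>n. e (Suc n)) \<longleftrightarrow> sat (mix e c) p"
    using assms unfolding definable_def by metis
  define r where "r k = (if k = 0 then 1 else if even k then k - 2 else k + 2)" for k :: nat
  have inj: "inj r"
    by (rule inj_on_inverseI[where g = "\<lambda>k. if even k then k + 2 else if k = 1 then 0 else k - 2"])
       (auto simp: r_def elim!: oddE evenE, presburger)
  have "(\<lambda>n. ((mix e (case_nat undefined c))(1 := x)) (r n)) = mix (case_nat x e) c" for e x
  proof
    fix n :: nat
    consider "n = 0" | k where "n = 2 * k + 2" | k where "n = 2 * k + 1"
    proof (cases "even n")
      case True
      then obtain k where "n = 2 * k" by (elim evenE)
      then show ?thesis using that(1) that(2)[of "k - 1"] by (cases k) auto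
    next
      case False
      then show ?thesis using that(3) by (elim oddE)
    qed
    then show "((mix e (case_nat undefined c))(1 := x)) (r n) = mix (case_nat x e) c n"
      by cases (auto simp: mix_def r_def)
  qed
  then have "(\<forall>x. P x e) \<longleftrightarrow> sat (mix e (case_nat undefined c)) (Forall 1 (rename_fm r p))" for e
    using p[of "case_nat _ e"] by (simp add: sat_rename_fm inj del: One_nat_def)
  then show ?thesis unfolding definable_def by blast
qed

lemma definable_rename:
  assumes "definable P" "inj r"
  shows "definable (\<lambda>e. P (\<lambda>n. e (r n)))"
proof -
  obtain p c where p: "\<And>e. P e \<longleftrightarrow> sat (mix e c) p"
    using assms unfolding definable_def by metis
  define s where "s = (\<lambda>k :: nat. if even k then 2 * r (k div 2) else 2 * (k div 2) + 1)"
  have inj: "inj s"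
    unfolding s_def by (rule inj_parity[OF \<open>inj r\<close>, of "\<lambda>k. k"]) (simp add: injI)
  have "(\<lambda>n. mix e c (s n)) = mix (\<lambda>n. e (r n)) c" for e
    unfolding mix_def s_def by auto
  then have "P (\<lambda>n. e (r n)) \<longleftrightarrow> sat (mix e c) (rename_fm s p)" for e
    by (simp add: sat_rename_fm inj p)
  then show ?thesis unfolding definable_def by blast
qed

lemma definable_const [definable_intros]: "definable (\<lambda>e. b)"
proof -
  have "definable (\<lambda>e. True)" unfolding definable_def
    by (rule exI[of _ "Eq 0 0"]) simp
  moreover have "definable (\<lambda>e. False)" unfolding definable_def
    by (rule exI[of _ "Neg (Eq 0 0)"]) simp
  ultimately show ?thesis by (cases b) auto
qed

lemma definable_disj [definable_intros]:
  assumes "definable P" "definable Q"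
  shows "definable (\<lambda>e. P e \<or> Q e)"
  using definable_not[OF definable_conj[OF definable_not[OF assms(1)] definable_not[OF assms(2)]]] by simp

lemma definable_imp [definable_intros]:
  assumes "definable P" "definable Q"
  shows "definable (\<lambda>e. P e \<longrightarrow> Q e)"
  unfolding imp_conv_disj by (rule definable_disj[OF definable_not[OF assms(1)] assms(2)])

lemma definable_iff [definable_intros]:
  assumes "definable P" "definable Q"
  shows "definable (\<lambda>e. P e \<longleftrightarrow> Q e)"
  unfolding iff_conv_conj_imp by (rule definable_conj[OF definable_imp[OF assms] definable_imp[OF assms(2,1)]])

lemma definable_ex [definable_intros]:
  assumes "definable (\<lambda>e. P (e 0) (\<lambda>n. e (Suc n)))"
  shows "definable (\<lambda>e. \<exists>x. P x e)"
  using definable_not[OF definable_all[of "\<lambda>x e. \<not> P x e", OF definable_not[OF assms]]] by simp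

text \<open>The language has no function symbols, so a term is represented by its graph, with the
  value in variable 0.\<close>

definition def_term :: "((nat \<Rightarrow> 'a) \<Rightarrow> 'a) \<Rightarrow> bool" where
  "def_term t \<longleftrightarrow> definable (\<lambda>e. e 0 = t (\<lambda>n. e (Suc n)))"

lemma def_term_var [definable_intros]: "def_term (\<lambda>e. e i)"
proof -
  have "e 0 = e (Suc i) \<longleftrightarrow> sat (mix e c) (Eq 0 (2 * Suc i))" for e c :: "nat \<Rightarrow> 'a"
    by (simp add: mix_def)
  then show ?thesis unfolding def_term_def definable_def by blast
qed

lemma def_term_const [definable_intros]: "def_term (\<lambda>e. a)"
proof -
  have "e 0 = a \<longleftrightarrow> sat (mix e (\<lambda>_. a)) (Eq 0 1)" for e
    by (simp add: mix_def)
  then show ?thesis unfolding def_term_def definable_def by blast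
qed

text \<open>A vacuous quantifier over variable 0 undoes the shift. This lets the substitution lemmas
  use low variables as scratch space and discard them afterwards.\<close>

lemma definable_unshift: "definable (\<lambda>e. P (\<lambda>n. e (Suc n))) \<Longrightarrow> definable P"
  using definable_ex[of "\<lambda>_. P"] by simp

lemma definable_subst_at:
  assumes "definable P" "def_term t"
  shows "definable (\<lambda>e. P (e(k := t e)))"
proof -
  define r where "r n = (if n = k then 0 else Suc n)" for n
  have "inj r" by (auto simp: inj_def r_def)
  then have "definable (\<lambda>e. P (\<lambda>n. e (r n)))" by (rule definable_rename[OF assms(1)])
  moreover have "(\<lambda>n. e (r n)) = (\<lambda>n. e (Suc n))(k := e 0)" for e :: "nat \<Rightarrow> 'a"
    by (auto simp: r_def)
  ultimately have "definable (\<lambda>e. e 0 = t (\<lambda>n. e (Suc n)) \<and> P ((\<lambda>n. e (Suc n))(k := e 0)))"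
    using assms(2) unfolding def_term_def by (simp add: definable_conj del: fun_upd_apply)
  from definable_ex[of "\<lambda>x e. x = t e \<and> P (e(k := x))", OF this] show ?thesis by simp
qed

lemma def_term_rename:
  assumes "def_term t" "inj r"
  shows "def_term (\<lambda>e. t (\<lambda>n. e (r n)))"
proof -
  have "inj (case_nat 0 (\<lambda>n. Suc (r n)))"
    by (rule injI) (auto split: nat.splits dest: injD[OF assms(2)])
  from definable_rename[OF assms(1)[unfolded def_term_def] this] show ?thesis
    by (simp add: def_term_def)
qed

lemma def_term_shift: "def_term t \<Longrightarrow> def_term (\<lambda>e. t (\<lambda>n. e (Suc n)))"
  using def_term_rename[where r = Suc] by simp

text \<open>
  These rules are not in \<open>definable_intros\<close>: their premise is not a higher-order pattern, so they are
  only usable when instantiated with a given predicate.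
\<close>

lemma definable_app1:
  assumes "definable (\<lambda>e. P (e 0))" "def_term s"
  shows "definable (\<lambda>e. P (s e))"
  using definable_subst_at[OF assms(1) def_term_shift[OF assms(2)], of 0] definable_unshift[where P = "\<lambda>e. P (s e)"]
  by simp

lemma definable_app2:
  assumes "definable (\<lambda>e. P (e 0) (e 1))" "def_term s" "def_term t"
  shows "definable (\<lambda>e. P (s e) (t e))"
proof -
  \<comment> \<open>Both arguments are read from an environment shifted by two, so that slots 0 and
    1 can receive them without overwriting a variable on which the other argument depends.\<close>
  have "def_term (\<lambda>e. s (\<lambda>n. e (Suc (Suc n))))" "def_term (\<lambda>e. t (\<lambda>n. e (Suc (Suc n))))"
    using def_term_rename[OF assms(2), of "\<lambda>n. Suc (Suc n)"] def_term_rename[OF assms(3), of "\<lambda>n. Suc (Suc n)"]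
    by (simp_all add: inj_def)
  from definable_subst_at[OF definable_subst_at[OF assms(1) this(1), of 0] this(2), of 1]
  have "definable (\<lambda>e. P (s (\<lambda>n. e (Suc (Suc n)))) (t (\<lambda>n. e (Suc (Suc n)))))"
    by simp
  from definable_unshift[of "\<lambda>e. P (s (\<lambda>n. e (Suc n))) (t (\<lambda>n. e (Suc n)))", OF this]
  show ?thesis by (rule definable_unshift[of "\<lambda>e. P (s e) (t e)"])
qed

lemma definable_app3:
  assumes "definable (\<lambda>e. P (e 0) (e 1) (e 2))" "def_term s" "def_term t" "def_term u"
  shows "definable (\<lambda>e. P (s e) (t e) (u e))"
proof -
  have T: "def_term (\<lambda>e. v (\<lambda>n. e (Suc (Suc (Suc n)))))" if "def_term v" for v
    using def_term_rename[OF that, of "\<lambda>n. Suc (Suc (Suc n))"] by (simp add: inj_def)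
  from definable_subst_at[OF definable_subst_at[OF definable_subst_at[OF assms(1) T[OF assms(2)], of 0]
      T[OF assms(3)], of 1] T[OF assms(4)], of 2]
  have "definable (\<lambda>e. P (s (\<lambda>n. e (Suc (Suc (Suc n))))) (t (\<lambda>n. e (Suc (Suc (Suc n)))))
            (u (\<lambda>n. e (Suc (Suc (Suc n))))))"
    by (simp add: numeral_2_eq_2)
  from definable_unshift[of "\<lambda>e. P (s (\<lambda>n. e (Suc (Suc n)))) (t (\<lambda>n. e (Suc (Suc n))))
            (u (\<lambda>n. e (Suc (Suc n))))", OF this]
  have "definable (\<lambda>e. P (s (\<lambda>n. e (Suc n))) (t (\<lambda>n. e (Suc n))) (u (\<lambda>n. e (Suc n))))"
    by (rule definable_unshift)
  then show ?thesis by (rule definable_unshift[of "\<lambda>e. P (s e) (t e) (u e)"])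
qed

lemma definable_eq [definable_intros]: "def_term s \<Longrightarrow> def_term t \<Longrightarrow> definable (\<lambda>e. s e = t e)"
  by (rule definable_app2[where P = "(=)"]) (use def_term_var[of 0] in \<open>simp_all add: def_term_def\<close>)

lemma definable_mem [definable_intros]: "def_term s \<Longrightarrow> def_term t \<Longrightarrow> definable (\<lambda>e. s e \<epsilon> t e)"
proof (rule definable_app2[where P = mem])
  have "e 0 \<epsilon> e 1 \<longleftrightarrow> sat (mix e c) (Mem 0 2)" for e c :: "nat \<Rightarrow> 'a"
    by (simp add: mix_def)
  then show "definable (\<lambda>e. e 0 \<epsilon> e 1)" unfolding definable_def by blast
qed

definition def_set :: "((nat \<Rightarrow> 'a) \<Rightarrow> 'a set) \<Rightarrow> bool" where
  "def_set S \<longleftrightarrow> definable (\<lambda>e. e 0 \<in> S (\<lambda>n. e (Suc n)))"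

lemma definable_in [definable_intros]:
  assumes "def_term t" "def_set S"
  shows "definable (\<lambda>e. t e \<in> S e)"
  using definable_subst_at[OF assms(2)[unfolded def_set_def] def_term_shift[OF assms(1)], of 0]
    definable_unshift[where P = "\<lambda>e. t e \<in> S e"]
  by simp

lemma def_set_els [definable_intros]: "def_term t \<Longrightarrow> def_set (\<lambda>e. els (t e))"
  unfolding def_set_def els_def mem_Collect_eq by (intro definable_mem def_term_var def_term_shift)

lemma def_set_Collect [definable_intros]: "definable (\<lambda>e. P (e 0) (\<lambda>n. e (Suc n))) \<Longrightarrow> def_set (\<lambda>e. {x. P x e})"
  by (simp add: def_set_def)

lemma def_set_empty [definable_intros]: "def_set (\<lambda>e. {})"
  by (simp add: def_set_def definable_intros)

lemma def_set_insert [definable_intros]: "def_term t \<Longrightarrow> def_set S \<Longrightarrow> def_set (\<lambda>e. insert (t e) (S e))"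
  unfolding def_set_def insert_iff by (intro definable_disj definable_eq def_term_var def_term_shift)

lemma def_set_Un [definable_intros]: "def_set S \<Longrightarrow> def_set T \<Longrightarrow> def_set (\<lambda>e. S e \<union> T e)"
  unfolding def_set_def Un_iff by (intro definable_disj)

lemma def_set_Diff [definable_intros]: "def_set S \<Longrightarrow> def_set T \<Longrightarrow> def_set (\<lambda>e. S e - T e)"
  unfolding def_set_def Diff_iff by (intro definable_conj definable_not)

lemma definable_ball [definable_intros]:
  "def_set S \<Longrightarrow> definable (\<lambda>e. P (e 0) (\<lambda>n. e (Suc n))) \<Longrightarrow> definable (\<lambda>e. \<forall>x\<in>S e. P x e)"
  unfolding Ball_def def_set_def by (intro definable_all definable_imp)

lemma definable_bex [definable_intros]:
  "def_set S \<Longrightarrow> definable (\<lambda>e. P (e 0) (\<lambda>n. e (Suc n))) \<Longrightarrow> definable (\<lambda>e. \<exists>x\<in>S e. P x e)"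
  unfolding Bex_def def_set_def by (intro definable_ex definable_conj)

lemma definable_seteq [definable_intros]: "def_set S \<Longrightarrow> def_set T \<Longrightarrow> definable (\<lambda>e. S e = T e)"
  unfolding def_set_def set_eq_iff by (intro definable_all definable_iff)

lemma definable_subset [definable_intros]: "def_set S \<Longrightarrow> def_set T \<Longrightarrow> definable (\<lambda>e. S e \<subseteq> T e)"
  unfolding def_set_def subset_iff by (intro definable_all definable_imp)

lemma definable_ex1 [definable_intros]:
  assumes "definable (\<lambda>e. P (e 0) (\<lambda>n. e (Suc n)))"
  shows "definable (\<lambda>e. \<exists>!x. P x e)"
proof -
  have "definable (\<lambda>e. P (e 0) (\<lambda>n. e (Suc (Suc n))))"
    using definable_rename[OF assms, of "case_nat 0 (\<lambda>n. Suc (Suc n))"]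
    by (simp add: inj_def split: nat.split)
  then show ?thesis
    unfolding Ex1_def by (intro definable_ex definable_conj definable_all definable_imp definable_eq def_term_var assms)
qed

section \<open>Definability of the set-theoretic notions of the model\<close>

lemma definable_is_succ [definable_intros]: "def_term s \<Longrightarrow> def_term t \<Longrightarrow> definable (\<lambda>e. is_succ (s e) (t e))"
  by (rule definable_app2) (unfold is_succ_def, (rule definable_intros)+)

lemma definable_is_inductive [definable_intros]: "def_term s \<Longrightarrow> definable (\<lambda>e. is_inductive (s e))"
  by (rule definable_app1) (unfold is_inductive_def, (rule definable_intros)+)

lemma definable_is_nat [definable_intros]: "def_term s \<Longrightarrow> definable (\<lambda>e. is_nat (s e))"
  by (rule definable_app1) (unfold is_nat_def, (rule definable_intros)+)

lemma definable_is_pair [definable_intros]: "def_term s \<Longrightarrow> def_term t \<Longrightarrow> def_term u \<Longrightarrow> definable (\<lambda>e. is_pair (s e) (t e) (u e))"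
  by (rule definable_app3) (unfold is_pair_def, (rule definable_intros)+)

lemma definable_maps_to [definable_intros]: "def_term s \<Longrightarrow> def_term t \<Longrightarrow> def_term u \<Longrightarrow> definable (\<lambda>e. maps_to (s e) (t e) (u e))"
  by (rule definable_app3) (unfold maps_to_def, (rule definable_intros)+)

lemma definable_is_fun [definable_intros]: "def_term s \<Longrightarrow> def_term t \<Longrightarrow> def_term u \<Longrightarrow> definable (\<lambda>e. is_fun (s e) (t e) (u e))"
  by (rule definable_app3) (unfold is_fun_def, (rule definable_intros)+)

lemma definable_is_inj [definable_intros]: "def_term s \<Longrightarrow> def_term t \<Longrightarrow> def_term u \<Longrightarrow> definable (\<lambda>e. is_inj (s e) (t e) (u e))"
  by (rule definable_app3) (unfold is_inj_def, (rule definable_intros)+)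

lemma definable_is_bij [definable_intros]: "def_term s \<Longrightarrow> def_term t \<Longrightarrow> def_term u \<Longrightarrow> definable (\<lambda>e. is_bij (s e) (t e) (u e))"
  by (rule definable_app3) (unfold is_bij_def, (rule definable_intros)+)

lemma definable_fin [definable_intros]: "def_term s \<Longrightarrow> definable (\<lambda>e. fin (s e))"
  by (rule definable_app1) (unfold fin_def, (rule definable_intros)+)

lemma definable_adj [definable_intros]: "def_term s \<Longrightarrow> def_term t \<Longrightarrow> def_term u \<Longrightarrow> definable (\<lambda>e. adj (s e) (t e) (u e))"
  by (rule definable_app3) (unfold adj_def, (rule definable_intros)+)

end

section \<open>Sets, pairs and natural numbers of the model\<close>

context membership
begin

lemma def_set_app1:
  assumes "def_set (\<lambda>e. X (e 0))" "def_term t"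
  shows "def_set (\<lambda>e. X (t e))"
proof -
  have "definable (\<lambda>e. e 0 \<in> X (e 1))" using assms(1) by (simp add: def_set_def)
  from definable_app2[OF this def_term_var def_term_shift[OF assms(2)], of 0] show ?thesis by (simp add: def_set_def)
qed

lemma def_set_UN [definable_intros]:
  assumes "def_set S" "def_set (\<lambda>e. X (e 0) (\<lambda>n. e (Suc n)))"
  shows "def_set (\<lambda>e. \<Union>i\<in>S e. X i e)"
proof -
  have *: "definable (\<lambda>e. e 0 \<in> S (\<lambda>n. e (Suc n)))"
    "definable (\<lambda>e. e 0 \<in> X (e 1) (\<lambda>n. e (Suc (Suc n))))"
    using assms by (simp_all add: def_set_def)
  \<comment> \<open>Under the quantifier the index is variable 0 and the element variable 1, the
    opposite of their order in the hypothesis; the first renaming swaps them.\<close>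
  have "inj (case_nat 1 (case_nat 0 (\<lambda>n. Suc (Suc n))))" "inj (case_nat 0 (\<lambda>n. Suc (Suc n)))"
    by (simp_all add: inj_def split: nat.split)
  with * have "definable (\<lambda>e. e 1 \<in> X (e 0) (\<lambda>n. e (Suc (Suc n))))"
    "definable (\<lambda>e. e 0 \<in> S (\<lambda>n. e (Suc (Suc n))))"
    using definable_rename[OF *(1), of "case_nat 0 (\<lambda>n. Suc (Suc n))"]
      definable_rename[OF *(2), of "case_nat 1 (case_nat 0 (\<lambda>n. Suc (Suc n)))"] by simp_all
  then show ?thesis
    unfolding def_set_def UN_iff Bex_def by (intro definable_ex definable_conj) simp_all
qed

end

context ZF_model
begin

lemma mem_iff: "x \<epsilon> a \<longleftrightarrow> x \<in> els a"
  by (simp add: els_def)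

lemma els_inject [simp]: "els a = els b \<longleftrightarrow> a = b"
  using extensionality by blast

section \<open>Classes that are sets of the model\<close>

definition small :: "'a set \<Rightarrow> bool" where
  "small X \<longleftrightarrow> (\<exists>a. els a = X)"

definition set_of :: "'a set \<Rightarrow> 'a" where
  "set_of X = (THE a. els a = X)"

lemma set_of_els [simp]: "set_of (els a) = a"
  unfolding set_of_def by simp

lemma els_set_of: "small X \<Longrightarrow> els (set_of X) = X"
  unfolding small_def by auto

lemma small_els [simp]: "small (els a)"
  unfolding small_def by blast

lemma def_set_small: "small X \<Longrightarrow> def_set (\<lambda>e. X)"
  unfolding small_def using def_set_els[OF def_term_const] by blast

lemma small_sep:
  assumes "small X" "definable (\<lambda>e. P (e 0))"
  shows "small {x \<in> X. P x}"
proof -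
  obtain p c where p: "\<And>e. P (e 0) \<longleftrightarrow> sat (mix e c) p"
    using assms(2) unfolding definable_def by metis
  obtain a where a: "els a = X" using assms(1) unfolding small_def by blast
  have "(mix (\<lambda>_. a) c)(0 := x) = mix ((\<lambda>_. a)(0 := x)) c" for x
    by (auto simp: mix_def fun_eq_iff elim!: evenE)
  then have "P x \<longleftrightarrow> sat ((mix (\<lambda>_. a) c)(0 := x)) p" for x
    using p[of "(\<lambda>_. a)(0 := x)"] by simp
  then show ?thesis
    using separation[of a "mix (\<lambda>_. a) c" p] a by (simp add: small_def)
qed

lemma small_subset:
  assumes "small X" "Y \<subseteq> X" "def_set (\<lambda>e. Y)"
  shows "small Y"
proof -
  have "{x \<in> X. x \<in> Y} = Y" using assms(2) by blast
  then show ?thesis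
    using small_sep[OF assms(1), of "\<lambda>x. x \<in> Y"] assms(3) by (simp add: def_set_def)
qed

lemma small_replace:
  assumes "small X" "definable (\<lambda>e. R (e 0) (e 1))"
    and fn: "\<And>x y y'. x \<in> X \<Longrightarrow> R x y \<Longrightarrow> R x y' \<Longrightarrow> y = y'"
  shows "small {y. \<exists>x\<in>X. R x y}"
proof -
  \<comment> \<open>The replacement scheme asks for a relation that is functional everywhere,
    whereas \<open>R\<close> is so only on \<open>X\<close>; membership in \<open>X\<close> is
    therefore put into the formula.\<close>
  have "definable (\<lambda>e. e 0 \<in> X \<and> R (e 0) (e 1))"
    by (intro definable_conj assms definable_in def_term_var def_set_small)
  then obtain p c where p: "\<And>e. e 0 \<in> X \<and> R (e 0) (e 1) \<longleftrightarrow> sat (mix e c) p"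
    unfolding definable_def by metis
  obtain a where a: "els a = X" using assms(1) unfolding small_def by blast
  define r where "r k = (if k = 1 then 2 else if k = 2 then 1 else k)" for k :: nat
  have "inj r" by (simp add: inj_def r_def)
  define E where "E = (\<lambda>n. mix (\<lambda>_. a) c (r n))"
  have "(\<lambda>n. (E(0 := x, 1 := y)) (r n)) = mix ((\<lambda>_. a)(0 := x, 1 := y)) c" for x y
    by (auto simp: mix_def fun_eq_iff E_def r_def elim!: evenE)
  then have "sat (E(0 := x, 1 := y)) (rename_fm r p) \<longleftrightarrow> x \<in> X \<and> R x y" for x y
    using p[of "(\<lambda>_. a)(0 := x, 1 := y)"] by (simp add: sat_rename_fm[OF \<open>inj r\<close>] del: One_nat_def)
  then have "\<exists>b. els b = {y. \<exists>x\<in>els a. x \<in> X \<and> R x y}"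
    using replacement[of E "rename_fm r p" a] fn by simp blast
  then show ?thesis unfolding small_def a by simp
qed

lemma small_pair: "small {a, b}"
  using pairing unfolding small_def by blast

lemma small_single: "small {a}"
  using small_pair[of a a] by simp

lemma small_empty: "small {}"
  using small_subset[OF small_single[of undefined]] by (simp add: def_set_empty)

lemma small_UN:
  assumes "small I" "\<And>i. i \<in> I \<Longrightarrow> small (X i)" "def_set (\<lambda>e. X (e 0))"
  shows "small (\<Union>i\<in>I. X i)"
proof -
  \<comment> \<open>Replacement along \<open>els y = X i\<close> collects the members of the family
    into one set, to which the union axiom applies.\<close>
  have "definable (\<lambda>e. els (e 1) = X (e 0))"
    by (intro definable_intros assms)
  from small_replace[OF assms(1), of "\<lambda>i y. els y = X i", OF this]
  have "small {y. \<exists>i\<in>I. els y = X i}"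
    by (metis els_inject)
  then obtain b where b: "els b = {y. \<exists>i\<in>I. els y = X i}"
    unfolding small_def by blast
  obtain u where "els u = (\<Union>x\<in>els b. els x)" using union by blast
  moreover have "(\<Union>x\<in>els b. els x) = (\<Union>i\<in>I. X i)"
    unfolding b using els_set_of[OF assms(2)] by (auto; metis)
  ultimately show ?thesis by (metis small_els)
qed

lemma small_Un:
  assumes "small X" "small Y"
  shows "small (X \<union> Y)"
proof -
  obtain a b where ab: "els a = X" "els b = Y" using assms unfolding small_def by blast
  obtain c where "els c = {a, b}" using pairing by blast
  moreover obtain u where "els u = (\<Union>x\<in>els c. els x)" using union by blast
  ultimately have "els u = X \<union> Y" using ab by simp
  then show ?thesis unfolding small_def by blast
qed

lemma small_insert: "small X \<Longrightarrow> small (insert a X)"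
  using small_Un[OF small_single[of a], of X] by simp

lemma small_Pow: "small X \<Longrightarrow> small {s. els s \<subseteq> X}"
  using power_set unfolding small_def by blast

lemma small_image:
  assumes "small X" "def_term (\<lambda>e. F (e 0))"
  shows "small (F ` X)"
proof -
  have "definable (\<lambda>e. e 1 = F (e 0))" by (intro definable_intros assms)
  from small_replace[OF assms(1), of "\<lambda>x y. y = F x", OF this] have "small {y. \<exists>x\<in>X. y = F x}"
    by blast
  then show ?thesis by (simp add: image_def)
qed

section \<open>Ordered pairs and functions\<close>

definition opair :: "'a \<Rightarrow> 'a \<Rightarrow> 'a" where
  "opair a b = set_of {set_of {a}, set_of {a, b}}"

lemma is_pair_iff [simp]: "is_pair z a b \<longleftrightarrow> z = opair a b"
proof -
  have "is_pair z a b \<longleftrightarrow> els z = {set_of {a}, set_of {a, b}}"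
    unfolding is_pair_def by (metis els_set_of set_of_els small_pair small_single)
  then show ?thesis
    unfolding opair_def by (metis els_set_of set_of_els small_pair)
qed

lemma opair_inject [simp]: "opair a b = opair c d \<longleftrightarrow> a = c \<and> b = d"
proof
  assume "opair a b = opair c d"
  then have "{set_of {a}, set_of {a, b}} = {set_of {c}, set_of {c, d}}"
    unfolding opair_def by (metis els_set_of small_pair)
  moreover have "set_of {x} = set_of {y, z} \<longleftrightarrow> {x} = {y, z}"
    "set_of {x, y} = set_of {z, w} \<longleftrightarrow> {x, y} = {z, w}"
    "set_of {y, z} = set_of {x} \<longleftrightarrow> {x} = {y, z}" "set_of {x} = set_of {y} \<longleftrightarrow> {x} = {y}" for x y z w
    by (metis els_set_of small_pair small_single)+
  ultimately show "a = c \<and> b = d"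
    by (auto simp: doubleton_eq_iff)
qed simp

lemma def_term_opair [definable_intros]: "def_term s \<Longrightarrow> def_term t \<Longrightarrow> def_term (\<lambda>e. opair (s e) (t e))"
  unfolding def_term_def[of "\<lambda>e. opair (s e) (t e)"] is_pair_iff[symmetric]
  by (intro definable_is_pair def_term_var def_term_shift)

lemma maps_to_iff: "maps_to f x y \<longleftrightarrow> opair x y \<in> els f"
  unfolding maps_to_def by auto

lemma small_prod:
  assumes "small X" "small Y"
  shows "small {z. \<exists>x\<in>X. \<exists>y\<in>Y. z = opair x y}"
proof -
  have "small (\<Union>x\<in>X. (\<lambda>y. opair x y) ` Y)"
  proof (rule small_UN[OF assms(1)])
    show "small ((\<lambda>y. opair x y) ` Y)" for x
      by (rule small_image[OF assms(2)]) (rule definable_intros)+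
    have "def_set (\<lambda>e. {z. \<exists>y\<in>Y. z = opair (e 0) y})"
      by (rule definable_intros def_set_small assms)+
    then show "def_set (\<lambda>e. (\<lambda>y. opair (e 0) y) ` Y)" by (simp add: image_def)
  qed
  moreover have "(\<Union>x\<in>X. (\<lambda>y. opair x y) ` Y) = {z. \<exists>x\<in>X. \<exists>y\<in>Y. z = opair x y}" by blast
  ultimately show ?thesis by simp
qed

text \<open>Every function of the model is built here from a definable graph. Totality and
  uniqueness form a premise inside the second conclusion, so that the description of
  \<open>maps_to f\<close> can be simplified before they are checked.\<close>

lemma ex_fun:
  assumes "definable (\<lambda>e. R (e 0) (e 1))"
  obtains f where "\<And>x y. maps_to f x y \<longleftrightarrow> x \<in> els A \<and> y \<in> els B \<and> R x y"
    and "(\<forall>x\<in>els A. \<exists>!y. y \<in> els B \<and> R x y) \<longrightarrow> is_fun f A B"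
proof -
  note [definable_intros] = definable_app2[OF assms]
  have "small {z. \<exists>x\<in>els A. \<exists>y\<in>els B. z = opair x y \<and> R x y}"
    by (rule small_subset[OF small_prod[OF small_els[of A] small_els[of B]]]) (blast, (rule definable_intros)+)
  then obtain f where f: "els f = {z. \<exists>x\<in>els A. \<exists>y\<in>els B. z = opair x y \<and> R x y}"
    unfolding small_def by blast
  have *: "maps_to f x y \<longleftrightarrow> x \<in> els A \<and> y \<in> els B \<and> R x y" for x y
    unfolding maps_to_iff f by auto
  have "is_fun f A B" if r: "\<forall>x\<in>els A. \<exists>!y. y \<in> els B \<and> R x y"
    unfolding is_fun_def
  proof (intro conjI ballI)
    fix x
    assume "x \<in> els A"
    then have "\<exists>!y. x \<in> els A \<and> y \<in> els B \<and> R x y" using r by simp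
    then show "\<exists>!y. maps_to f x y" by (simp only: *)
  qed (auto simp: f)
  then show thesis using that[OF *] by blast
qed

section \<open>Natural numbers of the model\<close>

definition zero :: 'a where "zero = set_of {}"

definition ins :: "'a \<Rightarrow> 'a \<Rightarrow> 'a" where "ins x a = set_of (insert x (els a))"

abbreviation suc :: "'a \<Rightarrow> 'a" where "suc n \<equiv> ins n n"

lemma els_zero [simp]: "els zero = {}"
  by (simp add: zero_def els_set_of small_empty)

lemma els_ins [simp]: "els (ins x a) = insert x (els a)"
  by (simp add: ins_def els_set_of small_insert)

lemma els_eq_empty [simp]: "els a = {} \<longleftrightarrow> a = zero"
  by (metis els_zero els_inject)

lemma is_succ_iff [simp]: "is_succ s n \<longleftrightarrow> s = suc n"
  unfolding is_succ_def by (metis els_ins els_inject)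

lemma def_term_ins [definable_intros]:
  assumes "def_term s" "def_term t"
  shows "def_term (\<lambda>e. ins (s e) (t e))"
proof -
  have "e = ins x a \<longleftrightarrow> els e = insert x (els a)" for e x a
    by (metis els_ins els_inject)
  then show ?thesis
    unfolding def_term_def[of "\<lambda>e. ins (s e) (t e)"]
    by (simp only:) (intro definable_seteq def_set_els def_set_insert def_term_var def_term_shift assms)
qed

lemma is_inductive_iff: "is_inductive w \<longleftrightarrow> zero \<in> els w \<and> (\<forall>n\<in>els w. suc n \<in> els w)"
  unfolding is_inductive_def by auto

lemma is_nat_zero [simp]: "is_nat zero"
  by (simp add: is_nat_def is_inductive_iff mem_iff del: els_ins)

lemma is_nat_suc [simp]: "is_nat n \<Longrightarrow> is_nat (suc n)"
  by (simp add: is_nat_def is_inductive_iff mem_iff del: els_ins)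

lemma small_nat: "small {n. is_nat n}"
proof -
  obtain w where "is_inductive w" using infinity by blast
  then have "{n. is_nat n} \<subseteq> els w" unfolding is_nat_def by (auto simp: els_def)
  then show ?thesis by (rule small_subset[OF small_els]) (rule definable_intros)+
qed

definition omega :: 'a where "omega = set_of {n. is_nat n}"

lemma els_omega [simp]: "els omega = {n. is_nat n}"
  unfolding omega_def by (rule els_set_of[OF small_nat])

lemma is_omega_iff [simp]: "is_omega w \<longleftrightarrow> w = omega"
  unfolding is_omega_def by (metis els_omega els_inject)

text \<open>Separation turns \<open>P\<close> into a set, which is then inductive. Without
  definability the rule would fail: if omega of the model is nonstandard, a HOL predicate can single
  out its standard part.\<close>

lemma nat_induct [consumes 1, case_names definable zero suc]:
  assumes n: "is_nat n" and "definable (\<lambda>e. P (e 0))" and "P zero"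
    and suc: "\<And>n. is_nat n \<Longrightarrow> P n \<Longrightarrow> P (suc n)"
  shows "P n"
proof -
  obtain w where w: "els w = {n \<in> {n. is_nat n}. P n}"
    using small_sep[OF small_nat assms(2)] unfolding small_def by blast
  have "is_inductive w"
    unfolding is_inductive_iff w using assms(3) suc by simp
  then have "n \<in> els w" using n by (simp add: is_nat_def mem_iff)
  then show ?thesis by (simp add: w)
qed

lemma mem_irrefl [simp]: "x \<notin> els x"
proof
  assume "x \<in> els x"
  moreover obtain c where "els c = {x}" using small_single small_def by blast
  ultimately show False using foundation[of c] by auto
qed

lemma mem_asym: "x \<in> els y \<Longrightarrow> y \<notin> els x"
proof
  assume "x \<in> els y" "y \<in> els x"
  moreover obtain c where "els c = {x, y}" using small_pair small_def by blast
  ultimately show False using foundation[of c] by auto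
qed

lemma suc_inject [simp]: "suc a = suc b \<longleftrightarrow> a = b"
  by (metis els_ins insert_iff mem_asym)

lemma suc_neq_zero [simp]: "suc a \<noteq> zero" "zero \<noteq> suc a"
  by (metis els_ins els_zero insert_not_empty)+

lemma mem_suc [simp]: "m \<in> els (suc n) \<longleftrightarrow> m = n \<or> m \<in> els n"
  by simp

lemma nat_mem_nat:
  assumes "is_nat n" "m \<in> els n"
  shows "is_nat m"
proof -
  have "\<forall>m\<in>els n. is_nat m" using assms(1)
  proof (induction rule: nat_induct)
    case definable
    show ?case by (rule definable_intros)+
  qed auto
  then show ?thesis using assms(2) by blast
qed

lemma nat_trans:
  assumes "is_nat n" "m \<in> els n" "k \<in> els m"
  shows "k \<in> els n"
proof -
  have "\<forall>m\<in>els n. \<forall>k\<in>els m. k \<in> els n" using assms(1)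
  proof (induction rule: nat_induct)
    case definable
    show ?case by (rule definable_intros)+
  qed auto
  then show ?thesis using assms(2,3) by blast
qed

lemma suc_mem:
  assumes "is_nat n" "m \<in> els n"
  shows "suc m \<in> els n \<or> suc m = n"
proof -
  have "\<forall>m\<in>els n. suc m \<in> els n \<or> suc m = n" using assms(1)
  proof (induction rule: nat_induct)
    case definable
    show ?case by (rule definable_intros)+
  qed auto
  then show ?thesis using assms(2) by blast
qed

lemma zero_mem: "is_nat n \<Longrightarrow> n = zero \<or> zero \<in> els n"
proof (induction rule: nat_induct)
  case definable
  show ?case by (rule definable_intros)+
qed auto

lemma nat_linear:
  assumes "is_nat n" "is_nat m"
  shows "m \<in> els n \<or> m = n \<or> n \<in> els m"
proof -
  have "\<forall>m. is_nat m \<longrightarrow> m \<in> els n \<or> m = n \<or> n \<in> els m" using assms(1)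
  proof (induction rule: nat_induct)
    case definable
    show ?case by (rule definable_intros)+
  next
    case zero
    then show ?case using zero_mem by blast
  next
    case (suc n)
    then show ?case using suc_mem by auto
  qed
  then show ?thesis using assms(2) by blast
qed

lemma suc_mem_suc: "is_nat n \<Longrightarrow> suc m \<in> els (suc n) \<longleftrightarrow> m \<in> els n"
  using suc_mem[of n m] nat_trans[of n "suc m" m] by auto

text \<open>On natural numbers membership is the order, so foundation for the set of witnesses
  provides a least one.\<close>

lemma nat_least:
  assumes "is_nat n" "P n" "definable (\<lambda>e. P (e 0))"
  obtains m where "is_nat m" "P m" "\<And>k. k \<in> els m \<Longrightarrow> \<not> P k"
proof -
  obtain w where w: "els w = {n \<in> {n. is_nat n}. P n}"
    using small_sep[OF small_nat assms(3)] unfolding small_def by blast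
  then obtain m where "m \<in> els w" "els m \<inter> els w = {}"
    using foundation[of w] assms(1,2) by auto
  then show thesis using that[of m] nat_mem_nat unfolding w by blast
qed

section \<open>Finite sets of the model\<close>

lemma is_bij_iff:
  "is_bij f A B \<longleftrightarrow> is_fun f A B \<and> (\<forall>x x' y. maps_to f x y \<and> maps_to f x' y \<longrightarrow> x = x') \<and>
     (\<forall>y\<in>els B. \<exists>x. maps_to f x y)"
  by (simp add: is_bij_def is_inj_def)

lemma is_fun_dom: "is_fun f A B \<Longrightarrow> maps_to f x y \<Longrightarrow> x \<in> els A \<and> y \<in> els B"
  unfolding is_fun_def maps_to_iff by force

lemma is_fun_unique: "is_fun f A B \<Longrightarrow> maps_to f x y \<Longrightarrow> maps_to f x y' \<Longrightarrow> y = y'"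
  using is_fun_dom[of f A B x y] unfolding is_fun_def by blast

lemma is_fun_ex: "is_fun f A B \<Longrightarrow> x \<in> els A \<Longrightarrow> \<exists>y. maps_to f x y"
  unfolding is_fun_def by blast

text \<open>Finiteness in the sense of the model, transferred to HOL sets. It differs from
  \<open>finite\<close>: a nonstandard natural number has an externally infinite extension.\<close>

definition Fin :: "'a set \<Rightarrow> bool" where
  "Fin X \<longleftrightarrow> (\<exists>a. els a = X \<and> fin a)"

lemma Fin_els: "Fin (els a) \<longleftrightarrow> fin a"
  by (simp add: Fin_def)

lemma definable_Fin [definable_intros]:
  assumes "def_set S"
  shows "definable (\<lambda>e. Fin (S e))"
proof -
  have "definable (\<lambda>e. e 0 \<in> S (\<lambda>n. e (Suc n)))" using assms by (simp add: def_set_def)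
  from definable_rename[OF this, of "case_nat 0 (\<lambda>n. Suc (Suc n))"]
  have "def_set (\<lambda>e. S (\<lambda>n. e (Suc n)))"
    by (simp add: def_set_def inj_def split: nat.split)
  then show ?thesis unfolding Fin_def by (intro definable_ex definable_conj definable_seteq def_set_els definable_fin def_term_var)
qed

lemma Fin_small: "Fin X \<Longrightarrow> small X"
  unfolding Fin_def small_def by blast

lemma Fin_empty: "Fin {}"
proof -
  have "is_bij zero zero zero"
    by (simp add: is_bij_iff is_fun_def maps_to_iff)
  then show ?thesis unfolding Fin_def fin_def using is_nat_zero els_zero by blast
qed

lemma Fin_insert:
  assumes "Fin X"
  shows "Fin (insert x X)"
proof (cases "x \<in> X")
  case True
  then show ?thesis using assms by (simp add: insert_absorb)
next
  case False
  obtain a n f where a: "els a = X" and n: "is_nat n" and f: "is_bij f n a"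
    using assms unfolding Fin_def fin_def by blast
  have fn: "is_fun f n a" using f by (simp add: is_bij_iff)
  have "definable (\<lambda>e. (e 0 = n \<and> e 1 = x) \<or> maps_to f (e 0) (e 1))" by (rule definable_intros)+
  then obtain g where g: "\<And>i y. maps_to g i y \<longleftrightarrow>
      i \<in> els (suc n) \<and> y \<in> els (ins x a) \<and> (i = n \<and> y = x \<or> maps_to f i y)"
    and gf: "(\<forall>i\<in>els (suc n). \<exists>!y. y \<in> els (ins x a) \<and> (i = n \<and> y = x \<or> maps_to f i y))
       \<longrightarrow> is_fun g (suc n) (ins x a)"
    by (rule ex_fun[where R = "\<lambda>i y. (i = n \<and> y = x) \<or> maps_to f i y" and A = "suc n" and B = "ins x a"]) (rule that)
  have g: "maps_to g i y \<longleftrightarrow> i = n \<and> y = x \<or> maps_to f i y" for i y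
    unfolding g using is_fun_dom[OF fn] by auto
  have "is_fun g (suc n) (ins x a)"
  proof (rule gf[rule_format])
    fix i
    assume i: "i \<in> els (suc n)"
    show "\<exists>!y. y \<in> els (ins x a) \<and> (i = n \<and> y = x \<or> maps_to f i y)"
    proof (cases "i = n")
      case True
      have "\<not> maps_to f n y" for y using is_fun_dom[OF fn, of n y] by auto
      then show ?thesis using True by auto
    next
      case False
      then obtain y where "maps_to f i y" using is_fun_ex[OF fn] i by auto
      then show ?thesis using False is_fun_dom[OF fn] is_fun_unique[OF fn] by auto
    qed
  qed
  moreover have "\<forall>i i' y. maps_to g i y \<and> maps_to g i' y \<longrightarrow> i = i'"
    using f is_fun_dom[OF fn] False a unfolding g is_bij_iff by blast
  moreover have "\<forall>y\<in>els (ins x a). \<exists>i. maps_to g i y"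
    using f unfolding g is_bij_iff by auto
  ultimately have "is_bij g (suc n) (ins x a)" unfolding is_bij_iff by blast
  then have "fin (ins x a)" using n is_nat_suc unfolding fin_def by blast
  then show ?thesis unfolding Fin_def using a by (intro exI[of _ "ins x a"]) simp
qed

text \<open>Internal induction on the cardinality; the element removed in the step is the image of
  the last index \<open>n\<close>.\<close>

lemma Fin_induct [consumes 1, case_names definable empty insert]:
  assumes "Fin X" and definable_intros': "definable (\<lambda>e. P (els (e 0)))" and "P {}"
    and insert: "\<And>X x. Fin X \<Longrightarrow> x \<notin> X \<Longrightarrow> P X \<Longrightarrow> P (insert x X)"
  shows "P X"
proof -
  note [definable_intros] = definable_app1[OF definable_intros']
  have "\<forall>a f. is_bij f n a \<longrightarrow> P (els a)" if "is_nat n" for n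
    using that
  proof (induction rule: nat_induct)
    case definable
    show ?case by (rule definable_intros)+
  next
    case zero
    show ?case
    proof (intro allI impI)
      fix a f
      assume "is_bij f zero a"
      then have "els a = {}" unfolding is_bij_iff using is_fun_dom by fastforce
      then show "P (els a)" using \<open>P {}\<close> by (simp only:)
    qed
  next
    case (suc n)
    show ?case
    proof (intro allI impI)
      fix a f
      assume "is_bij f (suc n) a"
      then have fn: "is_fun f (suc n) a"
        and inj: "\<And>i i' y. maps_to f i y \<Longrightarrow> maps_to f i' y \<Longrightarrow> i = i'"
        and sur: "\<And>y. y \<in> els a \<Longrightarrow> \<exists>i. maps_to f i y" unfolding is_bij_iff by blast+
      obtain x where x: "maps_to f n x" using is_fun_ex[OF fn, of n] by auto
      have "small (els a - {x})"
        by (rule small_subset[OF small_els[of a]]) (blast, (rule definable_intros)+)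
      then obtain b where b: "els b = els a - {x}" unfolding small_def by blast
      have "definable (\<lambda>e. maps_to f (e 0) (e 1))" by (rule definable_intros)+
      then obtain g where g: "\<And>i y. maps_to g i y \<longleftrightarrow> i \<in> els n \<and> y \<in> els b \<and> maps_to f i y"
        and gf: "(\<forall>i\<in>els n. \<exists>!y. y \<in> els b \<and> maps_to f i y) \<longrightarrow> is_fun g n b"
        by (rule ex_fun[where R = "maps_to f" and A = n and B = b]) (rule that)
      have ne: "y \<noteq> x" if "i \<in> els n" "maps_to f i y" for i y
        using that inj[of i x n] x by auto
      have "is_fun g n b"
      proof (rule gf[rule_format])
        fix i
        assume i: "i \<in> els n"
        then obtain y where "maps_to f i y" using is_fun_ex[OF fn, of i] by auto
        then show "\<exists>!y. y \<in> els b \<and> maps_to f i y"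
          unfolding b using ne[OF i] is_fun_dom[OF fn] is_fun_unique[OF fn] by blast
      qed
      moreover have "\<forall>y\<in>els b. \<exists>i. maps_to g i y"
      proof
        fix y
        assume y: "y \<in> els b"
        then obtain i where i: "maps_to f i y" using sur b by blast
        then have "i \<in> els (suc n)" using is_fun_dom[OF fn] by blast
        moreover have "i \<noteq> n" using i x y b is_fun_unique[OF fn] by blast
        ultimately show "\<exists>i. maps_to g i y" using i y g by auto
      qed
      ultimately have bij: "is_bij g n b"
        unfolding is_bij_iff using g inj by blast
      then have "Fin (els b)" unfolding Fin_els fin_def using suc.hyps by blast
      moreover have "P (els b)" using bij suc.IH by blast
      moreover have "x \<notin> els b" by (simp add: b)
      ultimately have "P (insert x (els b))" by (intro insert)
      moreover have "insert x (els b) = els a" unfolding b using is_fun_dom[OF fn x] by blast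
      ultimately show "P (els a)" by (simp only:)
    qed
  qed
  then show ?thesis using assms(1) unfolding Fin_def fin_def by blast
qed

text \<open>Definability of \<open>X\<close> ensures that \<open>X\<close> is the extension of an
  element at all; an arbitrary HOL subset of a \<open>Fin\<close> set need not be. The induction is
  made over all elements below \<open>Y\<close> simultaneously.\<close>

lemma Fin_subset:
  assumes "Fin Y" "X \<subseteq> Y" "def_set (\<lambda>e. X)"
  shows "Fin X"
proof -
  have "\<forall>b. els b \<subseteq> Y \<longrightarrow> Fin (els b)" using assms(1)
  proof (induction rule: Fin_induct)
    case definable
    show ?case by (rule definable_intros)+
  next
    case empty
    show ?case using Fin_empty by auto
  next
    case (insert Y x)
    show ?case
    proof (intro allI impI)
      fix b
      assume b: "els b \<subseteq> insert x Y"
      have "small (els b - {x})"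
        by (rule small_subset[OF small_els[of b]]) (blast, (rule definable_intros)+)
      then obtain c where c: "els c = els b - {x}" unfolding small_def by blast
      then have "Fin (els c)" using b insert.IH by blast
      then have *: "Fin (insert x (els c))" by (rule Fin_insert)
      show "Fin (els b)"
      proof (cases "x \<in> els b")
        case True
        then have "insert x (els c) = els b" using c by blast
        then show ?thesis using * by (simp only:)
      next
        case False
        then have "els c = els b" using c by blast
        then show ?thesis using \<open>Fin (els c)\<close> by (simp only:)
      qed
    qed
  qed
  moreover have "small X" by (rule small_subset[OF Fin_small[OF assms(1)] assms(2,3)])
  ultimately show ?thesis using assms(2) unfolding small_def by blast
qed

lemma Fin_Un:
  assumes "Fin X" "Fin Y"
  shows "Fin (X \<union> Y)"
proof -
  note [definable_intros] = def_set_small[OF Fin_small[OF assms(2)]]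
  show ?thesis using assms(1)
  proof (induction rule: Fin_induct)
    case definable
    show ?case by (intro definable_intros)
  next
    case empty
    show ?case using assms(2) by simp
  next
    case (insert X x)
    then show ?case by (simp add: Fin_insert)
  qed
qed

lemma Fin_UN:
  assumes "Fin I" "\<And>i. i \<in> I \<Longrightarrow> Fin (X i)" "def_set (\<lambda>e. X (e 0))"
  shows "Fin (\<Union>i\<in>I. X i)"
proof -
  note def_set_app1[OF assms(3), definable_intros]
  have "(\<forall>i\<in>I. Fin (X i)) \<longrightarrow> Fin (\<Union>i\<in>I. X i)" using assms(1)
  proof (induction rule: Fin_induct)
    case definable
    show ?case by (rule definable_intros)+
  next
    case empty
    show ?case by (simp add: Fin_empty)
  next
    case (insert I i)
    then show ?case by (simp add: Fin_Un)
  qed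
  then show ?thesis using assms(2) by blast
qed

lemma Fin_image:
  assumes "Fin X" "def_term (\<lambda>e. F (e 0))"
  shows "Fin (F ` X)"
proof -
  have "Fin (\<Union>x\<in>X. {F x})"
    by (rule Fin_UN[OF assms(1)]) (auto intro: Fin_insert Fin_empty definable_intros assms)
  then show ?thesis by (simp add: UNION_singleton_eq_range)
qed

lemma Fin_Pow: "Fin X \<Longrightarrow> Fin {s. els s \<subseteq> X}"
proof (induction rule: Fin_induct)
  case definable
  show ?case by (rule definable_intros)+
next
  case empty
  have "{s. els s \<subseteq> {}} = {zero}" by auto
  then show ?case by (simp only: Fin_insert Fin_empty)
next
  case (insert X x)
  let ?P = "{s. els s \<subseteq> X}"
  have "Fin (?P \<union> ins x ` ?P)"
    by (intro Fin_Un Fin_image insert.IH) (rule definable_intros)+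
  moreover have "?P \<union> ins x ` ?P = {s. els s \<subseteq> insert x X}"
  proof (intro equalityI subsetI)
    fix s
    assume "s \<in> {s. els s \<subseteq> insert x X}"
    then have s: "els s \<subseteq> insert x X" by simp
    have "small (els s - {x})"
      by (rule small_subset[OF small_els[of s]]) (blast, (rule definable_intros)+)
    then obtain t where t: "els t = els s - {x}" unfolding small_def by blast
    show "s \<in> ?P \<union> ins x ` ?P"
    proof (cases "x \<in> els s")
      case True
      then have "els (ins x t) = els s" using t by auto
      then have "s = ins x t" by (metis els_inject)
      moreover have "els t \<subseteq> X" using s t by blast
      ultimately show ?thesis by simp
    qed (use s in auto)
  qed auto
  ultimately show ?case by simp
qed

lemma Fin_nat: "is_nat n \<Longrightarrow> Fin (els n)"
proof (induction rule: nat_induct)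
  case definable
  show ?case by (rule definable_intros)+
qed (simp_all add: Fin_empty Fin_insert)

lemma Fin_nats_bounded:
  assumes "Fin X" "\<And>n. n \<in> X \<Longrightarrow> is_nat n"
  obtains N where "is_nat N" "X \<subseteq> els N"
proof -
  have "(\<forall>n\<in>X. is_nat n) \<longrightarrow> (\<exists>N. is_nat N \<and> X \<subseteq> els N)" using assms(1)
  proof (induction rule: Fin_induct)
    case definable
    show ?case by (rule definable_intros)+
  next
    case empty
    show ?case using is_nat_zero by blast
  next
    case (insert X n)
    show ?case
    proof
      assume *: "\<forall>k\<in>insert n X. is_nat k"
      then obtain N where N: "is_nat N" "X \<subseteq> els N" using insert.IH by blast
      have "n \<in> els N \<or> n = N \<or> N \<in> els n" using nat_linear[of N n] N * by blast
      then show "\<exists>N. is_nat N \<and> insert n X \<subseteq> els N"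
      proof (elim disjE)
        assume "n \<in> els N" then show ?thesis using N by blast
      next
        assume "n = N"
        then have "is_nat (suc N) \<and> insert n X \<subseteq> els (suc N)" using N by auto
        then show ?thesis by blast
      next
        assume n: "N \<in> els n"
        then have "X \<subseteq> els n" using N nat_trans[of n N] * by blast
        then have "is_nat (suc n) \<and> insert n X \<subseteq> els (suc n)" using * by auto
        then show ?thesis by blast
      qed
    qed
  qed
  then show thesis using that assms(2) by blast
qed

lemma not_Fin_nat: "\<not> Fin {n. is_nat n}"
proof
  assume "Fin {n. is_nat n}"
  then obtain N where "is_nat N" "{n. is_nat n} \<subseteq> els N" by (rule Fin_nats_bounded) auto
  then show False using mem_irrefl by blast
qed

section \<open>Kernels of well-founded relations, well-orders, paths\<close>

lemma ex_small: "small X \<Longrightarrow> (\<And>a. els a = X \<Longrightarrow> thesis) \<Longrightarrow> thesis"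
  unfolding small_def by blast

text \<open>This is recursion along \<open>R\<close> in disguise: whether \<open>x\<close> belongs
  to \<open>K\<close> depends only on which of its \<open>R\<close>-predecessors do.
  Well-foundedness is required in its internal form, for small subsets.\<close>

lemma kernel:
  assumes X: "small X" and R: "definable (\<lambda>e. R (e 0) (e 1))"
    and wf: "\<And>S. small S \<Longrightarrow> S \<subseteq> X \<Longrightarrow> S \<noteq> {} \<Longrightarrow> \<exists>x\<in>S. \<forall>y\<in>S. \<not> R y x"
  obtains K where "els K \<subseteq> X" "\<And>x. x \<in> X \<Longrightarrow> x \<in> els K \<longleftrightarrow> (\<forall>y\<in>els K. \<not> R y x)"
proof -
  note [definable_intros] = definable_app2[OF R] def_set_small[OF X]
  (* Any two partial kernels, defined on R-closed subsets D of X, agree where both are defined. *)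
  define approx where "approx D K \<longleftrightarrow> els D \<subseteq> X \<and> (\<forall>x\<in>els D. \<forall>y\<in>X. R y x \<longrightarrow> y \<in> els D) \<and>
    els K \<subseteq> els D \<and> (\<forall>x\<in>els D. x \<in> els K \<longleftrightarrow> (\<forall>y\<in>els K. \<not> R y x))" for D K
  have "definable (\<lambda>e. approx (e 0) (e 1))"
    unfolding approx_def by (rule definable_intros)+
  note [definable_intros] = definable_app2[OF this]
  have asub: "approx D K \<Longrightarrow> x \<in> els D \<Longrightarrow> x \<in> X"
    and acl: "approx D K \<Longrightarrow> x \<in> els D \<Longrightarrow> y \<in> X \<Longrightarrow> R y x \<Longrightarrow> y \<in> els D"
    and aK: "approx D K \<Longrightarrow> x \<in> els K \<Longrightarrow> x \<in> els D"
    and aiff: "approx D K \<Longrightarrow> x \<in> els D \<Longrightarrow> x \<in> els K \<longleftrightarrow> (\<forall>y\<in>els K. \<not> R y x)" for D K x y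
    unfolding approx_def by blast+
  have agree: "x \<in> els K \<longleftrightarrow> x \<in> els K'"
    if D: "approx D K" "approx D' K'" and x: "x \<in> els D" "x \<in> els D'" for D K D' K' x
  proof (rule ccontr)
    let ?S = "{x. x \<in> els D \<and> x \<in> els D' \<and> (x \<in> els K \<longleftrightarrow> x \<notin> els K')}"
    assume "\<not> ?thesis"
    then have "?S \<noteq> {}" using x by blast
    moreover have "small ?S"
      by (rule small_subset[OF small_els[of D]]) (blast, (rule definable_intros)+)
    moreover have "?S \<subseteq> X" using D(1) unfolding approx_def by blast
    ultimately obtain m where m: "m \<in> ?S" "\<forall>y\<in>?S. \<not> R y m" using wf[of ?S] by blast
    have mD: "m \<in> els D" "m \<in> els D'" using m(1) by blast+
    \<comment> \<open>Both domains are closed under \<open>R\<close>-predecessors in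
      \<open>X\<close>. So a predecessor missing from one of them is outside \<open>X\<close> and
      belongs to neither kernel.\<close>
    have "y \<in> els K \<longleftrightarrow> y \<in> els K'" if "R y m" for y
    proof (cases "y \<in> els D \<and> y \<in> els D'")
      case True
      then show ?thesis using m(2) that by blast
    next
      case False
      then have "y \<notin> X" using acl[OF D(1) mD(1) _ that] acl[OF D(2) mD(2) _ that] by blast
      then show ?thesis using aK asub D by metis
    qed
    then have "m \<in> els K \<longleftrightarrow> m \<in> els K'"
      unfolding aiff[OF D(1) mD(1)] aiff[OF D(2) mD(2)] by metis
    then show False using m(1) by blast
  qed
  have "small {x \<in> X. \<exists>D K. approx D K \<and> x \<in> els D}" "small {x \<in> X. \<exists>D K. approx D K \<and> x \<in> els K}"
    by (rule small_sep[OF X], (rule definable_intros)+)+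
  then obtain D K where D: "els D = {x \<in> X. \<exists>D K. approx D K \<and> x \<in> els D}"
    and K: "els K = {x \<in> X. \<exists>D K. approx D K \<and> x \<in> els K}"
    unfolding small_def by blast
  have DI: "x \<in> els D" if "approx D' K'" "x \<in> els D'" for D' K' x
    using that asub unfolding D by blast
  have KI: "x \<in> els K \<longleftrightarrow> x \<in> els K'" if "approx D' K'" "x \<in> els D'" for D' K' x
  proof
    show "x \<in> els K" if "x \<in> els K'"
      using that \<open>approx D' K'\<close> \<open>x \<in> els D'\<close> asub unfolding K by blast
    assume "x \<in> els K"
    then obtain D'' K'' where "approx D'' K''" "x \<in> els K''" unfolding K by blast
    then show "x \<in> els K'" using agree[OF _ that(1) _ that(2)] aK by blast
  qed
  have DK: "approx D K"
    unfolding approx_def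
  proof (intro conjI ballI impI)
    show "els D \<subseteq> X" unfolding D by blast
    show "els K \<subseteq> els D" unfolding D K using aK by blast
    show "y \<in> els D" if x: "x \<in> els D" and y: "y \<in> X" "R y x" for x y
    proof -
      obtain D' K' where D': "approx D' K'" "x \<in> els D'" using x unfolding D by blast
      show ?thesis using DI[OF D'(1)] acl[OF D' y] by blast
    qed
    fix x
    assume "x \<in> els D"
    then obtain D' K' where D': "approx D' K'" "x \<in> els D'" unfolding D by blast
    have "y \<in> els K \<longleftrightarrow> y \<in> els K'" if "R y x" for y
    proof (cases "y \<in> els D'")
      case True
      then show ?thesis by (rule KI[OF D'(1)])
    next
      case False
      then have "y \<notin> X" using acl[OF D' _ that] by blast
      then show ?thesis using aK[OF D'(1)] False unfolding K by blast
    qed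
    then show "x \<in> els K \<longleftrightarrow> (\<forall>y\<in>els K. \<not> R y x)"
      unfolding KI[OF D'] aiff[OF D'] by metis
  qed
  have "els D = X"
  proof (rule ccontr)
    \<comment> \<open>An \<open>R\<close>-minimal point outside \<open>D\<close> has all its
      predecessors from \<open>X\<close> in \<open>D\<close>, so the glued kernel could be extended
      by it.\<close>
    assume "els D \<noteq> X"
    then have "X - els D \<noteq> {}" using D by blast
    moreover have "small (X - els D)"
      by (rule small_subset[OF X]) (blast, (rule definable_intros)+)
    ultimately obtain x where x: "x \<in> X" "x \<notin> els D" "\<forall>y\<in>X - els D. \<not> R y x"
      using wf[of "X - els D"] by blast
    have "small (els K \<union> {y. y = x \<and> (\<forall>z\<in>els K. \<not> R z x)})"
      by (rule small_subset[OF small_insert[OF small_els[of K], of x]]) (blast, (rule definable_intros)+)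
    then obtain K' where K': "els K' = els K \<union> {y. y = x \<and> (\<forall>z\<in>els K. \<not> R z x)}"
      by (rule ex_small)
    have "approx (ins x D) K'"
      unfolding approx_def els_ins
    proof (intro conjI ballI impI)
      \<comment> \<open>\<open>x\<close> precedes nothing in \<open>D\<close>, which is closed, and
        by minimality it does not precede itself. Adding \<open>x\<close> to the kernel therefore
        alters no earlier verdict.\<close>
      have nR: "\<not> R x z" if "z \<in> insert x (els D)" for z
        using that x acl[OF DK _ x(1)] by blast
      show "insert x (els D) \<subseteq> X" using x(1) asub[OF DK] by blast
      show "els K' \<subseteq> insert x (els D)" using aK[OF DK] unfolding K' by blast
      show "z \<in> insert x (els D)" if "y \<in> insert x (els D)" "z \<in> X" "R z y" for y z
        using that x(3) acl[OF DK] by blast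
      show "z \<in> els K' \<longleftrightarrow> (\<forall>y\<in>els K'. \<not> R y z)" if z: "z \<in> insert x (els D)" for z
      proof -
        have "(\<forall>y\<in>els K'. \<not> R y z) \<longleftrightarrow> (\<forall>y\<in>els K. \<not> R y z)"
          using nR[OF z] unfolding K' by blast
        moreover have "z \<in> els K' \<longleftrightarrow> (\<forall>y\<in>els K. \<not> R y z)"
          using z x(2) aK[OF DK] aiff[OF DK] unfolding K' by blast
        ultimately show ?thesis by blast
      qed
    qed
    then have "x \<in> els D" by (rule DI) simp
    then show False using x(2) by blast
  qed
  then show thesis using that[of K] aK[OF DK] aiff[OF DK] by blast
qed

section \<open>Definable well-orders\<close>

definition wo :: "'a set \<Rightarrow> ('a \<Rightarrow> 'a \<Rightarrow> bool) \<Rightarrow> bool" where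
  "wo X lt \<longleftrightarrow> definable (\<lambda>e. lt (e 0) (e 1)) \<and>
     (\<forall>S. small S \<and> S \<subseteq> X \<and> S \<noteq> {} \<longrightarrow> (\<exists>x\<in>S. \<forall>y\<in>S. \<not> lt y x \<and> (y \<noteq> x \<longrightarrow> lt x y)))"

lemma wo_min:
  "wo X lt \<Longrightarrow> small S \<Longrightarrow> S \<subseteq> X \<Longrightarrow> S \<noteq> {} \<Longrightarrow> \<exists>x\<in>S. \<forall>y\<in>S. \<not> lt y x \<and> (y \<noteq> x \<longrightarrow> lt x y)"
  unfolding wo_def by simp

text \<open>The least elements provided by \<open>wo\<close> are strictly below all others, so the
  order axioms for \<open>lt\<close> can be read off from sets with two or three elements.\<close>

lemma wo_asym:
  assumes "wo X lt" "x \<in> X" "y \<in> X" "lt x y"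
  shows "\<not> lt y x" "x \<noteq> y"
proof -
  obtain m where "m \<in> {x, y}" "\<forall>w\<in>{x, y}. \<not> lt w m \<and> (w \<noteq> m \<longrightarrow> lt m w)"
    using wo_min[OF assms(1) small_pair[of x y]] assms(2,3) by auto
  then show "\<not> lt y x" "x \<noteq> y" using assms(4) by auto
qed

lemma wo_linear:
  assumes "wo X lt" "x \<in> X" "y \<in> X"
  shows "lt x y \<or> x = y \<or> lt y x"
proof -
  obtain m where "m \<in> {x, y}" "\<forall>w\<in>{x, y}. \<not> lt w m \<and> (w \<noteq> m \<longrightarrow> lt m w)"
    using wo_min[OF assms(1) small_pair[of x y]] assms(2,3) by auto
  then show ?thesis by auto
qed

lemma wo_trans:
  assumes "wo X lt" "x \<in> X" "y \<in> X" "z \<in> X" "lt x y" "lt y z"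
  shows "lt x z"
proof -
  have "small {x, y, z}" by (intro small_insert small_single)
  then obtain m where m: "m \<in> {x, y, z}" "\<forall>w\<in>{x, y, z}. \<not> lt w m \<and> (w \<noteq> m \<longrightarrow> lt m w)"
    using wo_min[OF assms(1), of "{x, y, z}"] assms(2-4) by auto
  then have "m = x" using assms(5,6) by auto
  moreover have "z \<noteq> x" using wo_asym(1)[OF assms(1-3,5)] assms(6) by auto
  ultimately show ?thesis using m by simp
qed

lemma wo_least:
  assumes "wo X lt" "small X" "definable (\<lambda>e. P (e 0))" "x \<in> X" "P x"
  obtains m where "m \<in> X" "P m" "\<And>y. y \<in> X \<Longrightarrow> P y \<Longrightarrow> \<not> lt y m \<and> (y \<noteq> m \<longrightarrow> lt m y)"
proof -
  have "small {x \<in> X. P x}" by (rule small_sep[OF assms(2,3)])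
  moreover have "{x \<in> X. P x} \<noteq> {}" "{x \<in> X. P x} \<subseteq> X" using assms by blast+
  ultimately obtain m where "m \<in> {x \<in> X. P x}" "\<forall>y\<in>{x \<in> X. P x}. \<not> lt y m \<and> (y \<noteq> m \<longrightarrow> lt m y)"
    using wo_min[OF assms(1), of "{x \<in> X. P x}"] by auto
  then show thesis using that[of m] by simp
qed

lemma wo_Df: "wo X lt \<Longrightarrow> definable (\<lambda>e. lt (e 0) (e 1))"
  unfolding wo_def by blast

section \<open>Adjacency, paths and connectedness\<close>

lemma adj_sym: "adj E x y \<Longrightarrow> adj E y x"
  unfolding adj_def by (simp add: insert_commute)

lemma adj_graph:
  assumes "is_graph V E" "adj E x y"
  shows "x \<in> els V" "y \<in> els V" "x \<noteq> y"
  using assms unfolding is_graph_def adj_def by (metis doubleton_eq_iff)+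

lemma is_path_iff:
  "is_path V E n p x y \<longleftrightarrow> is_nat n \<and> is_inj p (suc n) V \<and> maps_to p zero x \<and> maps_to p n y \<and>
     (\<forall>i u v. i \<in> els n \<and> maps_to p i u \<and> maps_to p (suc i) v \<longrightarrow> adj E u v)"
  unfolding is_path_def by (auto simp: mem_iff)

lemma definable_is_path [definable_intros]:
  assumes "def_term n" "def_term p" "def_term y"
  shows "definable (\<lambda>e. is_path V E (n e) (p e) x (y e))"
proof -
  have "definable (\<lambda>e. is_path V E (e 0) (e 1) x (e 2))"
    unfolding is_path_iff by (rule definable_intros)+
  from definable_app3[where P = "\<lambda>n p y. is_path V E n p x y", OF this assms] show ?thesis .
qed

lemma inj_restrict:
  assumes "is_inj p A V" "els B \<subseteq> els A"
  obtains q where "is_inj q B V" "\<And>j y. maps_to q j y \<longleftrightarrow> j \<in> els B \<and> maps_to p j y"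
proof -
  have fn: "is_fun p A V" and inj: "\<And>i i' y. maps_to p i y \<Longrightarrow> maps_to p i' y \<Longrightarrow> i = i'"
    using assms(1) unfolding is_inj_def by blast+
  have "definable (\<lambda>e. maps_to p (e 0) (e 1))" by (rule definable_intros)+
  then obtain q where q: "\<And>j y. maps_to q j y \<longleftrightarrow> j \<in> els B \<and> y \<in> els V \<and> maps_to p j y"
    and qf: "(\<forall>j\<in>els B. \<exists>!y. y \<in> els V \<and> maps_to p j y) \<longrightarrow> is_fun q B V"
    by (rule ex_fun[where R = "maps_to p" and A = B and B = V]) (rule that)
  have "is_fun q B V"
  proof (rule qf[rule_format])
    fix j
    assume "j \<in> els B"
    then obtain y where "maps_to p j y" using is_fun_ex[OF fn] assms(2) by blast
    then show "\<exists>!y. y \<in> els V \<and> maps_to p j y"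
      using is_fun_dom[OF fn] is_fun_unique[OF fn] by blast
  qed
  moreover have "maps_to q j y \<longleftrightarrow> j \<in> els B \<and> maps_to p j y" for j y
    unfolding q using is_fun_dom[OF fn] by blast
  ultimately show thesis using that[of q] inj unfolding is_inj_def by blast
qed

lemma path_restrict:
  assumes p: "is_path V E n p x y" and i: "i \<in> els (suc n)" "maps_to p i u"
  shows "\<exists>q. is_path V E i q x u"
proof -
  have n: "is_nat n" using p is_path_iff by blast
  then have "is_nat i" using i nat_mem_nat[of "suc n" i] by simp
  have sub: "els (suc i) \<subseteq> els (suc n)" using i nat_trans[of "suc n" i] n by auto
  obtain q where q: "is_inj q (suc i) V" "\<And>j y. maps_to q j y \<longleftrightarrow> j \<in> els (suc i) \<and> maps_to p j y"
    using inj_restrict[OF _ sub, of p V] p is_path_iff by blast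
  have "zero \<in> els (suc i)" using zero_mem[OF \<open>is_nat i\<close>] by auto
  moreover have "adj E u v" if "j \<in> els i" "maps_to q j u" "maps_to q (suc j) v" for j u v
    using that sub p nat_trans[of n i j] n i unfolding is_path_iff q(2) by auto
  ultimately have "is_path V E i q x u"
    using p i \<open>is_nat i\<close> unfolding is_path_iff by (auto simp: q)
  then show ?thesis by blast
qed

lemma path_zero:
  assumes "x \<in> els V"
  shows "\<exists>p. is_path V E zero p x x"
proof -
  have "definable (\<lambda>e. e 1 = x)" by (rule definable_intros)+
  then obtain p where p: "\<And>i y. maps_to p i y \<longleftrightarrow> i \<in> els (suc zero) \<and> y \<in> els V \<and> y = x"
    and pf: "(\<forall>i\<in>els (suc zero). \<exists>!y. y \<in> els V \<and> y = x) \<longrightarrow> is_fun p (suc zero) V"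
    by (rule ex_fun[where R = "\<lambda>i y. y = x" and A = "suc zero" and B = V]) (rule that)
  have "is_path V E zero p x x"
    unfolding is_path_iff is_inj_def using pf assms by (auto simp: p)
  then show ?thesis by blast
qed

text \<open>Paths are injective, so if \<open>v\<close> already lies on \<open>p\<close>, the path
  is cut off there instead of being extended. Hence the length is only bounded by
  \<open>n + 1\<close>.\<close>

lemma path_extend:
  assumes g: "is_graph V E" and p: "is_path V E n p x u" and uv: "adj E u v"
  shows "\<exists>m q. m \<in> els (suc (suc n)) \<and> is_path V E m q x v"
proof (cases "\<exists>i. maps_to p i v")
  case True
  then obtain i where i: "maps_to p i v" by blast
  then have "i \<in> els (suc n)" using p is_fun_dom unfolding is_path_iff is_inj_def by blast
  then show ?thesis using path_restrict[OF p _ i] by auto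
next
  case False
  have n: "is_nat n" and fn: "is_fun p (suc n) V" and inj: "is_inj p (suc n) V"
    using p unfolding is_path_iff is_inj_def by blast+
  have v: "v \<in> els V" using adj_graph[OF g uv] by blast
  have "definable (\<lambda>e. maps_to p (e 0) (e 1) \<or> (e 0 = suc n \<and> e 1 = v))" by (rule definable_intros)+
  then obtain q where q: "\<And>i y. maps_to q i y \<longleftrightarrow>
      i \<in> els (suc (suc n)) \<and> y \<in> els V \<and> (maps_to p i y \<or> (i = suc n \<and> y = v))"
    and qf: "(\<forall>i\<in>els (suc (suc n)). \<exists>!y. y \<in> els V \<and> (maps_to p i y \<or> (i = suc n \<and> y = v)))
      \<longrightarrow> is_fun q (suc (suc n)) V"
    by (rule ex_fun[where R = "\<lambda>i y. maps_to p i y \<or> (i = suc n \<and> y = v)" and A = "suc (suc n)" and B = V])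
       (rule that)
  have q: "maps_to q i y \<longleftrightarrow> maps_to p i y \<or> (i = suc n \<and> y = v)" for i y
    unfolding q using is_fun_dom[OF fn] v by auto
  have top: "\<not> maps_to p (suc n) y" for y using is_fun_dom[OF fn, of "suc n" y] mem_irrefl by blast
  have "is_fun q (suc (suc n)) V"
  proof (rule qf[rule_format])
    fix i
    assume i: "i \<in> els (suc (suc n))"
    show "\<exists>!y. y \<in> els V \<and> (maps_to p i y \<or> (i = suc n \<and> y = v))"
    proof (cases "i = suc n")
      case True
      then show ?thesis using top v by auto
    next
      case False
      then obtain y where "maps_to p i y" using is_fun_ex[OF fn, of i] i by auto
      then show ?thesis using False is_fun_dom[OF fn] is_fun_unique[OF fn] by blast
    qed
  qed
  then have qi: "is_inj q (suc (suc n)) V"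
    using inj False unfolding is_inj_def q by blast
  have "adj E w z" if "i \<in> els (suc n)" "maps_to q i w" "maps_to q (suc i) z" for i w z
  proof (cases "i = n")
    case True
    then have "w = u" "z = v"
      using that is_fun_unique[OF fn] p top unfolding q is_path_iff by auto
    then show ?thesis using uv by simp
  next
    case False
    then have "i \<in> els n" using that(1) by simp
    moreover have "i \<noteq> suc n" using that(1) mem_irrefl by metis
    then have "maps_to p i w" "maps_to p (suc i) z"
      using that False unfolding q by auto
    ultimately show ?thesis using p unfolding is_path_iff by blast
  qed
  then have "is_path V E (suc n) q x v"
    using p n qi unfolding is_path_iff q by auto
  then show ?thesis by auto
qed

lemma path_last:
  assumes "is_path V E (suc n) p x v" "is_nat n"
  shows "\<exists>q u. is_path V E n q x u \<and> adj E u v"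
proof -
  have "is_fun p (suc (suc n)) V" and v: "maps_to p (suc n) v"
    and step: "\<And>i u v. i \<in> els (suc n) \<Longrightarrow> maps_to p i u \<Longrightarrow> maps_to p (suc i) v \<Longrightarrow> adj E u v"
    using assms unfolding is_path_iff is_inj_def by blast+
  then obtain u where u: "maps_to p n u" using is_fun_ex[of p "suc (suc n)" V n] by auto
  then have "adj E u v" using step[of n] v by simp
  moreover have "\<exists>q. is_path V E n q x u" by (rule path_restrict[OF assms(1) _ u]) simp
  ultimately show ?thesis by blast
qed

lemma connected_closed:
  assumes "connected V E" "x \<in> els V" "x \<in> S" "def_set (\<lambda>e. S)"
    and closed: "\<And>u v. u \<in> S \<Longrightarrow> adj E u v \<Longrightarrow> v \<in> S"
  shows "els V \<subseteq> S"
proof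
  fix y
  assume "y \<in> els V"
  then obtain n p where p: "is_path V E n p x y" using assms(1,2) unfolding connected_def by blast
  then have n: "is_nat n" and fn: "is_fun p (suc n) V" unfolding is_path_iff is_inj_def by blast+
  have "definable (\<lambda>e. e 0 \<in> S)" by (intro definable_intros assms)
  note [definable_intros] = definable_app1[where P = "\<lambda>x. x \<in> S", OF this]
  have "i \<in> els (suc n) \<longrightarrow> (\<forall>u. maps_to p i u \<longrightarrow> u \<in> S)" if "is_nat i" for i using that
  proof (induction rule: nat_induct)
    case definable
    show ?case by (rule definable_intros)+
  next
    case zero
    then show ?case using p is_fun_unique[OF fn] assms(3) unfolding is_path_iff by blast
  next
    case (suc i)
    show ?case
    proof (intro impI allI)
      fix v
      assume i: "suc i \<in> els (suc n)" and v: "maps_to p (suc i) v"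
      then have "i \<in> els n" using suc_mem_suc[OF n] by blast
      moreover then obtain u where u: "maps_to p i u" using is_fun_ex[OF fn, of i] by auto
      ultimately have "adj E u v" "u \<in> S" using p v suc.IH unfolding is_path_iff by auto
      then show "v \<in> S" by (rule closed[rotated])
    qed
  qed
  then show "y \<in> S" using n p unfolding is_path_iff by auto
qed

text \<open>The vertices reachable from \<open>x\<close> form a small set closed under adjacency.
  This spares the explicit construction of paths in the graphs built later.\<close>

lemma connectedI:
  assumes g: "is_graph V E"
    and closed: "\<And>S. \<lbrakk>S \<subseteq> els V; small S; S \<noteq> {}; \<forall>u\<in>S. \<forall>v. adj E u v \<longrightarrow> v \<in> S\<rbrakk> \<Longrightarrow> els V \<subseteq> S"
  shows "connected V E"
  unfolding connected_def
proof (intro ballI)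
  fix x y
  assume x: "x \<in> els V" and y: "y \<in> els V"
  let ?S = "{v. v \<in> els V \<and> (\<exists>n p. is_path V E n p x v)}"
  have "els V \<subseteq> ?S"
  proof (rule closed)
    show "small ?S" by (rule small_subset[OF small_els[of V]]) (blast, (rule definable_intros)+)
    show "?S \<noteq> {}" using path_zero x by blast
    show "\<forall>u\<in>?S. \<forall>v. adj E u v \<longrightarrow> v \<in> ?S"
      using path_extend[OF g] adj_graph[OF g] by blast
  qed blast
  then show "\<exists>n p. is_path V E n p x y" using y by blast
qed

section \<open>Partial choice well-orders a graph\<close>

text \<open>
  Here and below, \<open>n \<in> els (suc m)\<close> says \<open>n \<le> m\<close>.
\<close>

definition chooses :: "('a \<Rightarrow> 'a \<Rightarrow> bool) \<Rightarrow> ('a \<Rightarrow> 'a \<Rightarrow> bool) \<Rightarrow> bool" where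
  "chooses A c \<longleftrightarrow> definable (\<lambda>e. c (e 0) (e 1)) \<and>
     (\<forall>n x y. is_nat n \<longrightarrow> c n x \<longrightarrow> c n y \<longrightarrow> x = y) \<and>
     (\<forall>n x. is_nat n \<longrightarrow> c n x \<longrightarrow> A n x) \<and>
     (\<forall>n. is_nat n \<longrightarrow> (\<exists>m x. is_nat m \<and> n \<in> els (suc m) \<and> c m x))"

lemma choosesI:
  assumes "definable (\<lambda>e. c (e 0) (e 1))" "\<And>n x y. is_nat n \<Longrightarrow> c n x \<Longrightarrow> c n y \<Longrightarrow> x = y"
    "\<And>n x. is_nat n \<Longrightarrow> c n x \<Longrightarrow> A n x"
    "\<And>n. is_nat n \<Longrightarrow> \<exists>m x. is_nat m \<and> n \<in> els (suc m) \<and> c m x"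
  shows "\<exists>c. chooses A c"
  unfolding chooses_def using assms by (intro exI[of _ c]) presburger

text \<open>\<open>A\<close> ranges over definable relations rather than elements of the model.
  Since each \<open>A n\<close> is a finite set, replacement makes the sequence an element, so this
  is still a statement about the sequences of the model.\<close>

definition partial_choice :: bool where
  "partial_choice \<longleftrightarrow>
     (\<forall>A. definable (\<lambda>e. A (e 0) (e 1)) \<longrightarrow> (\<forall>n. is_nat n \<longrightarrow> Fin {x. A n x} \<and> (\<exists>x. A n x)) \<longrightarrow>
       (\<exists>c. chooses A c))"

lemma partial_choiceE:
  assumes partial_choice "definable (\<lambda>e. A (e 0) (e 1))"
    and A: "\<And>n. is_nat n \<Longrightarrow> Fin {x. A n x}" "\<And>n. is_nat n \<Longrightarrow> \<exists>x. A n x"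
  obtains c where "definable (\<lambda>e. c (e 0) (e 1))"
    "\<And>n x y. is_nat n \<Longrightarrow> c n x \<Longrightarrow> c n y \<Longrightarrow> x = y"
    "\<And>n x. is_nat n \<Longrightarrow> c n x \<Longrightarrow> A n x"
    "\<And>n. is_nat n \<Longrightarrow> \<exists>m x. is_nat m \<and> n \<in> els (suc m) \<and> c m x"
proof -
  have "\<forall>n. is_nat n \<longrightarrow> Fin {x. A n x} \<and> (\<exists>x. A n x)" using A by simp
  note ex = mp[OF mp[OF spec[OF assms(1)[unfolded partial_choice_def], of A] assms(2)] this]
  show thesis
  proof (rule exE[OF ex], unfold chooses_def, elim conjE)
    fix c
    assume "definable (\<lambda>e. c (e 0) (e 1))" "\<forall>n x y. is_nat n \<longrightarrow> c n x \<longrightarrow> c n y \<longrightarrow> x = y"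
      "\<forall>n x. is_nat n \<longrightarrow> c n x \<longrightarrow> A n x"
      "\<forall>n. is_nat n \<longrightarrow> (\<exists>m x. is_nat m \<and> n \<in> els (suc m) \<and> c m x)"
    then show thesis using that[of c] by presburger
  qed
qed

text \<open>
  A linear ordering of \<open>X\<close> is encoded by a set \<open>c\<close> of initial segments, so that the orderings of
  \<open>X\<close> lie in the power set of the power set of \<open>X\<close>.
\<close>

definition chain_less :: "'a \<Rightarrow> 'a \<Rightarrow> 'a \<Rightarrow> bool" where
  "chain_less c u v \<longleftrightarrow> (\<exists>s\<in>els c. u \<in> els s \<and> v \<notin> els s)"

definition chain_wo :: "'a set \<Rightarrow> 'a \<Rightarrow> bool" where
  "chain_wo X c \<longleftrightarrow> els c \<subseteq> {s. els s \<subseteq> X} \<and>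
     (\<forall>S. els S \<subseteq> X \<and> els S \<noteq> {} \<longrightarrow>
        (\<exists>x\<in>els S. \<forall>y\<in>els S. \<not> chain_less c y x \<and> (y \<noteq> x \<longrightarrow> chain_less c x y)))"

lemma definable_chain_less [definable_intros]: "def_term s \<Longrightarrow> def_term t \<Longrightarrow> def_term u \<Longrightarrow> definable (\<lambda>e. chain_less (s e) (t e) (u e))"
  by (rule definable_app3) (unfold chain_less_def, (rule definable_intros)+)

lemma chain_wo_less: "chain_wo X c \<Longrightarrow> chain_less c u v \<Longrightarrow> u \<in> X"
  unfolding chain_wo_def chain_less_def by blast

text \<open>Adding \<open>X\<close> itself as an initial segment keeps the order on \<open>X\<close>
  and puts the new point \<open>x\<close> last.\<close>

lemma Fin_chain_wo_ex: "Fin X \<Longrightarrow> \<exists>c. chain_wo X c"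
proof (induction rule: Fin_induct)
  case definable
  show ?case unfolding chain_wo_def by (rule definable_intros)+
next
  case empty
  have "chain_wo {} zero" unfolding chain_wo_def by simp
  then show ?case by blast
next
  case (insert X x)
  then obtain c where c: "chain_wo X c" by blast
  obtain a where a: "els a = X" by (rule ex_small[OF Fin_small[OF insert.hyps(1)]])
  have ch: "chain_less (ins a c) u v \<longleftrightarrow> (u \<in> X \<and> v \<notin> X) \<or> chain_less c u v" for u v
    unfolding chain_less_def els_ins by (simp add: a)
  have "chain_wo (insert x X) (ins a c)"
    unfolding chain_wo_def
  proof (intro conjI allI impI)
    show "els (ins a c) \<subseteq> {s. els s \<subseteq> insert x X}"
      using c a unfolding chain_wo_def els_ins by auto
    fix S
    assume S: "els S \<subseteq> insert x X \<and> els S \<noteq> {}"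
    show "\<exists>m\<in>els S. \<forall>y\<in>els S. \<not> chain_less (ins a c) y m \<and> (y \<noteq> m \<longrightarrow> chain_less (ins a c) m y)"
    proof (cases "els S = {x}")
      case True
      have "\<not> chain_less (ins a c) x x" unfolding ch using chain_wo_less[OF c, of x x] insert.hyps(2) by auto
      then show ?thesis using True by simp
    next
      case False
      have "small (els S - {x})"
        by (rule small_subset[OF small_els[of S]]) (blast, (rule definable_intros)+)
      then obtain T where T: "els T = els S - {x}" by (rule ex_small)
      then have "els T \<noteq> {}" using False S by blast
      moreover have TX: "els T \<subseteq> X" using S unfolding T by blast
      ultimately obtain m where m: "m \<in> els T"
        "\<And>y. y \<in> els T \<Longrightarrow> \<not> chain_less c y m \<and> (y \<noteq> m \<longrightarrow> chain_less c m y)"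
        using c unfolding chain_wo_def by metis
      have mX: "m \<in> X" using m(1) TX by blast
      have "\<not> chain_less (ins a c) y m \<and> (y \<noteq> m \<longrightarrow> chain_less (ins a c) m y)" if "y \<in> els S" for y
      proof (cases "y = x")
        case True
        then show ?thesis using mX insert.hyps(2) chain_wo_less[OF c, of x m] unfolding ch by auto
      next
        case False
        then have "y \<in> els T" using that T by blast
        then have "y \<in> X" using TX by blast
        then show ?thesis using m(2)[OF \<open>y \<in> els T\<close>] mX unfolding ch by auto
      qed
      moreover have "m \<in> els S" using m(1) unfolding T by blast
      ultimately show ?thesis by blast
    qed
  qed
  then show ?case by blast
qed

section \<open>Balls and distance levels around a vertex\<close>

definition ball :: "'a \<Rightarrow> 'a \<Rightarrow> 'a \<Rightarrow> 'a \<Rightarrow> 'a set" where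
  "ball V E x n = {v. \<exists>m\<in>els (suc n). \<exists>p. is_path V E m p x v}"

lemma def_set_ball [definable_intros]: "def_term t \<Longrightarrow> def_set (\<lambda>e. ball V E x (t e))"
  by (rule def_set_app1) (unfold ball_def, (rule definable_intros)+)

definition least_nat :: "('a \<Rightarrow> bool) \<Rightarrow> 'a \<Rightarrow> bool" where
  "least_nat P n \<longleftrightarrow> is_nat n \<and> P n \<and> (\<forall>m\<in>els n. \<not> P m)"

lemma least_nat_unique: "least_nat P n \<Longrightarrow> least_nat P m \<Longrightarrow> n = m"
  unfolding least_nat_def using nat_linear[of n m] by blast

lemma least_nat_ex: "is_nat n \<Longrightarrow> P n \<Longrightarrow> definable (\<lambda>e. P (e 0)) \<Longrightarrow> \<exists>m. least_nat P m"
  unfolding least_nat_def by (rule nat_least[of n P]) auto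

text \<open>The graph distance from \<open>x\<close>, written as a relation.\<close>

definition level :: "'a \<Rightarrow> 'a \<Rightarrow> 'a \<Rightarrow> 'a \<Rightarrow> 'a \<Rightarrow> bool" where
  "level V E x v n \<longleftrightarrow> least_nat (\<lambda>n. v \<in> ball V E x n) n"

lemma definable_level [definable_intros]: "def_term s \<Longrightarrow> def_term t \<Longrightarrow> definable (\<lambda>e. level V E x (s e) (t e))"
  by (rule definable_app2) (unfold level_def least_nat_def, (rule definable_intros)+)

context
  fixes V E x0
  assumes G: "inf_lf_conn_graph V E" and x0: "x0 \<in> els V"
begin

lemma graph: "is_graph V E" and conn: "connected V E" and inf: "\<not> Fin (els V)"
  using G unfolding inf_lf_conn_graph_def Fin_els by blast+

lemma Fin_nbrs: "v \<in> els V \<Longrightarrow> Fin {x. adj E v x}"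
  using G unfolding inf_lf_conn_graph_def locally_finite_def Fin_def by blast

lemma ball_sub: "ball V E x0 n \<subseteq> els V"
  unfolding ball_def is_path_iff is_inj_def using is_fun_dom by blast

lemma ball_zero: "ball V E x0 zero = {x0}"
proof
  show "ball V E x0 zero \<subseteq> {x0}"
    unfolding ball_def is_path_iff is_inj_def using is_fun_unique by auto
  show "{x0} \<subseteq> ball V E x0 zero"
    using path_zero[OF x0] unfolding ball_def by auto
qed

lemma ball_suc:
  assumes n: "is_nat n" and v: "v \<in> ball V E x0 (suc n)"
  shows "v \<in> ball V E x0 n \<or> (\<exists>u\<in>ball V E x0 n. adj E u v)"
proof -
  obtain m p where m: "m \<in> els (suc (suc n))" and p: "is_path V E m p x0 v"
    using v unfolding ball_def by blast
  show ?thesis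
  proof (cases "m = suc n")
    case True
    then obtain q u where "is_path V E n q x0 u" "adj E u v" using path_last p n by blast
    moreover have "n \<in> els (suc n)" by simp
    ultimately show ?thesis unfolding ball_def by blast
  next
    case False
    then have "m \<in> els (suc n)" using m by simp
    then show ?thesis using p unfolding ball_def by blast
  qed
qed

lemma ball_step:
  assumes "is_nat n" "u \<in> ball V E x0 n" "adj E u v"
  shows "v \<in> ball V E x0 (suc n)"
proof -
  obtain m p where m: "m \<in> els (suc n)" and p: "is_path V E m p x0 u"
    using assms(2) unfolding ball_def by blast
  obtain k q where k: "k \<in> els (suc (suc m))" and q: "is_path V E k q x0 v"
    using path_extend[OF graph p assms(3)] by blast
  have "suc m \<in> els (suc (suc n))" using m assms(1) suc_mem_suc[of "suc n" m] by simp
  then have "k \<in> els (suc (suc n))"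
    using k nat_trans[of "suc (suc n)" "suc m" k] assms(1) by auto
  then show ?thesis using q unfolding ball_def by blast
qed

lemma Fin_ball: "is_nat n \<Longrightarrow> Fin (ball V E x0 n)"
proof (induction rule: nat_induct)
  case definable
  show ?case by (rule definable_intros)+
next
  case zero
  then show ?case by (simp add: ball_zero Fin_insert Fin_empty)
next
  case (suc n)
  have "Fin (ball V E x0 n \<union> (\<Union>u\<in>ball V E x0 n. {v. adj E u v}))"
  proof (rule Fin_Un[OF suc.IH Fin_UN[OF suc.IH]])
    show "Fin {v. adj E u v}" if "u \<in> ball V E x0 n" for u
      using that Fin_nbrs ball_sub by blast
  qed (rule definable_intros)+
  then show ?case
    by (rule Fin_subset) (use ball_suc[OF suc.hyps] in blast, (rule definable_intros)+)
qed

lemma ball_cover: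
  assumes "v \<in> els V"
  shows "\<exists>n. is_nat n \<and> v \<in> ball V E x0 n"
proof -
  obtain n p where "is_path V E n p x0 v" using conn x0 assms unfolding connected_def by blast
  moreover then have "is_nat n" unfolding is_path_iff by blast
  moreover have "n \<in> els (suc n)" by simp
  ultimately show ?thesis unfolding ball_def by blast
qed

lemma ball_mono:
  assumes "is_nat n" "m \<in> els (suc n)"
  shows "ball V E x0 m \<subseteq> ball V E x0 n"
proof -
  have "els (suc m) \<subseteq> els (suc n)" using assms nat_trans[of "suc n" m] by auto
  then show ?thesis unfolding ball_def by blast
qed

lemma level_ex:
  assumes "v \<in> els V"
  shows "\<exists>n. level V E x0 v n"
proof -
  obtain n where "is_nat n" "v \<in> ball V E x0 n" using ball_cover[OF assms] by blast
  moreover have "definable (\<lambda>e. v \<in> ball V E x0 (e 0))" by (rule definable_intros)+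
  ultimately show ?thesis
    unfolding level_def by (rule least_nat_ex[where P = "\<lambda>n. v \<in> ball V E x0 n"])
qed

lemma level_unique: "level V E x0 v n \<Longrightarrow> level V E x0 v m \<Longrightarrow> n = m"
  unfolding level_def by (rule least_nat_unique)

lemma level_nat: "level V E x0 v n \<Longrightarrow> is_nat n"
  unfolding level_def least_nat_def by blast

lemma level_in: "level V E x0 v n \<Longrightarrow> v \<in> els V"
  unfolding level_def least_nat_def using ball_sub by blast

lemma level_zero: "level V E x0 v zero \<longleftrightarrow> v = x0"
  unfolding level_def least_nat_def by (simp add: ball_zero)

lemma level_step:
  assumes "is_nat n" "level V E x0 v (suc n)"
  shows "\<exists>u. level V E x0 u n \<and> adj E u v"
proof -
  have "v \<in> ball V E x0 (suc n)" "v \<notin> ball V E x0 n"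
    using assms unfolding level_def least_nat_def by auto
  then obtain u where u: "u \<in> ball V E x0 n" "adj E u v" using ball_suc[OF assms(1)] by blast
  have "u \<notin> ball V E x0 m" if m: "m \<in> els n" for m
  proof
    assume "u \<in> ball V E x0 m"
    moreover have "is_nat m" using nat_mem_nat assms(1) m by blast
    ultimately have "v \<in> ball V E x0 (suc m)" using ball_step u(2) by blast
    moreover have "suc m \<in> els (suc n)" using m assms(1) suc_mem_suc by blast
    ultimately show False using assms(2) unfolding level_def least_nat_def by blast
  qed
  then show ?thesis using u assms(1) unfolding level_def least_nat_def by blast
qed

text \<open>An isolated vertex would be a whole component, against infinity and connectedness. Edge
  covers need this, since an isolated vertex could not be covered.\<close>

lemma nbr_ex:
  assumes "v \<in> els V"
  shows "\<exists>u. adj E v u"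
proof (rule ccontr)
  assume no: "\<nexists>u. adj E v u"
  have "els V \<subseteq> {v}"
    by (rule connected_closed[OF conn assms]) (simp, (rule definable_intros)+, use no in simp)
  then have "els V = {v}" using assms by blast
  then show False using inf Fin_insert[OF Fin_empty, of v] by simp
qed

text \<open>Every vertex lies in a ball whose ordering was chosen, since those balls have unbounded
  radius. Vertices are compared first by the least such radius, \<open>idx\<close>, then by the
  ordering chosen for that ball. The least element of a set is found in the same two stages.\<close>

lemma partial_choice_wo:
  assumes partial_choice
  shows "\<exists>lt. wo (els V) lt"
proof -
  let ?B = "ball V E x0"
  have D: "definable (\<lambda>e. chain_wo (?B (e 0)) (e 1))" unfolding chain_wo_def by (rule definable_intros)+
  have F: "Fin {c. chain_wo (?B n) c}" if n: "is_nat n" for n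
  proof -
    have "Fin {c. els c \<subseteq> {s. els s \<subseteq> ?B n}}" by (intro Fin_Pow Fin_ball n)
    then show ?thesis
      by (rule Fin_subset) (unfold chain_wo_def, blast, (rule definable_intros)+)
  qed
  have ex: "\<exists>c. chain_wo (?B n) c" if n: "is_nat n" for n
    by (rule Fin_chain_wo_ex[OF Fin_ball[OF n]])
  obtain c where cD: "definable (\<lambda>e. c (e 0) (e 1))"
    and cu: "\<And>n x y. is_nat n \<Longrightarrow> c n x \<Longrightarrow> c n y \<Longrightarrow> x = y"
    and cA: "\<And>n x. is_nat n \<Longrightarrow> c n x \<Longrightarrow> chain_wo (?B n) x"
    and cub: "\<And>n. is_nat n \<Longrightarrow> \<exists>m x. is_nat m \<and> n \<in> els (suc m) \<and> c m x"
    by (rule partial_choiceE[where A = "\<lambda>n. chain_wo (?B n)", OF assms D F ex]) (assumption | rule that)+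
  note [definable_intros] = definable_app2[OF cD]
  define idx where "idx v n \<longleftrightarrow> least_nat (\<lambda>n. v \<in> ?B n \<and> (\<exists>x. c n x)) n" for v n
  have "definable (\<lambda>e. idx (e 0) (e 1))" unfolding idx_def least_nat_def by (rule definable_intros)+
  note [definable_intros] = definable_app2[OF this]
  have idx_ex: "\<exists>n. idx v n" if v: "v \<in> els V" for v
  proof -
    obtain n where n: "is_nat n" "v \<in> ?B n" using ball_cover[OF v] by blast
    obtain m x where m: "is_nat m" "n \<in> els (suc m)" "c m x" using cub[OF n(1)] by blast
    have "v \<in> ?B m" using ball_mono[OF m(1,2)] n(2) by blast
    then have "v \<in> ?B m \<and> (\<exists>x. c m x)" using m(3) by blast
    moreover have "definable (\<lambda>e. v \<in> ?B (e 0) \<and> (\<exists>x. c (e 0) x))" by (rule definable_intros)+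
    ultimately show ?thesis
      unfolding idx_def using least_nat_ex[of m "\<lambda>m. v \<in> ?B m \<and> (\<exists>x. c m x)"] m(1) by blast
  qed
  have idx_u: "n = m" if "idx v n" "idx v m" for v n m
    using that unfolding idx_def by (rule least_nat_unique)
  define lt where "lt u v \<longleftrightarrow> (\<exists>m n. idx u m \<and> idx v n \<and>
    (m \<in> els n \<or> (m = n \<and> (\<exists>x. c n x \<and> chain_less x u v))))" for u v
  have "wo (els V) lt"
    unfolding wo_def
  proof (intro conjI allI impI)
    show "definable (\<lambda>e. lt (e 0) (e 1))" unfolding lt_def by (rule definable_intros)+
    fix S :: "'a set"
    assume S: "small S \<and> S \<subseteq> els V \<and> S \<noteq> {}"
    then obtain s where s: "els s = S" unfolding small_def by blast
    obtain v where v: "v \<in> els s" using S s by blast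
    then obtain n' where n': "idx v n'" using idx_ex s S by blast
    then have "is_nat n'" unfolding idx_def least_nat_def by blast
    moreover have "\<exists>v\<in>els s. idx v n'" using v n' by blast
    moreover have "definable (\<lambda>e. \<exists>v\<in>els s. idx v (e 0))" by (rule definable_intros)+
    ultimately obtain n where n: "is_nat n" "\<exists>v\<in>els s. idx v n"
      and nl: "\<And>k. k \<in> els n \<Longrightarrow> \<not> (\<exists>v\<in>els s. idx v k)"
      by (rule nat_least[where P = "\<lambda>n. \<exists>v\<in>els s. idx v n"]) blast
    have "small {v \<in> els s. idx v n}" by (rule small_sep[OF small_els]) (rule definable_intros)+
    then obtain t where t: "els t = {v \<in> els s. idx v n}" by (rule ex_small)
    obtain x where x: "c n x" using n(2) unfolding idx_def least_nat_def by blast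
    have "els t \<subseteq> ?B n" unfolding t idx_def least_nat_def by blast
    moreover have "els t \<noteq> {}" using n(2) unfolding t by blast
    ultimately obtain m where m: "m \<in> els t"
      and ml: "\<And>y. y \<in> els t \<Longrightarrow> \<not> chain_less x y m \<and> (y \<noteq> m \<longrightarrow> chain_less x m y)"
      using cA[OF n(1) x] unfolding chain_wo_def by metis
    have im: "idx m n" and mS: "m \<in> S" using m s unfolding t by blast+
    have "\<not> lt y m \<and> (y \<noteq> m \<longrightarrow> lt m y)" if y: "y \<in> S" for y
    proof -
      obtain k where k: "idx y k" using idx_ex y S by blast
      have lt1: "lt y m \<longleftrightarrow> k \<in> els n \<or> (k = n \<and> chain_less x y m)"
        unfolding lt_def using k im idx_u cu[OF n(1)] x by blast
      have lt2: "lt m y \<longleftrightarrow> n \<in> els k \<or> (k = n \<and> chain_less x m y)"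
        unfolding lt_def using k im idx_u cu[OF n(1)] x by blast
      have kn: "k \<notin> els n" using nl k y s by blast
      show ?thesis
      proof (cases "k = n")
        case True
        then have "y \<in> els t" using k y s unfolding t by blast
        then show ?thesis using ml True kn unfolding lt1 lt2 by blast
      next
        case False
        then have "n \<in> els k"
          using kn nat_linear[OF n(1), of k] k unfolding idx_def least_nat_def by blast
        then show ?thesis using False kn unfolding lt1 lt2 by blast
      qed
    qed
    then show "\<exists>x\<in>S. \<forall>y\<in>S. \<not> lt y x \<and> (y \<noteq> x \<longrightarrow> lt x y)" using mS by blast
  qed
  then show ?thesis by blast
qed

end

section \<open>Graphs with a well-ordered vertex set\<close>

lemma dominating_iff:
  "dominating V E D \<longleftrightarrow> els D \<subseteq> els V \<and> (\<forall>v\<in>els V. v \<in> els D \<or> (\<exists>d\<in>els D. adj E v d))"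
  by (simp add: dominating_def els_def)

lemma edge_cover_iff:
  "edge_cover V E F \<longleftrightarrow> els F \<subseteq> els E \<and> (\<forall>v\<in>els V. \<exists>e\<in>els F. v \<in> els e)"
  by (simp add: edge_cover_def els_def)

context
  fixes V E lt
  assumes G: "inf_lf_conn_graph V E" and W: "wo (els V) lt"
begin

lemma graph_of: "is_graph V E"
  using G unfolding inf_lf_conn_graph_def by blast

lemma edge_vertex:
  assumes "e \<in> els E" "y \<in> els e"
  shows "y \<in> els V"
proof -
  obtain a b where "a \<in> els V" "b \<in> els V" "els e = {a, b}"
    using assms(1) graph_of unfolding is_graph_def by blast
  then show ?thesis using assms(2) by auto
qed

text \<open>The kernel of "adjacent and smaller" is a maximal independent set. It dominates, and
  none of its vertices can be spared, because no other member is adjacent to it.\<close>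

lemma wo_minimal_dominating: "\<exists>D. minimal_dominating V E D"
proof -
  note [definable_intros] = definable_app2[OF wo_Df[OF W]]
  have "definable (\<lambda>e. adj E (e 0) (e 1) \<and> lt (e 0) (e 1))" by (rule definable_intros)+
  moreover have "\<exists>x\<in>S. \<forall>y\<in>S. \<not> (adj E y x \<and> lt y x)" if "small S" "S \<subseteq> els V" "S \<noteq> {}" for S
    using wo_min[OF W that] by blast
  ultimately obtain K where K: "els K \<subseteq> els V"
    and ker: "\<And>x. x \<in> els V \<Longrightarrow> x \<in> els K \<longleftrightarrow> (\<forall>y\<in>els K. \<not> (adj E y x \<and> lt y x))"
    by (rule kernel[where X = "els V" and R = "\<lambda>y x. adj E y x \<and> lt y x", OF small_els])
       (assumption | rule that)+
  have indep: "\<not> adj E x y" if "x \<in> els K" "y \<in> els K" for x y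
  proof
    assume xy: "adj E x y"
    have V: "x \<in> els V" "y \<in> els V" using that K by blast+
    have "x \<noteq> y" using adj_graph[OF graph_of xy] by blast
    then have "lt x y \<or> lt y x" using wo_linear[OF W V] by blast
    then show False using ker[OF V(1)] ker[OF V(2)] that xy adj_sym[OF xy] by blast
  qed
  have "v \<in> els K \<or> (\<exists>d\<in>els K. adj E v d)" if "v \<in> els V" for v
    using ker[OF that] adj_sym by blast
  then have "dominating V E K"
    unfolding dominating_iff using K by simp
  moreover have False if D': "els D' \<subset> els K" "dominating V E D'" for D'
  proof -
    obtain v where v: "v \<in> els K" "v \<notin> els D'" using D'(1) by blast
    then obtain d where "d \<in> els D'" "adj E v d"
      using D'(2) K unfolding dominating_iff by (meson subsetD)
    then show False using indep[OF v(1), of d] D'(1) by blast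
  qed
  ultimately show ?thesis unfolding minimal_dominating_def by blast
qed

lemma wo_maximal_matching: "\<exists>M. maximal_matching E M"
proof -
  note [definable_intros] = definable_app2[OF wo_Df[OF W]]
  (* Well-founded since it is contained in the lexicographic order, larger endpoint first. *)
  define R where "R e' e \<longleftrightarrow> (\<exists>z a b. els e = {z, a} \<and> els e' = {z, b} \<and> lt b a)" for e' e
  have RD: "definable (\<lambda>e. R (e 0) (e 1))" unfolding R_def by (rule definable_intros)+
  have RW: "\<exists>x\<in>S. \<forall>y\<in>S. \<not> R y x" if S: "small S" "S \<subseteq> els E" "S \<noteq> {}" for S
  proof -
    obtain s where s: "els s = S" using S(1) unfolding small_def by blast
    have edge: "x \<in> els V \<and> y \<in> els V \<and> x \<noteq> y" if "e \<in> els s" "els e = {x, y}" for e x y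
      using adj_graph[OF graph_of, of x y] that S(2) unfolding s adj_def by blast
    obtain e0 where "e0 \<in> els s" using S(3) s by blast
    then obtain x y where xy: "els e0 = {x, y}"
      using S(2) graph_of unfolding s is_graph_def by blast
    have xyV: "x \<in> els V" "y \<in> els V" "x \<noteq> y" using edge \<open>e0 \<in> els s\<close> xy by blast+
    have yx: "els e0 = {y, x}" using xy by (simp add: insert_commute)
    \<comment> \<open>\<open>P m\<close> says that \<open>m\<close> is the larger end of an edge in
      \<open>s\<close>. The edge wanted has the least larger end \<open>m\<close> and, among those,
      the least smaller end \<open>k\<close>, which is what \<open>Q\<close> is for.\<close>
    define P where "P m \<longleftrightarrow> (\<exists>k\<in>els V. lt k m \<and> (\<exists>e\<in>els s. els e = {k, m}))" for m
    have "definable (\<lambda>e. P (e 0))" unfolding P_def by (rule definable_intros)+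
    moreover have "\<exists>m0\<in>els V. P m0"
      using wo_linear[OF W xyV(1,2)] xyV \<open>e0 \<in> els s\<close> xy yx unfolding P_def by blast
    then obtain m0 where "m0 \<in> els V" "P m0" by blast
    ultimately obtain m where m: "m \<in> els V" "P m"
      and ml: "\<And>y. y \<in> els V \<Longrightarrow> P y \<Longrightarrow> \<not> lt y m \<and> (y \<noteq> m \<longrightarrow> lt m y)"
      by (rule wo_least[OF W small_els, where P = P]) (assumption | rule that)+
    define Q where "Q k \<longleftrightarrow> lt k m \<and> (\<exists>e\<in>els s. els e = {k, m})" for k
    obtain k0 where "k0 \<in> els V" "Q k0" using m(2) unfolding P_def Q_def by blast
    moreover have "definable (\<lambda>e. Q (e 0))" unfolding Q_def by (rule definable_intros)+
    ultimately obtain k where k: "k \<in> els V" "Q k"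
      and kl: "\<And>y. y \<in> els V \<Longrightarrow> Q y \<Longrightarrow> \<not> lt y k \<and> (y \<noteq> k \<longrightarrow> lt k y)"
      using wo_least[OF W small_els, of Q] by metis
    then obtain e where e: "e \<in> els s" "els e = {k, m}" and km: "lt k m" unfolding Q_def by blast
    have "\<not> R e' e" if e': "e' \<in> els s" for e'
    proof
      assume "R e' e"
      then obtain z a b where za: "els e = {z, a}" and zb: "els e' = {z, b}" and ba: "lt b a"
        unfolding R_def by blast
      have bV: "z \<in> els V" "b \<in> els V" "z \<noteq> b" using edge[OF e' zb] by blast+
      have "(z = k \<and> a = m) \<or> (z = m \<and> a = k)"
        using za e(2) by (auto simp: doubleton_eq_iff)
      then show False
      proof (elim disjE conjE)
        \<comment> \<open>Both ends \<open>k\<close> and \<open>b\<close> of \<open>e'\<close> lie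
          below \<open>m\<close>, so its larger end contradicts the choice of
          \<open>m\<close>.\<close>
        assume z: "z = k" "a = m"
        have "els e' = {b, k}" "els e' = {k, b}" using zb z by (simp_all add: insert_commute)
        then have "lt b k \<Longrightarrow> P k" "lt k b \<Longrightarrow> P b" unfolding P_def using bV k(1) e' by blast+
        then show False
          using wo_linear[OF W bV(2) k(1)] bV(3) z ml[OF k(1)] ml[OF bV(2)] km ba by blast
      next
        \<comment> \<open>Now \<open>e'\<close> has the same larger end \<open>m\<close> but a
          smaller end below \<open>k\<close>, against the choice of \<open>k\<close>.\<close>
        assume z: "z = m" "a = k"
        have "els e' = {b, m}" using zb z by (simp add: insert_commute)
        moreover have "lt b m" using wo_trans[OF W bV(2) k(1) m(1)] ba z km by blast
        ultimately have "Q b" unfolding Q_def using e' by blast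
        then show False using kl[OF bV(2)] ba z by blast
      qed
    qed
    then show ?thesis using e(1) s by blast
  qed
  obtain K where K: "els K \<subseteq> els E"
    and ker: "\<And>x. x \<in> els E \<Longrightarrow> x \<in> els K \<longleftrightarrow> (\<forall>y\<in>els K. \<not> R y x)"
    by (rule kernel[OF small_els RD RW]) (assumption | rule that)+
  have disj: "els e \<inter> els e' = {}" if e: "e \<in> els K" "e' \<in> els K" "e \<noteq> e'" for e e'
  proof (rule ccontr)
    assume "els e \<inter> els e' \<noteq> {}"
    then obtain z where z: "z \<in> els e" "z \<in> els e'" by blast
    have other: "\<exists>a. a \<in> els V \<and> els d = {z, a}" if d: "d \<in> els E" "z \<in> els d" for d
    proof -
      obtain x y where xy: "x \<in> els V" "y \<in> els V" "els d = {x, y}"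
        using d(1) graph_of unfolding is_graph_def by blast
      have "z = x \<or> z = y" using d(2) xy(3) by simp
      moreover have "els d = {y, x}" using xy(3) by (simp add: insert_commute)
      ultimately show ?thesis using xy by auto
    qed
    obtain a where a: "a \<in> els V" "els e = {z, a}" using other[of e] e(1) K z(1) by blast
    obtain b where b: "b \<in> els V" "els e' = {z, b}" using other[of e'] e(2) K z(2) by blast
    have "a \<noteq> b" using a b e(3) by (metis els_inject)
    then have "R e e' \<or> R e' e" using wo_linear[OF W a(1) b(1)] a b unfolding R_def by blast
    then show False using ker[of e] ker[of e'] e K by blast
  qed
  then have "matching E K" unfolding matching_def using K by blast
  moreover have False if M': "els K \<subset> els M'" "matching E M'" for M'
  proof -
    obtain e where e: "e \<in> els M'" "e \<notin> els K" using M'(1) by blast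
    then have "e \<in> els E" using M'(2) unfolding matching_def by blast
    then obtain e' where e': "e' \<in> els K" "R e' e" using e(2) ker by blast
    then have "els e' \<inter> els e \<noteq> {}" unfolding R_def by auto
    moreover have "e' \<in> els M'" "e' \<noteq> e" using e e'(1) M'(1) by auto
    moreover have "\<forall>e\<in>els M'. \<forall>e'\<in>els M'. e \<noteq> e' \<longrightarrow> els e \<inter> els e' = {}"
      using M'(2) unfolding matching_def by simp
    ultimately show False using e(1) by simp
  qed
  ultimately show ?thesis unfolding maximal_matching_def by blast
qed

lemma wo_minimal_edge_cover: "\<exists>F. minimal_edge_cover V E F"
proof -
  note [definable_intros] = definable_app2[OF wo_Df[OF W]]
  obtain M where M: "matching E M" and Mmax: "\<And>M'. els M \<subset> els M' \<Longrightarrow> \<not> matching E M'"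
    using wo_maximal_matching unfolding maximal_matching_def by blast
  have ME: "els M \<subseteq> els E"
    and Mdisj: "\<And>e e' x. e \<in> els M \<Longrightarrow> e' \<in> els M \<Longrightarrow> x \<in> els e \<Longrightarrow> x \<in> els e' \<Longrightarrow> e = e'"
    using M unfolding matching_def by blast+
  (* Each vertex u outside a maximal matching is attached to its least neighbour; a matching edge
     is dropped if both its ends are hit in this way.  The result is a forest of stars. *)
  define unm where "unm u \<longleftrightarrow> u \<in> els V \<and> (\<forall>e\<in>els M. u \<notin> els e)" for u
  define best where "best u v \<longleftrightarrow> adj E u v \<and> (\<forall>w. adj E u w \<longrightarrow> w \<noteq> v \<longrightarrow> lt v w)" for u v
  have best_ex: "\<exists>v. best u v" if u: "u \<in> els V" for u
  proof -
    obtain w where w: "adj E u w" using nbr_ex[OF G u u] by blast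
    have "w \<in> els V" using adj_graph[OF graph_of w] by blast
    moreover have "definable (\<lambda>e. adj E u (e 0))" by (rule definable_intros)+
    ultimately obtain v where "v \<in> els V" "adj E u v"
      "\<And>y. y \<in> els V \<Longrightarrow> adj E u y \<Longrightarrow> \<not> lt y v \<and> (y \<noteq> v \<longrightarrow> lt v y)"
      using wo_least[OF W small_els, of "adj E u" w] w by metis
    then show ?thesis unfolding best_def using adj_graph[OF graph_of] by blast
  qed
  have best_unique: "v = v'" if b: "best u v" "best u v'" for u v v'
  proof (rule ccontr)
    assume "v \<noteq> v'"
    then have "lt v v'" "lt v' v" using b unfolding best_def by auto
    moreover have "v \<in> els V" "v' \<in> els V" using b adj_graph[OF graph_of] unfolding best_def by blast+
    ultimately show False using wo_asym[OF W] by blast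
  qed
  \<comment> \<open>The edge between two adjacent unmatched vertices could be added to the maximal
    matching.\<close>
  have unm: "\<not> unm v" if u: "unm u" "adj E u v" for u v
  proof
    assume v: "unm v"
    obtain e where e: "e \<in> els E" "els e = {u, v}" using u(2) unfolding adj_def by blast
    have "e \<notin> els M" using u(1) e(2) unfolding unm_def by blast
    then have "els M \<subset> els (ins e M)" by auto
    moreover have "matching E (ins e M)"
      using M e u(1) v unfolding matching_def unm_def by auto
    ultimately show False using Mmax by blast
  qed
  have "definable (\<lambda>e. unm (e 0))" unfolding unm_def by (rule definable_intros)+
  note [definable_intros] = definable_app1[OF this]
  have "definable (\<lambda>e. best (e 0) (e 1))" unfolding best_def by (rule definable_intros)+
  note [definable_intros] = definable_app2[OF this]
  define hit where "hit y \<longleftrightarrow> (\<exists>u. unm u \<and> best u y)" for y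
  define pick where "pick e \<longleftrightarrow> (\<exists>u v. els e = {u, v} \<and> unm u \<and> best u v)" for e
  have "small {e \<in> els E. (e \<in> els M \<and> (\<exists>y\<in>els e. \<not> hit y)) \<or> pick e}"
    unfolding hit_def pick_def by (rule small_sep[OF small_els]) (rule definable_intros)+
  then obtain F where F: "els F = {e \<in> els E. (e \<in> els M \<and> (\<exists>y\<in>els e. \<not> hit y)) \<or> pick e}"
    by (rule ex_small)
  have pick: "\<exists>e\<in>els F. els e = {u, v}" if "unm u" "best u v" for u v
    using that unfolding F pick_def best_def adj_def by blast
  have "edge_cover V E F"
    unfolding edge_cover_iff
  proof (intro conjI ballI)
    show "els F \<subseteq> els E" unfolding F by blast
    fix x
    assume x: "x \<in> els V"
    show "\<exists>e\<in>els F. x \<in> els e"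
    proof (cases "unm x \<or> hit x")
      case True
      then obtain u v where "unm u" "best u v" "x \<in> {u, v}"
        using best_ex[OF x] unfolding hit_def by blast
      then show ?thesis using pick[of u v] by auto
    next
      case False
      then obtain e where "e \<in> els M" "x \<in> els e" using x unfolding unm_def by blast
      then show ?thesis using False ME unfolding F by blast
    qed
  qed
  moreover have False if F': "els F' \<subset> els F" "edge_cover V E F'" for F'
  proof -
    obtain e where e: "e \<in> els F" "e \<notin> els F'" using F'(1) by blast
    have cov: "\<exists>e'\<in>els F. x \<in> els e' \<and> e' \<noteq> e" if "x \<in> els V" for x
      using that F' e(2) unfolding edge_cover_iff by blast
    consider y where "e \<in> els M" "y \<in> els e" "\<not> hit y" | u v where "els e = {u, v}" "unm u" "best u v"
      using e(1) unfolding F pick_def by blast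
    then show False
    proof cases
      \<comment> \<open>Here \<open>e\<close> was kept because its end \<open>y\<close> is not hit.
        Any other edge of \<open>F\<close> at \<open>y\<close> is outside the matching, hence
        attaches an unmatched vertex; as \<open>y\<close> is matched, it would be the vertex
        hit.\<close>
      case 1
      have "y \<in> els V" using edge_vertex[of e y] 1 ME by blast
      then obtain e' where e': "e' \<in> els F" "y \<in> els e'" "e' \<noteq> e" using cov by blast
      then have "e' \<notin> els M" using Mdisj 1 by blast
      then obtain u v where uv: "els e' = {u, v}" "unm u" "best u v"
        using e'(1) unfolding F pick_def by blast
      have "y \<noteq> u" using 1(1,2) uv(2) unfolding unm_def by blast
      then have "y = v" using e'(2) uv(1) by simp
      then have "hit y" using uv(2,3) unfolding hit_def by blast
      then show False using 1(3) by simp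
    next
      \<comment> \<open>The unmatched \<open>u\<close> is never the target of an attachment, because
        targets are adjacent to unmatched vertices and so are matched. Hence the only edge of
        \<open>F\<close> at \<open>u\<close> is the one to its own least neighbour.\<close>
      case 2
      have "u \<in> els V" using 2(2) unfolding unm_def by blast
      then obtain e' where e': "e' \<in> els F" "u \<in> els e'" "e' \<noteq> e" using cov by blast
      then have "e' \<notin> els M" using 2(2) unfolding unm_def by blast
      then obtain u' v' where uv': "els e' = {u', v'}" "unm u'" "best u' v'"
        using e'(1) unfolding F pick_def by blast
      have "u \<noteq> v'" using unm[of u' v'] 2(2) uv'(2,3) unfolding best_def by blast
      then have "u' = u" using e'(2) uv'(1) by simp
      then have "v' = v" using best_unique[of u v v'] 2(3) uv'(3) by simp
      then have "els e' = els e" using uv' 2 \<open>u' = u\<close> by simp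
      then show False using e'(3) by simp
    qed
  qed
  ultimately show ?thesis unfolding minimal_edge_cover_def by blast
qed

lemma wo_irreducible_coloring: "\<exists>C f. irreducible_proper_coloring V E C f"
proof -
  note [definable_intros] = definable_app2[OF wo_Df[OF W]]
  (* The kernel is the coloring itself, a set of pairs (v, c).  The colors are vertices, and a
     vertex v may only use colors up to v, which makes v itself always available to it. *)
  define X where "X = {z. \<exists>v\<in>els V. \<exists>c\<in>els V. z = opair v c \<and> (c = v \<or> lt c v)}"
  have XI: "opair v c \<in> X \<longleftrightarrow> v \<in> els V \<and> c \<in> els V \<and> (c = v \<or> lt c v)" for v c
    unfolding X_def by auto
  have X: "small X"
    by (rule small_subset[OF small_prod[OF small_els[of V] small_els[of V]]])
       (unfold X_def, blast, (rule definable_intros)+)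
  \<comment> \<open>A pair is blocked by a smaller color at the same vertex or by the same color at
    a smaller neighbour. Thus each vertex receives the least color not taken by its smaller
    neighbours.\<close>
  define R where "R p' p \<longleftrightarrow> (\<exists>v c c'. p = opair v c \<and> p' = opair v c' \<and> lt c' c) \<or>
    (\<exists>v v' c. p = opair v c \<and> p' = opair v' c \<and> lt v' v \<and> adj E v' v)" for p' p
  have R1: "R (opair v c') (opair v c)" if "lt c' c" for v c c' using that unfolding R_def by blast
  have R2: "R (opair v' c) (opair v c)" if "lt v' v" "adj E v' v" for v v' c using that unfolding R_def by blast
  have RD: "definable (\<lambda>e. R (e 0) (e 1))" unfolding R_def by (rule definable_intros)+
  have RW: "\<exists>x\<in>S. \<forall>y\<in>S. \<not> R y x" if S: "small S" "S \<subseteq> X" "S \<noteq> {}" for S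
  proof -
    obtain s where s: "els s = S" using S(1) unfolding small_def by blast
    have sV: "v \<in> els V \<and> c \<in> els V" if "opair v c \<in> els s" for v c
      using that S(2) unfolding s XI[symmetric] using XI by blast
    obtain p where "p \<in> els s" using S(3) s by blast
    moreover then obtain v0 c0 where "p = opair v0 c0" using S(2) unfolding s X_def by blast
    ultimately have vc0: "opair v0 c0 \<in> els s" by simp
    have "definable (\<lambda>e. \<exists>c. opair (e 0) c \<in> els s)" by (rule definable_intros)+
    moreover have "v0 \<in> els V" "\<exists>c. opair v0 c \<in> els s" using vc0 sV by blast+
    ultimately obtain v where v: "v \<in> els V" "\<exists>c. opair v c \<in> els s"
      and vl: "\<And>y. y \<in> els V \<Longrightarrow> \<exists>c. opair y c \<in> els s \<Longrightarrow> \<not> lt y v \<and> (y \<noteq> v \<longrightarrow> lt v y)"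
      by (rule wo_least[OF W small_els, where P = "\<lambda>v. \<exists>c. opair v c \<in> els s"]) (assumption | rule that)+
    obtain c1 where "opair v c1 \<in> els s" using v(2) by blast
    moreover have "definable (\<lambda>e. opair v (e 0) \<in> els s)" by (rule definable_intros)+
    ultimately obtain c where c: "c \<in> els V" "opair v c \<in> els s"
      and cl: "\<And>y. y \<in> els V \<Longrightarrow> opair v y \<in> els s \<Longrightarrow> \<not> lt y c \<and> (y \<noteq> c \<longrightarrow> lt c y)"
      using wo_least[OF W small_els, of "\<lambda>c. opair v c \<in> els s" c1] sV by metis
    have "\<not> R y (opair v c)" if y: "y \<in> els s" for y
    proof
      assume "R y (opair v c)"
      then consider c' where "y = opair v c'" "lt c' c" | v' where "y = opair v' c" "lt v' v"
        unfolding R_def by auto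
      then show False
      proof cases
        case 1
        then show False using cl[of c'] y sV by blast
      next
        case 2
        then show False using vl[of v'] y sV by blast
      qed
    qed
    then show ?thesis using c(2) s by blast
  qed
  obtain K where K: "els K \<subseteq> X"
    and ker: "\<And>x. x \<in> X \<Longrightarrow> x \<in> els K \<longleftrightarrow> (\<forall>y\<in>els K. \<not> R y x)"
    by (rule kernel[OF X RD RW]) (assumption | rule that)+
  have KV: "v \<in> els V \<and> c \<in> els V \<and> (c = v \<or> lt c v)" if "opair v c \<in> els K" for v c
    using that K XI by blast
  have ker': "\<not> R y x" if "x \<in> els K" "y \<in> els K" for x y
    using ker K that by blast
  have uniq: "c = c'" if "opair v c \<in> els K" "opair v c' \<in> els K" for v c c'
    using wo_linear[OF W, of c c'] KV[OF that(1)] KV[OF that(2)] ker'[OF that] ker'[OF that(2,1)] R1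
    by blast
  have ex: "\<exists>c. opair v c \<in> els K" if v: "v \<in> els V" for v
  proof (rule ccontr)
    assume no: "\<nexists>c. opair v c \<in> els K"
    \<comment> \<open>Only a smaller neighbour \<open>v'\<close> colored \<open>v\<close> could
      block this pair, but \<open>v'\<close> uses no color above \<open>v'\<close> itself.\<close>
    have "opair v v \<in> X" using v XI by blast
    then obtain y where y: "y \<in> els K" "R y (opair v v)" using ker no by blast
    then obtain v' where v': "y = opair v' v" "lt v' v" using no unfolding R_def by auto
    then have "v' \<in> els V" "v = v' \<or> lt v v'" using KV y(1) by blast+
    then show False using wo_asym[OF W _ v v'(2)] by blast
  qed
  have "small {c \<in> els V. \<exists>v. opair v c \<in> els K}" by (rule small_sep[OF small_els]) (rule definable_intros)+
  then obtain C where C: "els C = {c \<in> els V. \<exists>v. opair v c \<in> els K}" by (rule ex_small)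
  have "is_fun K V C"
    unfolding is_fun_def maps_to_iff
  proof (intro conjI ballI)
    fix z
    assume z: "z \<in> els K"
    then obtain v c where "z = opair v c" using K unfolding X_def by blast
    then show "\<exists>x\<in>els V. \<exists>y\<in>els C. is_pair z x y" using z KV unfolding C by auto
  qed (use ex uniq in blast)
  moreover have False if xy: "adj E x y" and x: "opair x c \<in> els K" and y: "opair y c \<in> els K" for x y c
  proof -
    have "x \<noteq> y" using adj_graph[OF graph_of xy] by blast
    then have "lt x y \<or> lt y x" using wo_linear[OF W] KV[OF x] KV[OF y] by blast
    then show False using R2 xy adj_sym[OF xy] ker' x y by blast
  qed
  ultimately have proper: "proper_coloring V E C K"
    unfolding proper_coloring_def maps_to_iff by blast
  \<comment> \<open>A vertex \<open>v\<close> colored \<open>c2\<close> was also allowed the smaller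
    color \<open>c1\<close>, since \<open>c2\<close> is at most \<open>v\<close>. It did not take
    \<open>c1\<close>, and its own color is not below \<open>c1\<close>, so a neighbour must have
    color \<open>c1\<close>.\<close>
  have dep: "\<exists>x y. adj E x y \<and> opair x c1 \<in> els K \<and> opair y c2 \<in> els K"
    if c: "c1 \<in> els C" "c2 \<in> els C" "lt c1 c2" for c1 c2
  proof -
    obtain v where v: "opair v c2 \<in> els K" using c(2) unfolding C by blast
    have cV: "c1 \<in> els V" "c2 \<in> els V" "v \<in> els V" "c2 = v \<or> lt c2 v"
      using c(1) KV[OF v] unfolding C by blast+
    have "lt c1 v" using cV(4) wo_trans[OF W cV(1-3) c(3)] c(3) by blast
    then have "opair v c1 \<in> X" using cV XI by blast
    moreover have "opair v c1 \<notin> els K" using uniq[OF v] wo_asym(2)[OF W cV(1,2) c(3)] by blast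
    ultimately obtain y where y: "y \<in> els K" "R y (opair v c1)" using ker by blast
    then consider c' where "y = opair v c'" "lt c' c1" | v' where "y = opair v' c1" "adj E v' v"
      unfolding R_def by auto
    then show ?thesis
    proof cases
      case 1
      then have "c' = c2" using uniq y(1) v by blast
      then show ?thesis using 1 wo_asym(1)[OF W cV(1,2) c(3)] by blast
    next
      case 2
      then show ?thesis using y(1) v by blast
    qed
  qed
  have "\<exists>S. els S = {x. opair x c1 \<in> els K} \<union> {x. opair x c2 \<in> els K} \<and> dependent E S"
    if c: "c1 \<in> els C" "c2 \<in> els C" "c1 \<noteq> c2" for c1 c2
  proof -
    have "small ({x. opair x c1 \<in> els K} \<union> {x. opair x c2 \<in> els K})"
      by (rule small_subset[OF small_els[of V]]) (use KV in blast, (rule definable_intros)+)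
    then obtain S where S: "els S = {x. opair x c1 \<in> els K} \<union> {x. opair x c2 \<in> els K}" by (rule ex_small)
    have "lt c1 c2 \<or> lt c2 c1" using wo_linear[OF W, of c1 c2] c unfolding C by blast
    then have "\<exists>x y. adj E x y \<and> x \<in> els S \<and> y \<in> els S"
      using dep[OF c(1,2)] dep[OF c(2,1)] unfolding S by blast
    then have "dependent E S" unfolding dependent_def by blast
    then show ?thesis using S by blast
  qed
  then show ?thesis
    using proper unfolding irreducible_proper_coloring_def maps_to_iff by blast
qed

end

section \<open>A ray from a well-order of the vertices\<close>

lemma is_ray_iff:
  "is_ray V E r \<longleftrightarrow> is_inj r omega V \<and>
     (\<forall>i u v. is_nat i \<and> maps_to r i u \<and> maps_to r (suc i) v \<longrightarrow> adj E u v)"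
  unfolding is_ray_def by auto

lemma wo_ray:
  assumes G: "inf_lf_conn_graph V E" and W: "wo (els V) lt"
  shows "\<exists>r. is_ray V E r"
proof -
  note [definable_intros] = definable_app2[OF wo_Df[OF W]]
  have "els V \<noteq> {}" using G Fin_empty unfolding inf_lf_conn_graph_def Fin_els[symmetric] by auto
  then obtain x0 where x0: "x0 \<in> els V" by blast
  note nonfin = inf[OF G x0] and gr = graph[OF G x0]
  note l_ex = level_ex[OF G x0] and l_nat = level_nat[OF G x0] and l_in = level_in[OF G x0]
    and l_zero = level_zero[OF G x0] and l_step = level_step[OF G x0]
    and nbrs = Fin_nbrs[OF G x0]
  define L where "L = level V E x0"
  have L_unique: "n = m" if "L v n" "L v m" for v n m
    using that unfolding L_def by (rule level_unique[OF G x0])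
  have "definable (\<lambda>e. L (e 0) (e 1))" unfolding L_def by (rule definable_intros)+
  note [definable_intros] = definable_app2[OF this]
  define up where "up x y \<longleftrightarrow> adj E x y \<and> (\<exists>n. L x n \<and> L y (suc n))" for x y
  have "definable (\<lambda>e. up (e 0) (e 1))" unfolding up_def by (rule definable_intros)+
  note [definable_intros] = definable_app2[OF this]
  have upV: "x \<in> els V" "y \<in> els V" if "up x y" for x y
    using that adj_graph[OF gr] unfolding up_def by blast+
  \<comment> \<open>Descendants along level-increasing edges, defined as an intersection of closed
    sets so that no internal recursion is needed.\<close>
  define desc where "desc v = {u. u \<in> els V \<and>
    (\<forall>S. v \<in> els S \<and> (\<forall>x\<in>els S. \<forall>y. up x y \<longrightarrow> y \<in> els S) \<longrightarrow> u \<in> els S)}" for v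
  have descD: "def_set (\<lambda>e. desc (e 0))" unfolding desc_def by (rule definable_intros)+
  note def_set_app1[OF descD, definable_intros]
  have desc_self: "v \<in> desc v" if "v \<in> els V" for v
    using that unfolding desc_def by blast
  have desc_up: "y \<in> desc v" if "x \<in> desc v" "up x y" for x y v
    using that upV(2)[OF that(2)] unfolding desc_def by blast
  have desc_min: "desc v \<subseteq> T"
    if T: "small T" "v \<in> T" "\<And>x y. x \<in> T \<Longrightarrow> up x y \<Longrightarrow> y \<in> T" for v T
  proof -
    obtain t where t: "els t = T" using T(1) unfolding small_def by blast
    have "v \<in> els t \<and> (\<forall>x\<in>els t. \<forall>y. up x y \<longrightarrow> y \<in> els t)" using T(2,3) unfolding t by blast
    then have "desc v \<subseteq> els t" unfolding desc_def by blast
    then show ?thesis unfolding t .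
  qed
  define big where "big v \<longleftrightarrow> v \<in> els V \<and> \<not> Fin (desc v)" for v
  have "definable (\<lambda>e. big (e 0))" unfolding big_def by (rule definable_intros)+
  note [definable_intros] = definable_app1[OF this]
  \<comment> \<open>The descendants of \<open>v\<close> are \<open>v\<close> and those of its
    finitely many upper neighbours; if the latter all had finitely many, so would
    \<open>v\<close>.\<close>
  have big_up: "\<exists>w. up v w \<and> big w" if v: "big v" for v
  proof (rule ccontr)
    assume no: "\<nexists>w. up v w \<and> big w"
    have vV: "v \<in> els V" using v unfolding big_def by blast
    have "Fin (desc w)" if "up v w" for w
      using no that upV(2)[OF that] unfolding big_def by blast
    moreover have "Fin {w. up v w}"
      by (rule Fin_subset[OF nbrs[OF vV]]) (unfold up_def, blast, (rule definable_intros)+)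
    ultimately have "Fin (\<Union>w\<in>{w. up v w}. desc w)"
      using Fin_UN[OF _ _ descD, of "{w. up v w}"] by simp
    then have F: "Fin (insert v (\<Union>w\<in>{w. up v w}. desc w))" by (rule Fin_insert)
    have "desc v \<subseteq> insert v (\<Union>w\<in>{w. up v w}. desc w)"
    proof (rule desc_min[OF Fin_small[OF F]])
      fix x y
      assume x: "x \<in> insert v (\<Union>w\<in>{w. up v w}. desc w)" and xy: "up x y"
      show "y \<in> insert v (\<Union>w\<in>{w. up v w}. desc w)"
      proof (cases "x = v")
        case True
        then have "y \<in> desc y" "up v y" using desc_self upV(2)[OF xy] xy by simp_all
        then show ?thesis by blast
      next
        case False
        then obtain w where "up v w" "x \<in> desc w" using x by blast
        then show ?thesis using desc_up[OF _ xy] by blast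
      qed
    qed simp
    then have "Fin (desc v)" by (rule Fin_subset[OF F]) (rule definable_intros)+
    then show False using v unfolding big_def by blast
  qed
  have "\<forall>v. L v n \<longrightarrow> v \<in> desc x0" if "is_nat n" for n using that
  proof (induction rule: nat_induct)
    case definable
    show ?case by (rule definable_intros)+
  next
    case zero
    then show ?case using desc_self[OF x0] l_zero unfolding L_def by simp
  next
    case (suc n)
    show ?case
    proof (intro allI impI)
      fix v
      assume v: "L v (suc n)"
      then obtain u where u: "L u n" "adj E u v" using l_step[OF suc.hyps] unfolding L_def by blast
      then have "up u v" unfolding up_def using v by blast
      moreover have "u \<in> desc x0" using suc.IH u(1) by blast
      ultimately show "v \<in> desc x0" by (rule desc_up[rotated])
    qed
  qed
  then have "els V \<subseteq> desc x0" using l_ex l_nat unfolding L_def by blast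
  moreover have "desc x0 \<subseteq> els V" unfolding desc_def by blast
  ultimately have "desc x0 = els V" by blast
  then have big0: "big x0" using nonfin x0 unfolding big_def by simp
  define X where "X = {v. big v}"
  have X: "small X"
    by (rule small_subset[OF small_els[of V]]) (unfold X_def, unfold big_def, blast, fold big_def, (rule definable_intros)+)
  (* The kernel of R has exactly one vertex on each level, and consecutive ones are adjacent. *)
  define R where "R y v \<longleftrightarrow> (\<exists>n. L y n \<and> L v n \<and> lt y v) \<or> (\<exists>n. L y n \<and> L v (suc n) \<and> \<not> adj E y v)" for y v
  have RD: "definable (\<lambda>e. R (e 0) (e 1))" unfolding R_def by (rule definable_intros)+
  have XV: "v \<in> els V" if "v \<in> X" for v using that unfolding X_def big_def by blast
  have RW: "\<exists>x\<in>S. \<forall>y\<in>S. \<not> R y x" if S: "small S" "S \<subseteq> X" "S \<noteq> {}" for S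
  proof -
    obtain s where s: "els s = S" using S(1) unfolding small_def by blast
    obtain v where v: "v \<in> els s" using S(3) s by blast
    then obtain n' where n': "L v n'" using l_ex XV S(2) unfolding s L_def by blast
    then have "is_nat n'" using l_nat unfolding L_def by blast
    moreover have "\<exists>v\<in>els s. L v n'" using v n' by blast
    moreover have "definable (\<lambda>e. \<exists>v\<in>els s. L v (e 0))" by (rule definable_intros)+
    ultimately obtain n where n: "is_nat n" "\<exists>v\<in>els s. L v n"
      and nl: "\<And>k. k \<in> els n \<Longrightarrow> \<not> (\<exists>v\<in>els s. L v k)"
      by (rule nat_least[where P = "\<lambda>n. \<exists>v\<in>els s. L v n"]) blast
    \<comment> \<open>An \<open>R\<close>-predecessor lies on the same level and is
      \<open>lt\<close>-smaller, or lies one level lower. So the \<open>lt\<close>-least vertex on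
      the lowest level of \<open>s\<close> has none in \<open>s\<close>.\<close>
    obtain v1 where v1: "v1 \<in> els s \<and> L v1 n" using n(2) by blast
    have "definable (\<lambda>e. e 0 \<in> els s \<and> L (e 0) n)" by (rule definable_intros)+
    moreover have "v1 \<in> els V" using v1 XV S(2) s by blast
    ultimately obtain m where m: "m \<in> els V" "m \<in> els s \<and> L m n"
      and ml: "\<And>y. y \<in> els V \<Longrightarrow> y \<in> els s \<and> L y n \<Longrightarrow> \<not> lt y m \<and> (y \<noteq> m \<longrightarrow> lt m y)"
      using v1
      by (rule wo_least[OF W small_els, where P = "\<lambda>v. v \<in> els s \<and> L v n"]) (assumption | rule that)+
    have "\<not> R y m" if y: "y \<in> S" for y
    proof
      assume "R y m"
      then consider k where "L y k" "L m k" "lt y m" | k where "L y k" "L m (suc k)"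
        unfolding R_def by blast
      then show False
      proof cases
        case 1
        then have "k = n" using L_unique m(2) by blast
        then show False using ml[of y] 1 y s XV S(2) by blast
      next
        case 2
        then have "suc k = n" using L_unique m(2) by blast
        then have "k \<in> els n" by auto
        then show False using nl 2(1) y s by blast
      qed
    qed
    then show ?thesis using m(2) s by blast
  qed
  obtain K where K: "els K \<subseteq> X"
    and ker: "\<And>x. x \<in> X \<Longrightarrow> x \<in> els K \<longleftrightarrow> (\<forall>y\<in>els K. \<not> R y x)"
    by (rule kernel[OF X RD RW]) (assumption | rule that)+
  have K_adj: "adj E u v" if "u \<in> els K" "v \<in> els K" "L u n" "L v (suc n)" for u v n
    using ker[of v] K that unfolding R_def by blast
  have KV: "v \<in> els V" if "v \<in> els K" for v using that K XV by blast
  have K_unique: "u = v" if "u \<in> els K" "v \<in> els K" "L u n" "L v n" for u v n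
  proof -
    have "\<not> lt u v" "\<not> lt v u" using ker[of u] ker[of v] K that unfolding R_def by blast+
    then show ?thesis using wo_linear[OF W KV[OF that(1)] KV[OF that(2)]] by blast
  qed
  have K_ex: "\<exists>v. v \<in> els K \<and> L v n" if "is_nat n" for n using that
  proof (induction rule: nat_induct)
    case definable
    show ?case by (rule definable_intros)+
  next
    case zero
    have "\<not> R y x0" for y
    proof
      assume "R y x0"
      then consider k where "L y k" "L x0 k" "lt y x0" | k where "L x0 (suc k)"
        unfolding R_def by blast
      then show False
      proof cases
        case 1
        then have "k = zero" using L_unique l_zero unfolding L_def by blast
        then have "y = x0" using 1 l_zero unfolding L_def by blast
        then show False using 1(3) wo_asym[OF W x0 x0] by blast
      next
        case 2
        then have "suc k = zero" using L_unique l_zero unfolding L_def by blast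
        then show False by simp
      qed
    qed
    moreover have "x0 \<in> X" using big0 unfolding X_def by blast
    ultimately have "x0 \<in> els K" using ker by blast
    then show ?case using l_zero unfolding L_def by blast
  next
    \<comment> \<open>The new vertex is the least \<open>big\<close> upper neighbour
      \<open>w\<close> of the kernel vertex \<open>u\<close> on level \<open>n\<close>. A kernel
      vertex \<open>y\<close> on level \<open>n + 1\<close> is adjacent to \<open>u\<close>, hence
      competes with \<open>w\<close> for being least and cannot block it.\<close>
    case (suc n)
    then obtain u where u: "u \<in> els K" "L u n" by blast
    then have "big u" using K unfolding X_def by blast
    then obtain w0 where w0: "up u w0 \<and> big w0" using big_up by blast
    have "definable (\<lambda>e. up u (e 0) \<and> big (e 0))" by (rule definable_intros)+
    moreover have "w0 \<in> els V" using w0 upV by blast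
    ultimately obtain w where w: "w \<in> els V" "up u w \<and> big w"
      and wl: "\<And>y. y \<in> els V \<Longrightarrow> up u y \<and> big y \<Longrightarrow> \<not> lt y w \<and> (y \<noteq> w \<longrightarrow> lt w y)"
      using w0
      by (rule wo_least[OF W small_els, where P = "\<lambda>w. up u w \<and> big w"]) (assumption | rule that)+
    have Lw: "L w (suc n)" using w(2) u(2) L_unique unfolding up_def by blast
    have "\<not> R y w" if y: "y \<in> els K" for y
    proof
      assume "R y w"
      then consider k where "L y k" "L w k" "lt y w" | k where "L y k" "L w (suc k)" "\<not> adj E y w"
        unfolding R_def by blast
      then show False
      proof cases
        case 1
        then have Ly: "L y (suc n)" using L_unique[OF 1(2) Lw] by simp
        then have "adj E u y" using K_adj[OF u(1) y u(2)] by blast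
        then have "up u y" unfolding up_def using u(2) Ly by blast
        moreover have "big y" using y K unfolding X_def by blast
        ultimately show False using wl[OF KV[OF y]] 1(3) by blast
      next
        case 2
        then have "k = n" using L_unique[OF 2(2) Lw] by simp
        then have "y = u" using K_unique[OF y u(1)] 2(1) u(2) by simp
        then show False using 2(3) w(2) unfolding up_def by blast
      qed
    qed
    moreover have "w \<in> X" using w(2) unfolding X_def by blast
    ultimately have "w \<in> els K" using ker by blast
    then show ?case using Lw by blast
  qed
  have "definable (\<lambda>e. e 1 \<in> els K \<and> L (e 1) (e 0))" by (rule definable_intros)+
  then obtain r where r: "\<And>n v. maps_to r n v \<longleftrightarrow> n \<in> els omega \<and> v \<in> els V \<and> (v \<in> els K \<and> L v n)"
    and rf: "(\<forall>n\<in>els omega. \<exists>!v. v \<in> els V \<and> (v \<in> els K \<and> L v n)) \<longrightarrow> is_fun r omega V"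
    by (rule ex_fun[where R = "\<lambda>n v. v \<in> els K \<and> L v n" and A = omega and B = V]) (rule that)
  have "is_fun r omega V"
  proof (rule rf[rule_format])
    fix n
    assume "n \<in> els omega"
    then obtain v where v: "v \<in> els K" "L v n" using K_ex by auto
    then show "\<exists>!v. v \<in> els V \<and> (v \<in> els K \<and> L v n)"
      using K_unique KV by blast
  qed
  then have "is_inj r omega V"
    unfolding is_inj_def r using L_unique by blast
  moreover have "adj E u v" if "maps_to r i u" "maps_to r (suc i) v" for i u v
    using that K_adj unfolding r by blast
  ultimately have "is_ray V E r" unfolding is_ray_iff by blast
  then show ?thesis by blast
qed

section \<open>Layered graphs\<close>

lemma Fin_single: "Fin {x}"
  by (intro Fin_insert Fin_empty)

lemma Fin_levels:
  assumes "Fin X"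
  shows "Fin {n. \<exists>y. opair n y \<in> X}"
proof -
  have "Fin (\<Union>z\<in>X. {n. \<exists>y. z = opair n y})"
  proof (rule Fin_UN[OF assms])
    fix z
    show "Fin {n. \<exists>y. z = opair n y}"
    proof (cases "\<exists>n y. z = opair n y")
      case True
      then obtain n y where "z = opair n y" by blast
      then have "{n. \<exists>y. z = opair n y} = {n}" by auto
      then show ?thesis by (simp add: Fin_single)
    next
      case False
      then have "{n. \<exists>y. z = opair n y} = {}" by blast
      then show ?thesis by (simp add: Fin_empty)
    qed
  qed (rule definable_intros)+
  moreover have "(\<Union>z\<in>X. {n. \<exists>y. z = opair n y}) = {n. \<exists>y. opair n y \<in> X}" by auto
  ultimately show ?thesis by simp
qed

lemma Fin_layers:
  assumes L: "definable (\<lambda>e. L (e 0) (e 1))" and fin: "\<And>n. is_nat n \<Longrightarrow> Fin {y. L n y}" and N: "is_nat N"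
  shows "Fin {z. \<exists>n\<in>els N. \<exists>y. L n y \<and> z = opair n y}"
proof -
  note [definable_intros] = definable_app2[OF L]
  have "Fin (\<Union>n\<in>els N. {z. \<exists>y. L n y \<and> z = opair n y})"
  proof (rule Fin_UN[OF Fin_nat[OF N]])
    fix n
    assume "n \<in> els N"
    then have "Fin (opair n ` {y. L n y})"
      by (intro Fin_image fin nat_mem_nat[OF N] definable_intros)
    moreover have "opair n ` {y. L n y} = {z. \<exists>y. L n y \<and> z = opair n y}" by auto
    ultimately show "Fin {z. \<exists>y. L n y \<and> z = opair n y}" by simp
  qed (rule definable_intros)+
  moreover have "(\<Union>n\<in>els N. {z. \<exists>y. L n y \<and> z = opair n y}) = {z. \<exists>n\<in>els N. \<exists>y. L n y \<and> z = opair n y}"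
    by auto
  ultimately show ?thesis by simp
qed

text \<open>Common frame for both graph constructions: \<open>near\<close> together with finite
  layers gives local finiteness, while \<open>up\<close> and \<open>down\<close> say how a set
  closed under adjacency spreads inside a layer and to the neighbouring ones.\<close>

lemma layered_graph:
  assumes L: "definable (\<lambda>e. L (e 0) (e 1))"
    and fin: "\<And>n. is_nat n \<Longrightarrow> Fin {y. L n y}" and ne: "\<And>n. is_nat n \<Longrightarrow> \<exists>y. L n y"
    and R: "definable (\<lambda>e. R (e 0) (e 1))" and sym: "\<And>u v. R u v \<Longrightarrow> R v u" and irr: "\<And>u. \<not> R u u"
    and near: "\<And>n m y z. R (opair n y) (opair m z) \<Longrightarrow> m = n \<or> m = suc n \<or> n = suc m"
    and up: "\<And>S n y. \<lbrakk>\<forall>n y m z. opair n y \<in> S \<and> is_nat m \<and> L m z \<and> R (opair n y) (opair m z) \<longrightarrow> opair m z \<in> S;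
        opair n y \<in> S; is_nat n; L n y\<rbrakk> \<Longrightarrow> (\<forall>z. L n z \<longrightarrow> opair n z \<in> S) \<and> (\<exists>z. L (suc n) z \<and> opair (suc n) z \<in> S)"
    and down: "\<And>S n y. \<lbrakk>\<forall>n y m z. opair n y \<in> S \<and> is_nat m \<and> L m z \<and> R (opair n y) (opair m z) \<longrightarrow> opair m z \<in> S;
        opair (suc n) y \<in> S; is_nat n; L (suc n) y\<rbrakk> \<Longrightarrow> \<exists>z. L n z \<and> opair n z \<in> S"
  obtains V E where "inf_lf_conn_graph V E" "els V = {z. \<exists>n y. is_nat n \<and> L n y \<and> z = opair n y}"
    "\<And>u v. adj E u v \<longleftrightarrow> u \<in> els V \<and> v \<in> els V \<and> R u v"
    "\<And>e. e \<in> els E \<longleftrightarrow> (\<exists>u v. u \<in> els V \<and> v \<in> els V \<and> R u v \<and> els e = {u, v})"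
proof -
  note [definable_intros] = definable_app2[OF L] definable_app2[OF R]
  have "small (\<Union>n\<in>{n. is_nat n}. {z. \<exists>y. L n y \<and> z = opair n y})"
  proof (rule small_UN[OF small_nat])
    fix n
    assume "n \<in> {n. is_nat n}"
    then have "small (opair n ` {y. L n y})"
      by (intro small_image Fin_small fin definable_intros) simp
    moreover have "opair n ` {y. L n y} = {z. \<exists>y. L n y \<and> z = opair n y}" by auto
    ultimately show "small {z. \<exists>y. L n y \<and> z = opair n y}" by simp
  qed (rule definable_intros)+
  then obtain V where "els V = (\<Union>n\<in>{n. is_nat n}. {z. \<exists>y. L n y \<and> z = opair n y})" by (rule ex_small)
  then have V: "els V = {z. \<exists>n y. is_nat n \<and> L n y \<and> z = opair n y}" by auto
  have VI: "opair n y \<in> els V \<longleftrightarrow> is_nat n \<and> L n y" for n y unfolding V by auto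
  have "small {e. \<exists>u v. u \<in> els V \<and> v \<in> els V \<and> R u v \<and> els e = {u, v}}"
    by (rule small_subset[OF small_Pow[OF small_els[of V]]]) (force, (rule definable_intros)+)
  then obtain E where E: "els E = {e. \<exists>u v. u \<in> els V \<and> v \<in> els V \<and> R u v \<and> els e = {u, v}}"
    by (rule ex_small)
  have adj: "adj E u v \<longleftrightarrow> u \<in> els V \<and> v \<in> els V \<and> R u v" for u v
  proof
    assume "adj E u v"
    then obtain a b where ab: "a \<in> els V" "b \<in> els V" "R a b" "{u, v} = {a, b}"
      unfolding adj_def E by auto
    then have "(u = a \<and> v = b) \<or> (u = b \<and> v = a)" by (simp add: doubleton_eq_iff)
    then show "u \<in> els V \<and> v \<in> els V \<and> R u v" using ab sym by auto
  next
    assume uv: "u \<in> els V \<and> v \<in> els V \<and> R u v"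
    obtain e where "els e = {u, v}" using pairing by blast
    then show "adj E u v" using uv unfolding adj_def E by blast
  qed
  have graph: "is_graph V E"
    unfolding is_graph_def
  proof
    fix e
    assume "e \<in> els E"
    then obtain u v where uv: "u \<in> els V" "v \<in> els V" "R u v" "els e = {u, v}" unfolding E by blast
    then have "u \<noteq> v" using irr by metis
    then show "\<exists>x\<in>els V. \<exists>y\<in>els V. x \<noteq> y \<and> els e = {x, y}" using uv by blast
  qed
  have "\<not> fin V"
  proof
    assume "fin V"
    then have "Fin {n. \<exists>y. opair n y \<in> els V}" by (intro Fin_levels) (simp add: Fin_els)
    moreover have "{n. \<exists>y. opair n y \<in> els V} = {n. is_nat n}" using ne unfolding VI by blast
    ultimately show False using not_Fin_nat by simp
  qed
  moreover have "locally_finite V E"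
    unfolding locally_finite_def
  proof
    fix v
    assume "v \<in> els V"
    then obtain n y where v: "v = opair n y" and n: "is_nat n" unfolding V by blast
    have "{x. adj E v x} \<subseteq> {z. \<exists>m\<in>els (suc (suc n)). \<exists>y. L m y \<and> z = opair m y}"
    proof
      fix x
      assume "x \<in> {x. adj E v x}"
      then have x: "x \<in> els V" "R v x" unfolding adj by blast+
      then obtain m z where z: "is_nat m" "L m z" "x = opair m z" unfolding V by blast
      have "m \<in> els (suc (suc n))" using near[of n y m z] x(2) unfolding v z by auto
      then show "x \<in> {z. \<exists>m\<in>els (suc (suc n)). \<exists>y. L m y \<and> z = opair m y}" using z by blast
    qed
    moreover have "Fin {z. \<exists>m\<in>els (suc (suc n)). \<exists>y. L m y \<and> z = opair m y}"
      by (rule Fin_layers[OF L fin]) (simp_all add: n)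
    ultimately have "Fin {x. adj E v x}" by - (rule Fin_subset, assumption+, (rule definable_intros)+)
    then show "\<exists>N. els N = {x. adj E v x} \<and> fin N" unfolding Fin_def .
  qed
  moreover have "connected V E"
  proof (rule connectedI[OF graph])
    fix S
    assume SV: "S \<subseteq> els V" and S: "small S" "S \<noteq> {}"
      and cl: "\<forall>u\<in>S. \<forall>v. adj E u v \<longrightarrow> v \<in> S"
    have closed: "\<forall>n y m z. opair n y \<in> S \<and> is_nat m \<and> L m z \<and> R (opair n y) (opair m z) \<longrightarrow> opair m z \<in> S"
    proof (intro allI impI)
      fix n y m z
      assume *: "opair n y \<in> S \<and> is_nat m \<and> L m z \<and> R (opair n y) (opair m z)"
      then have "adj E (opair n y) (opair m z)" unfolding adj using SV VI by blast
      then show "opair m z \<in> S" using cl * by blast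
    qed
    note [definable_intros] = def_set_small[OF S(1)]
    have SL: "is_nat n \<and> L n y" if "opair n y \<in> S" for n y
      using that SV VI by blast
    obtain n0 y0 where "opair n0 y0 \<in> S" "is_nat n0" using S(2) SV unfolding V by blast
    \<comment> \<open>A nonempty closed set first descends to layer zero; from there it climbs
      through every layer and fills it.\<close>
    moreover have "(\<exists>y. opair n y \<in> S) \<longrightarrow> (\<exists>y. opair zero y \<in> S)" if "is_nat n" for n using that
    proof (induction rule: nat_induct)
      case definable
      show ?case by (rule definable_intros)+
    next
      case (suc n)
      show ?case
      proof
        assume "\<exists>y. opair (suc n) y \<in> S"
        then obtain y where y: "opair (suc n) y \<in> S" by blast
        then have "L (suc n) y" using SL by blast
        then obtain z where "opair n z \<in> S" using down[OF closed y suc.hyps] by blast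
        then show "\<exists>y. opair zero y \<in> S" using suc.IH by blast
      qed
    qed simp
    ultimately have base: "\<exists>y. opair zero y \<in> S" by blast
    have all: "\<exists>y. opair n y \<in> S" if "is_nat n" for n using that
    proof (induction rule: nat_induct)
      case definable
      show ?case by (rule definable_intros)+
    next
      case (suc n)
      then obtain y where y: "opair n y \<in> S" by blast
      then have "L n y" using SL by blast
      then show ?case using up[OF closed y suc.hyps] by blast
    qed (rule base)
    show "els V \<subseteq> S"
    proof
      fix v
      assume "v \<in> els V"
      then obtain n z where v: "v = opair n z" "is_nat n" "L n z" unfolding V by blast
      obtain y where y: "opair n y \<in> S" using all[OF v(2)] by blast
      then have "L n y" using SL by blast
      then show "v \<in> S" using up[OF closed y v(2)] v by blast
    qed
  qed
  ultimately have "inf_lf_conn_graph V E" using graph unfolding inf_lf_conn_graph_def by blast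
  moreover have "e \<in> els E \<longleftrightarrow> (\<exists>u v. u \<in> els V \<and> v \<in> els V \<and> R u v \<and> els e = {u, v})" for e
    unfolding E by simp
  ultimately show thesis using that[OF _ V adj] by blast
qed

section \<open>Choice from the thick path: rays, dominating sets and colorings\<close>

definition near :: "'a \<Rightarrow> 'a \<Rightarrow> bool" where
  "near n m \<longleftrightarrow> m = n \<or> m = suc n \<or> n = suc m"

context
  fixes A
  assumes A: "definable (\<lambda>e. A (e 0) (e 1))" and A_fin: "\<And>n. is_nat n \<Longrightarrow> Fin {x. A n x}"
    and A_ne: "\<And>n. is_nat n \<Longrightarrow> \<exists>x. A n x"
begin

lemma thick_path:
  obtains V E where "inf_lf_conn_graph V E"
    "\<And>n x. opair n x \<in> els V \<longleftrightarrow> is_nat n \<and> A n x" "\<And>v. v \<in> els V \<Longrightarrow> \<exists>n x. v = opair n x"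
    "\<And>n x m y. adj E (opair n x) (opair m y) \<longleftrightarrow>
       opair n x \<in> els V \<and> opair m y \<in> els V \<and> opair n x \<noteq> opair m y \<and> near n m"
proof -
  note [definable_intros] = definable_app2[OF A]
  define R where "R u v \<longleftrightarrow> (\<exists>n x m y. u = opair n x \<and> v = opair m y \<and> u \<noteq> v \<and> near n m)" for u v
  have RI: "R (opair n x) (opair m y) \<longleftrightarrow> opair n x \<noteq> opair m y \<and> near n m" for n x m y
    unfolding R_def by auto
  have RD: "definable (\<lambda>e. R (e 0) (e 1))" unfolding R_def near_def by (rule definable_intros)+
  have Rs: "R v u" if "R u v" for u v using that unfolding R_def near_def by auto
  obtain V E where VE: "inf_lf_conn_graph V E" and V: "els V = {z. \<exists>n y. is_nat n \<and> A n y \<and> z = opair n y}"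
    and adj: "\<And>u v. adj E u v \<longleftrightarrow> u \<in> els V \<and> v \<in> els V \<and> R u v"
  proof (rule layered_graph[where R = R, OF A A_fin A_ne RD Rs])
    show "\<not> R u u" for u unfolding R_def by auto
    show "m = n \<or> m = suc n \<or> n = suc m" if "R (opair n y) (opair m z)" for n m y z
      using that unfolding RI near_def by blast
    fix S n y
    assume "\<forall>n y m z. opair n y \<in> S \<and> is_nat m \<and> A m z \<and> R (opair n y) (opair m z) \<longrightarrow> opair m z \<in> S"
    then have cl: "\<And>n y m z. \<lbrakk>opair n y \<in> S; is_nat m; A m z; R (opair n y) (opair m z)\<rbrakk> \<Longrightarrow> opair m z \<in> S"
      by blast
    {
      assume y: "opair n y \<in> S" and n: "is_nat n" and "A n y"
      have "opair n z \<in> S" if "A n z" for z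
        using cl[OF y n that] y unfolding RI near_def by auto
      moreover obtain z where z: "A (suc n) z" using A_ne[of "suc n"] n by auto
      moreover have "n \<noteq> suc n" using mem_irrefl[of n] mem_suc[of n n] by metis
      then have "opair (suc n) z \<in> S" using cl[OF y _ z] n unfolding RI near_def by auto
      ultimately show "(\<forall>z. A n z \<longrightarrow> opair n z \<in> S) \<and> (\<exists>z. A (suc n) z \<and> opair (suc n) z \<in> S)" by blast
    next
      assume y: "opair (suc n) y \<in> S" and n: "is_nat n"
      obtain z where z: "A n z" using A_ne[OF n] by blast
      moreover have "n \<noteq> suc n" using mem_irrefl[of n] mem_suc[of n n] by metis
      then have "opair n z \<in> S" using cl[OF y n z] unfolding RI near_def by auto
      ultimately show "\<exists>z. A n z \<and> opair n z \<in> S" by blast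
    }
  qed (assumption | rule that)+
  show thesis
    using that[OF VE] unfolding adj RI unfolding V by auto
qed

lemma ray_chooses:
  assumes Koenig_lemma
  shows "\<exists>c. chooses A c"
proof -
  note [definable_intros] = definable_app2[OF A]
  obtain V E where VE: "inf_lf_conn_graph V E"
    and V: "\<And>n x. opair n x \<in> els V \<longleftrightarrow> is_nat n \<and> A n x" and V': "\<And>v. v \<in> els V \<Longrightarrow> \<exists>n x. v = opair n x"
    by (rule thick_path) (assumption | rule that)+
  obtain r where "is_ray V E r" using assms VE unfolding Koenig_lemma_def by blast
  then have r: "is_fun r omega V" and inj: "\<And>i j v. maps_to r i v \<Longrightarrow> maps_to r j v \<Longrightarrow> i = j"
    unfolding is_ray_iff is_inj_def by blast+
  define c where "c n x \<longleftrightarrow> A n x \<and> (\<exists>i. is_nat i \<and> maps_to r i (opair n x) \<and>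
    (\<forall>j\<in>els i. \<forall>y. \<not> maps_to r j (opair n y)))" for n x
  show ?thesis
  proof (rule choosesI[where c = c])
    show "definable (\<lambda>e. c (e 0) (e 1))" unfolding c_def by (rule definable_intros)+
    show "A n x" if "c n x" for n x using that unfolding c_def by blast
    show "x = y" if xy: "c n x" "c n y" for n x y
    proof -
      obtain i where i: "is_nat i" "maps_to r i (opair n x)" "\<forall>j\<in>els i. \<forall>y. \<not> maps_to r j (opair n y)"
        using xy(1) unfolding c_def by blast
      obtain j where j: "is_nat j" "maps_to r j (opair n y)" "\<forall>k\<in>els j. \<forall>y. \<not> maps_to r k (opair n y)"
        using xy(2) unfolding c_def by blast
      have "i = j" using nat_linear[OF i(1) j(1)] i j by blast
      then have "opair n x = opair n y" using is_fun_unique[OF r] i(2) j(2) by blast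
      then show ?thesis by simp
    qed
    fix n
    assume n: "is_nat n"
    show "\<exists>m x. is_nat m \<and> n \<in> els (suc m) \<and> c m x"
    proof (rule ccontr)
      assume no: "\<not> ?thesis"
      let ?B = "{z. \<exists>m\<in>els n. \<exists>x. A m x \<and> z = opair m x}"
      \<comment> \<open>If nothing is chosen from index \<open>n\<close> on, the ray stays in the
        layers below \<open>n\<close>, because the first visit to any layer yields a choice there.
        These layers are finite, whereas the ray is injective on omega.\<close>
      have low: "z \<in> ?B" if z: "maps_to r i z" for i z
      proof -
        obtain m x where mx: "z = opair m x" using V' is_fun_dom[OF r z] by blast
        then have m: "is_nat m" "A m x" using V is_fun_dom[OF r z] by blast+
        have i: "is_nat i" using is_fun_dom[OF r z] by simp
        have D: "definable (\<lambda>e. \<exists>y. maps_to r (e 0) (opair m y))" by (rule definable_intros)+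
        have ex: "\<exists>y. maps_to r i (opair m y)" using z mx by blast
        obtain j where j: "is_nat j" "\<exists>y. maps_to r j (opair m y)"
          "\<And>k. k \<in> els j \<Longrightarrow> \<not> (\<exists>y. maps_to r k (opair m y))"
          by (rule nat_least[where P = "\<lambda>i. \<exists>y. maps_to r i (opair m y)", OF i ex D]) (assumption | rule that)+
        then obtain y where y: "maps_to r j (opair m y)" by blast
        then have "A m y" using V is_fun_dom[OF r y] by blast
        then have "c m y" unfolding c_def using j y by blast
        then have "n \<notin> els (suc m)" using no m(1) by blast
        then have "m \<in> els n" using nat_linear[OF n m(1)] by auto
        then show ?thesis using m(2) mx by blast
      qed
      have "Fin (\<Union>z\<in>?B. {i. maps_to r i z})"
      proof (rule Fin_UN[OF Fin_layers[OF A A_fin n]])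
        fix z
        show "Fin {i. maps_to r i z}"
        proof (cases "\<exists>i. maps_to r i z")
          case True
          then obtain i where "maps_to r i z" by blast
          then have "{i. maps_to r i z} = {i}" using inj by blast
          then show ?thesis by (simp add: Fin_single)
        next
          case False
          then have "{i. maps_to r i z} = {}" by blast
          then show ?thesis by (simp add: Fin_empty)
        qed
      qed (assumption | rule definable_intros)+
      moreover have "{i. is_nat i} \<subseteq> (\<Union>z\<in>?B. {i. maps_to r i z})"
      proof
        fix i
        assume "i \<in> {i. is_nat i}"
        then obtain z where z: "maps_to r i z" using is_fun_ex[OF r, of i] by auto
        then show "i \<in> (\<Union>z\<in>?B. {i. maps_to r i z})" using low[OF z] by blast
      qed
      ultimately have "Fin {i. is_nat i}" by (rule Fin_subset) (rule definable_intros)+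
      then show False using not_Fin_nat by blast
    qed
  qed
qed

lemma dominating_chooses:
  assumes dominating_set_principle
  shows "\<exists>c. chooses A c"
proof -
  obtain V E where VE: "inf_lf_conn_graph V E"
    and V: "\<And>n x. opair n x \<in> els V \<longleftrightarrow> is_nat n \<and> A n x" and V': "\<And>v. v \<in> els V \<Longrightarrow> \<exists>n x. v = opair n x"
    and adj: "\<And>n x m y. adj E (opair n x) (opair m y) \<longleftrightarrow>
       opair n x \<in> els V \<and> opair m y \<in> els V \<and> opair n x \<noteq> opair m y \<and> near n m"
    by (rule thick_path) (assumption | rule that)+
  obtain D where "minimal_dominating V E D"
    using assms VE unfolding dominating_set_principle_def by blast
  then have D: "dominating V E D" and Dmin: "\<And>D'. els D' \<subset> els D \<Longrightarrow> \<not> dominating V E D'"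
    unfolding minimal_dominating_def by blast+
  have DV: "els D \<subseteq> els V" and dom: "\<And>v. v \<in> els V \<Longrightarrow> v \<in> els D \<or> (\<exists>d\<in>els D. adj E v d)"
    using D unfolding dominating_iff by blast+
  show ?thesis
  proof (rule choosesI[where c = "\<lambda>n x. opair n x \<in> els D"])
    show "definable (\<lambda>e. opair (e 0) (e 1) \<in> els D)" by (rule definable_intros)+
    show "A n x" if "opair n x \<in> els D" for n x using that DV V by blast
    show "x = y" if x: "opair n x \<in> els D" and y: "opair n y \<in> els D" for n x y
    proof (rule ccontr)
      assume "x \<noteq> y"
      have "small (els D - {opair n x})"
        by (rule small_subset[OF small_els[of D]]) (blast, (rule definable_intros)+)
      then obtain D' where D': "els D' = els D - {opair n x}" by (rule ex_small)
      have y': "opair n y \<in> els D'" using y \<open>x \<noteq> y\<close> unfolding D' by simp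
      \<comment> \<open>Everything dominated by the point removed is dominated by its twin
        \<open>y\<close> in the same layer, including the two points themselves.\<close>
      have tw: "v \<in> els D' \<or> (\<exists>d\<in>els D'. adj E v d)"
        if v: "v \<in> els V" "v = opair n x \<or> adj E v (opair n x)" for v
      proof -
        obtain m z where z: "v = opair m z" using V' v(1) by blast
        have "near m n" using v(2) adj unfolding z near_def by auto
        then have "v = opair n y \<or> adj E v (opair n y)" using adj v(1) y DV unfolding z by blast
        then show ?thesis using y' by blast
      qed
      have "v \<in> els D' \<or> (\<exists>d\<in>els D'. adj E v d)" if v: "v \<in> els V" for v
        using dom[OF v] tw[OF v] unfolding D' by blast
      then have "dominating V E D'" unfolding dominating_iff using DV D' by blast
      moreover have "els D' \<subset> els D" using x unfolding D' by blast
      ultimately show False using Dmin by blast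
    qed
    fix n
    assume n: "is_nat n"
    \<comment> \<open>Starting one layer above \<open>n\<close> guarantees that a dominating
      neighbour still lies in a layer of index at least \<open>n\<close>.\<close>
    obtain x where x: "A (suc n) x" using A_ne[of "suc n"] n by auto
    then have "opair (suc n) x \<in> els V" using V n by simp
    then consider "opair (suc n) x \<in> els D" | d where "d \<in> els D" "adj E (opair (suc n) x) d" using dom by blast
    then show "\<exists>m x. is_nat m \<and> n \<in> els (suc m) \<and> opair m x \<in> els D"
    proof cases
      case 1
      moreover have "is_nat (suc n)" "n \<in> els (suc (suc n))" using n by auto
      ultimately show ?thesis by blast
    next
      case 2
      then obtain m y where d: "d = opair m y" using V' DV by blast
      then have "is_nat m" using V 2(1) DV by blast
      moreover have "near (suc n) m" using 2(2) adj unfolding d by blast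
      then have "n \<in> els (suc m)" unfolding near_def by auto
      ultimately show ?thesis using 2(1) d by blast
    qed
  qed
qed

lemma coloring_chooses:
  assumes coloring_principle
  shows "\<exists>c. chooses A c"
proof -
  note [definable_intros] = definable_app2[OF A]
  obtain V E where VE: "inf_lf_conn_graph V E"
    and V: "\<And>n x. opair n x \<in> els V \<longleftrightarrow> is_nat n \<and> A n x" and V': "\<And>v. v \<in> els V \<Longrightarrow> \<exists>n x. v = opair n x"
    and adj: "\<And>n x m y. adj E (opair n x) (opair m y) \<longleftrightarrow>
       opair n x \<in> els V \<and> opair m y \<in> els V \<and> opair n x \<noteq> opair m y \<and> near n m"
    by (rule thick_path) (assumption | rule that)+
  obtain C f where "irreducible_proper_coloring V E C f"
    using assms VE unfolding coloring_principle_def by blast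
  then have f: "is_fun f V C"
    and proper: "\<And>x y c. adj E x y \<Longrightarrow> maps_to f x c \<Longrightarrow> maps_to f y c \<Longrightarrow> False"
    and irred: "\<And>c1 c2. c1 \<in> els C \<Longrightarrow> c2 \<in> els C \<Longrightarrow> c1 \<noteq> c2 \<Longrightarrow>
      \<exists>S. els S = {x. maps_to f x c1} \<union> {x. maps_to f x c2} \<and> dependent E S"
    unfolding irreducible_proper_coloring_def proper_coloring_def by blast+
  have same: "x = y" if "maps_to f (opair n x) k" "maps_to f (opair n y) k" for n x y k
  proof (rule ccontr)
    assume "x \<noteq> y"
    then have "adj E (opair n x) (opair n y)"
      unfolding adj near_def using is_fun_dom[OF f that(1)] is_fun_dom[OF f that(2)] by simp
    then show False using proper that by blast
  qed
  have fA: "is_nat n \<and> A n x" if "maps_to f (opair n x) k" for n x k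
    using is_fun_dom[OF f that] V by blast
  have f_ex: "\<exists>k. maps_to f (opair n x) k" if "is_nat n" "A n x" for n x
    using is_fun_ex[OF f] V that by blast
  show ?thesis
  proof (cases "Fin (els C)")
    case True
    \<comment> \<open>A single finite set can be ordered without choice, and its order then selects
      a color in all layers at once.\<close>
    then obtain w where w: "chain_wo (els C) w" using Fin_chain_wo_ex by blast
    have W: "wo (els C) (chain_less w)"
      unfolding wo_def
    proof (intro conjI allI impI)
      show "definable (\<lambda>e. chain_less w (e 0) (e 1))" by (rule definable_intros)+
      fix S :: "'a set"
      assume S: "small S \<and> S \<subseteq> els C \<and> S \<noteq> {}"
      then obtain s where s: "els s = S" unfolding small_def by blast
      show "\<exists>x\<in>S. \<forall>y\<in>S. \<not> chain_less w y x \<and> (y \<noteq> x \<longrightarrow> chain_less w x y)"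
        using w S unfolding chain_wo_def s[symmetric] by simp
    qed
    define c where "c n x \<longleftrightarrow> A n x \<and> (\<exists>k. maps_to f (opair n x) k \<and>
      (\<forall>y k'. maps_to f (opair n y) k' \<longrightarrow> k' \<noteq> k \<longrightarrow> chain_less w k k'))" for n x
    show ?thesis
    proof (rule choosesI[where c = c])
      show "definable (\<lambda>e. c (e 0) (e 1))" unfolding c_def by (rule definable_intros)+
      show "A n x" if "c n x" for n x using that unfolding c_def by blast
      show "x = y" if xy: "c n x" "c n y" for n x y
      proof -
        obtain k where k: "maps_to f (opair n x) k" "\<And>y k'. maps_to f (opair n y) k' \<Longrightarrow> k' \<noteq> k \<Longrightarrow> chain_less w k k'"
          using xy(1) unfolding c_def by blast
        obtain l where l: "maps_to f (opair n y) l" "\<And>y k'. maps_to f (opair n y) k' \<Longrightarrow> k' \<noteq> l \<Longrightarrow> chain_less w l k'"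
          using xy(2) unfolding c_def by blast
        have kl: "k \<in> els C" "l \<in> els C" using is_fun_dom[OF f] k(1) l(1) by blast+
        have "k = l"
        proof (rule ccontr)
          assume "k \<noteq> l"
          then have "chain_less w k l" "chain_less w l k" using k(2)[OF l(1)] l(2)[OF k(1)] by blast+
          then show False using wo_asym[OF W kl] by blast
        qed
        then show ?thesis using same k(1) l(1) by blast
      qed
      fix n
      assume n: "is_nat n"
      obtain x0 where "A n x0" using A_ne[OF n] by blast
      then obtain k0 where k0: "maps_to f (opair n x0) k0" using f_ex n by blast
      then have k0': "k0 \<in> els C" "\<exists>x. maps_to f (opair n x) k0" using is_fun_dom[OF f] by blast+
      have D: "definable (\<lambda>e. \<exists>x. maps_to f (opair n x) (e 0))" by (rule definable_intros)+
      obtain k where k: "k \<in> els C" "\<exists>x. maps_to f (opair n x) k"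
        and kl: "\<And>y. y \<in> els C \<Longrightarrow> \<exists>x. maps_to f (opair n x) y \<Longrightarrow> \<not> chain_less w y k \<and> (y \<noteq> k \<longrightarrow> chain_less w k y)"
        by (rule wo_least[where P = "\<lambda>k. \<exists>x. maps_to f (opair n x) k", OF W small_els D k0'])
           (assumption | rule that)+
      then obtain x where x: "maps_to f (opair n x) k" by blast
      then have "c n x" unfolding c_def using fA is_fun_dom[OF f] kl by blast
      moreover have "n \<in> els (suc n)" by simp
      ultimately show "\<exists>m x. is_nat m \<and> n \<in> els (suc m) \<and> c m x" using n by blast
    qed
  next
    case False
    \<comment> \<open>Any color in use will do as \<open>k0\<close>; a layer contains at most one
      point of it, since points of a layer are pairwise adjacent.\<close>
    obtain x0 where "A zero x0" using A_ne[of zero] by auto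
    then obtain k0 where "maps_to f (opair zero x0) k0" using f_ex[of zero] by auto
    then have k0: "k0 \<in> els C" using is_fun_dom[OF f] by blast
    show ?thesis
    proof (rule choosesI[where c = "\<lambda>n x. maps_to f (opair n x) k0"])
      show "definable (\<lambda>e. maps_to f (opair (e 0) (e 1)) k0)" by (rule definable_intros)+
      show "x = y" if "maps_to f (opair n x) k0" "maps_to f (opair n y) k0" for n x y
        using same that by blast
      show "A n x" if "maps_to f (opair n x) k0" for n x using fA that by blast
      fix n
      assume n: "is_nat n"
      show "\<exists>m x. is_nat m \<and> n \<in> els (suc m) \<and> maps_to f (opair m x) k0"
      proof (rule ccontr)
        assume no: "\<not> ?thesis"
        have low: "m \<in> els n" if "maps_to f (opair m x) k0" for m x
        proof -
          have "is_nat m" using fA that by blast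
          then show ?thesis using no that nat_linear[OF n, of m] by auto
        qed
        let ?B = "{z. \<exists>m\<in>els (suc n). \<exists>x. A m x \<and> z = opair m x}"
        have near_low: "v \<in> ?B" if uv: "adj E u v" "maps_to f u k0" for u v
        proof -
          have "u \<in> els V" "v \<in> els V"
            using uv adj_graph VE unfolding inf_lf_conn_graph_def by blast+
          then obtain m x l y where uv': "u = opair m x" "v = opair l y" and "is_nat l" "A l y"
            using V V' by metis
          moreover have "near m l" using uv(1) adj unfolding uv' by blast
          moreover have "m \<in> els n" using low uv(2) uv' by blast
          moreover then have "suc m \<in> els (suc n)" using suc_mem_suc[OF n] by blast
          ultimately have "l \<in> els (suc n)"
            using nat_trans[OF n, of m l] unfolding near_def by auto
          then show ?thesis using uv' \<open>A l y\<close> by blast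
        qed
        have "els C \<subseteq> insert k0 (\<Union>v\<in>?B. {k. maps_to f v k})"
        proof
          fix k
          assume k: "k \<in> els C"
          show "k \<in> insert k0 (\<Union>v\<in>?B. {k. maps_to f v k})"
          proof (cases "k = k0")
            case False
            then obtain S where S: "els S = {x. maps_to f x k0} \<union> {x. maps_to f x k}" "dependent E S"
              using irred[OF k0 k] by blast
            then obtain u v where uv: "u \<in> els S" "v \<in> els S" "adj E u v" unfolding dependent_def by blast
            \<comment> \<open>Each color class is independent, so the edge supplied by
              irreducibility joins the two classes. Its end of color \<open>k\<close> thus lies next
              to a vertex of color \<open>k0\<close>.\<close>
            then have "(maps_to f u k0 \<and> maps_to f v k) \<or> (maps_to f v k0 \<and> maps_to f u k)"
              using proper unfolding S(1) by blast
            then obtain z where "z \<in> ?B" "maps_to f z k"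
              using near_low[OF uv(3)] near_low[OF adj_sym[OF uv(3)]] by auto
            then show ?thesis by (intro insertI2 UN_I[of z]) simp_all
          qed simp
        qed
        moreover have "Fin (insert k0 (\<Union>v\<in>?B. {k. maps_to f v k}))"
        proof (rule Fin_insert, rule Fin_UN[OF Fin_layers[OF A A_fin is_nat_suc[OF n]]])
          fix v
          show "Fin {k. maps_to f v k}"
          proof (cases "\<exists>k. maps_to f v k")
            case True
            then obtain k where "maps_to f v k" by blast
            then have "{k. maps_to f v k} = {k}" using is_fun_unique[OF f] by blast
            then show ?thesis by (simp add: Fin_single)
          next
            case False
            then have "{k. maps_to f v k} = {}" by blast
            then show ?thesis by (simp add: Fin_empty)
          qed
        qed (assumption | rule definable_intros)+
        ultimately have "Fin (els C)" by - (rule Fin_subset, assumption+, (rule definable_intros)+)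
        then show False using False by blast
      qed
    qed
  qed
qed

end

section \<open>Graphs with hubs\<close>

text \<open>The outer index is the layer, as \<open>layered_graph\<close> expects; inside it the
  tags 0, 1 and 2 separate points, pendants and hubs.\<close>

definition hub :: "'a \<Rightarrow> 'a" where "hub n = opair n (opair (suc (suc zero)) zero)"
definition point :: "'a \<Rightarrow> 'a \<Rightarrow> 'a" where "point n x = opair n (opair zero x)"
definition pendant :: "'a \<Rightarrow> 'a \<Rightarrow> 'a" where "pendant n x = opair n (opair (suc zero) x)"

lemma hub_point_pendant [simp]:
  "hub n = hub m \<longleftrightarrow> n = m" "point n x = point m y \<longleftrightarrow> n = m \<and> x = y" "pendant n x = pendant m y \<longleftrightarrow> n = m \<and> x = y"
  "hub n \<noteq> point m x" "point m x \<noteq> hub n" "hub n \<noteq> pendant m x" "pendant m x \<noteq> hub n" "point n x \<noteq> pendant m y" "pendant m y \<noteq> point n x"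
  by (simp_all add: hub_def point_def pendant_def)

lemma def_term_hub [definable_intros]: "def_term s \<Longrightarrow> def_term (\<lambda>e. hub (s e))"
  unfolding hub_def by (intro definable_intros)

lemma def_term_point [definable_intros]: "def_term s \<Longrightarrow> def_term t \<Longrightarrow> def_term (\<lambda>e. point (s e) (t e))"
  unfolding point_def by (intro definable_intros)

lemma def_term_pendant [definable_intros]: "def_term s \<Longrightarrow> def_term t \<Longrightarrow> def_term (\<lambda>e. pendant (s e) (t e))"
  unfolding pendant_def by (intro definable_intros)

context
  fixes A
  assumes A: "definable (\<lambda>e. A (e 0) (e 1))" and A_fin: "\<And>n. is_nat n \<Longrightarrow> Fin {x. A n x}"
    and A_ne: "\<And>n. is_nat n \<Longrightarrow> \<exists>x. A n x"
begin

text \<open>The flag \<open>pend\<close> switches the pendant vertices on, so that one construction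
  serves matchings and edge covers alike.\<close>

lemma hub_graph:
  fixes pend :: bool
  obtains V E where "inf_lf_conn_graph V E"
    "\<And>n. hub n \<in> els V \<longleftrightarrow> is_nat n" "\<And>n x. point n x \<in> els V \<longleftrightarrow> is_nat n \<and> A n x"
    "\<And>n x. pendant n x \<in> els V \<longleftrightarrow> is_nat n \<and> A n x \<and> pend"
    "\<And>e. e \<in> els E \<longleftrightarrow> (\<exists>k m x. is_nat k \<and> is_nat m \<and> A m x \<and> (m = k \<or> m = suc k) \<and> els e = {hub k, point m x}) \<or>
       (\<exists>m x. is_nat m \<and> A m x \<and> pend \<and> els e = {point m x, pendant m x})"
proof -
  note [definable_intros] = definable_app2[OF A]
  define L where "L n y \<longleftrightarrow> y = opair (suc (suc zero)) zero \<or> (\<exists>x. A n x \<and> y = opair zero x) \<or>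
    (pend \<and> (\<exists>x. A n x \<and> y = opair (suc zero) x))" for n y
  define R0 where "R0 u v \<longleftrightarrow> (\<exists>k m x. u = hub k \<and> v = point m x \<and> (m = k \<or> m = suc k)) \<or>
    (\<exists>m x. u = point m x \<and> v = pendant m x)" for u v
  define R where "R u v \<longleftrightarrow> R0 u v \<or> R0 v u" for u v
  have LD: "definable (\<lambda>e. L (e 0) (e 1))" unfolding L_def by (rule definable_intros)+
  have RD: "definable (\<lambda>e. R (e 0) (e 1))" unfolding R_def R0_def by (rule definable_intros)+
  have Rs: "R v u" if "R u v" for u v using that unfolding R_def by blast
  have Rhub: "R (hub k) (point m x)" "R (point m x) (hub k)" if "m = k \<or> m = suc k" for k m x
    using that unfolding R_def R0_def by blast+
  have Rpd: "R (point m x) (pendant m x)" "R (pendant m x) (point m x)" for m x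
    unfolding R_def R0_def by blast+
  have LF: "Fin {y. L n y}" if n: "is_nat n" for n
  proof -
    let ?T = "insert (opair (suc (suc zero)) zero) (opair zero ` {x. A n x} \<union> opair (suc zero) ` {x. A n x})"
    have "Fin ?T"
      by (intro Fin_insert Fin_Un Fin_image A_fin n definable_intros)
    moreover have "{y. L n y} \<subseteq> ?T" unfolding L_def by auto
    moreover have "def_set (\<lambda>e. {y. L n y})" unfolding L_def by (rule definable_intros)+
    ultimately show ?thesis by (rule Fin_subset)
  qed
  have LN: "\<exists>y. L n y" for n unfolding L_def by blast
  have level: "m = n \<or> m = suc n \<or> n = suc m" if "R (opair n y) (opair m z)" for n m y z
    using that unfolding R_def R0_def hub_def point_def pendant_def by auto
  have Lpt: "L n (opair zero x) \<longleftrightarrow> A n x" and Lhub: "L n (opair (suc (suc zero)) zero)"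
    and Lpd: "L n (opair (suc zero) x) \<longleftrightarrow> pend \<and> A n x" for n x
    unfolding L_def by auto
  obtain V E where VE: "inf_lf_conn_graph V E" and V: "els V = {z. \<exists>n y. is_nat n \<and> L n y \<and> z = opair n y}"
    and E: "\<And>e. e \<in> els E \<longleftrightarrow> (\<exists>u v. u \<in> els V \<and> v \<in> els V \<and> R u v \<and> els e = {u, v})"
  proof (rule layered_graph[where R = R and L = L, OF LD LF LN RD Rs])
    show "\<not> R u u" for u unfolding R_def R0_def by auto
    show "m = n \<or> m = suc n \<or> n = suc m" if "R (opair n y) (opair m z)" for n m y z
      using that by (rule level)
    fix S n y
    assume "\<forall>n y m z. opair n y \<in> S \<and> is_nat m \<and> L m z \<and> R (opair n y) (opair m z) \<longrightarrow> opair m z \<in> S"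
    then have cl: "opair m z \<in> S" if "opair n y \<in> S" "is_nat m" "L m z" "R (opair n y) (opair m z)" for n y m z
      using that by blast
    have to_pt: "point m x \<in> S" if "hub k \<in> S" "is_nat m" "A m x" "m = k \<or> m = suc k" for k m x
      using cl[of k _ m "opair zero x"] that Rhub(1)[OF that(4), of x] Lpt unfolding hub_def point_def by blast
    have to_hub: "hub k \<in> S" if "point m x \<in> S" "is_nat k" "m = k \<or> m = suc k" for k m x
      using cl[of m _ k] that Rhub(2)[OF that(3), of x] Lhub unfolding hub_def point_def by blast
    have to_pd: "pendant m x \<in> S" if "point m x \<in> S" "is_nat m" "A m x" pend for m x
      using cl[of m _ m "opair (suc zero) x"] that Rpd(1)[of m x] Lpd unfolding pendant_def point_def by blast
    have from_pd: "point m x \<in> S" if "pendant m x \<in> S" "is_nat m" "A m x" for m x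
      using cl[of m _ m "opair zero x"] that Rpd(2)[of m x] Lpt unfolding pendant_def point_def by blast
    \<comment> \<open>The hub is the centre of its layer: every point is adjacent to it, and every
      pendant leads to it through its point.\<close>
    have hubS: "hub n \<in> S" if y: "opair n y \<in> S" "is_nat n" "L n y" for n y
    proof -
      consider "y = opair (suc (suc zero)) zero" | x where "y = opair zero x" | x where "A n x" "y = opair (suc zero) x"
        using y(3) unfolding L_def by blast
      then show ?thesis
      proof cases
        case 1
        then show ?thesis using y(1) unfolding hub_def by simp
      next
        case 2
        then have "point n x \<in> S" using y(1) unfolding point_def by simp
        then show ?thesis using to_hub y(2) by blast
      next
        case 3
        then have "pendant n x \<in> S" using y(1) unfolding pendant_def by simp
        then have "point n x \<in> S" using from_pd y(2) 3(1) by blast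
        then show ?thesis using to_hub y(2) by blast
      qed
    qed
    {
      assume y: "opair n y \<in> S" and n: "is_nat n" and Ly: "L n y"
      have h: "hub n \<in> S" by (rule hubS[OF y n Ly])
      have "opair n z \<in> S" if z: "L n z" for z
      proof -
        consider "z = opair (suc (suc zero)) zero" | x where "A n x" "z = opair zero x"
          | x where "A n x" pend "z = opair (suc zero) x"
          using z unfolding L_def by blast
        then show ?thesis
        proof cases
          case 1
          then show ?thesis using h unfolding hub_def by simp
        next
          case 2
          then show ?thesis using to_pt[OF h n] unfolding point_def by blast
        next
          case 3
          then have "point n x \<in> S" using to_pt[OF h n] by blast
          then show ?thesis using to_pd n 3 unfolding pendant_def by blast
        qed
      qed
      moreover obtain x where x: "A (suc n) x" using A_ne[of "suc n"] n by auto
      then have "point (suc n) x \<in> S" using to_pt[OF h _ x] n by simp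
      then have "\<exists>z. L (suc n) z \<and> opair (suc n) z \<in> S" using x Lpt unfolding point_def by blast
      ultimately show "(\<forall>z. L n z \<longrightarrow> opair n z \<in> S) \<and> (\<exists>z. L (suc n) z \<and> opair (suc n) z \<in> S)" by blast
    next
      assume y: "opair (suc n) y \<in> S" and n: "is_nat n" and Ly: "L (suc n) y"
      have h: "hub (suc n) \<in> S" using hubS[OF y _ Ly] n by simp
      \<comment> \<open>The descent from hub \<open>n + 1\<close> to hub \<open>n\<close> passes
        through a point of \<open>A (n + 1)\<close>, to which both are joined.\<close>
      obtain x where x: "A (suc n) x" using A_ne[of "suc n"] n by auto
      then have "point (suc n) x \<in> S" using to_pt[OF h _ x] n by simp
      then have "hub n \<in> S" using to_hub n by blast
      then show "\<exists>z. L n z \<and> opair n z \<in> S" using Lhub unfolding hub_def by blast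
    }
  qed (assumption | rule that)+
  have VI: "opair n y \<in> els V \<longleftrightarrow> is_nat n \<and> L n y" for n y unfolding V by auto
  have Vhub: "hub n \<in> els V \<longleftrightarrow> is_nat n" for n unfolding hub_def VI using Lhub by blast
  have Vpt: "point n x \<in> els V \<longleftrightarrow> is_nat n \<and> A n x" for n x unfolding point_def VI Lpt by blast
  have Vpd: "pendant n x \<in> els V \<longleftrightarrow> is_nat n \<and> A n x \<and> pend" for n x unfolding pendant_def VI Lpd by blast
  have "e \<in> els E \<longleftrightarrow> (\<exists>u v. u \<in> els V \<and> v \<in> els V \<and> R0 u v \<and> els e = {u, v})" for e
    unfolding E R_def by (metis insert_commute)
  moreover have "(\<exists>u v. u \<in> els V \<and> v \<in> els V \<and> R0 u v \<and> els e = {u, v}) \<longleftrightarrow>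
      (\<exists>k m x. is_nat k \<and> is_nat m \<and> A m x \<and> (m = k \<or> m = suc k) \<and> els e = {hub k, point m x}) \<or>
      (\<exists>m x. is_nat m \<and> A m x \<and> pend \<and> els e = {point m x, pendant m x})" (is "?L \<longleftrightarrow> ?R") for e
  proof
    assume ?L
    then obtain u v where uv: "u \<in> els V" "v \<in> els V" "R0 u v" "els e = {u, v}" by blast
    from uv(3) consider k m x where "u = hub k" "v = point m x" "m = k \<or> m = suc k"
      | m x where "u = point m x" "v = pendant m x" unfolding R0_def by blast
    then show ?R
    proof cases
      case 1
      then have "is_nat k" "is_nat m" "A m x" "els e = {hub k, point m x}" using uv Vhub Vpt by auto
      then show ?thesis using 1(3) by blast
    next
      case 2
      then have "is_nat m" "A m x" "pend" "els e = {point m x, pendant m x}" using uv Vpd by auto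
      then show ?thesis by blast
    qed
  next
    assume ?R
    then consider k m x where "is_nat k" "is_nat m" "A m x" "m = k \<or> m = suc k" "els e = {hub k, point m x}"
      | m x where "is_nat m" "A m x" pend "els e = {point m x, pendant m x}" by blast
    then show ?L
    proof cases
      case 1
      then have "hub k \<in> els V" "point m x \<in> els V" "R0 (hub k) (point m x)"
        using Vhub Vpt unfolding R0_def by blast+
      then show ?thesis using 1(5) by blast
    next
      case 2
      then have "point m x \<in> els V" "pendant m x \<in> els V" "R0 (point m x) (pendant m x)"
        using Vpt Vpd unfolding R0_def by blast+
      then show ?thesis using 2(4) by blast
    qed
  qed
  ultimately have "e \<in> els E \<longleftrightarrow>
      (\<exists>k m x. is_nat k \<and> is_nat m \<and> A m x \<and> (m = k \<or> m = suc k) \<and> els e = {hub k, point m x}) \<or>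
      (\<exists>m x. is_nat m \<and> A m x \<and> pend \<and> els e = {point m x, pendant m x})" for e
    by (simp only:)
  then show thesis by (rule that[OF VE Vhub Vpt Vpd])
qed

text \<open>Here \<open>Z\<close> stands for the matching or the edge cover. If each hub has at most
  one edge in \<open>Z\<close>, the edges of a hub yield at most one point in any layer.\<close>

lemma hub_choice:
  assumes T: "\<And>k m x. T k m x \<longleftrightarrow> is_nat k \<and> A m x \<and> (m = k \<or> m = suc k) \<and> (\<exists>e\<in>els Z. els e = {hub k, point m x})"
    and unique: "\<And>k m x m' x'. T k m x \<Longrightarrow> T k m' x' \<Longrightarrow> x = x'"
    and unbounded: "\<And>n. is_nat n \<Longrightarrow> \<exists>k m x. n \<in> els (suc m) \<and> T k m x"
  shows "\<exists>c. chooses A c"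
proof -
  note [definable_intros] = definable_app2[OF A]
  (* A point of A m can be met by the edges of the hubs m and m - 1 only; prefer hub m. *)
  define c where "c m x \<longleftrightarrow> T m m x \<or> ((\<nexists>y. T m m y) \<and> (\<exists>k. m = suc k \<and> T k m x))" for m x
  show ?thesis
  proof (rule choosesI[where c = c])
    show "definable (\<lambda>e. c (e 0) (e 1))" unfolding c_def T by (rule definable_intros)+
    show "A m x" if "c m x" for m x using that T unfolding c_def by blast
    show "x = y" if "c m x" "c m y" for m x y
      using that unique[of m m x m y] unique[of _ m x m y] unfolding c_def by auto
    fix n
    assume "is_nat n"
    then obtain k m x where kmx: "n \<in> els (suc m)" "T k m x" using unbounded by blast
    then have "m = k \<or> m = suc k" "is_nat k" using T by blast+
    then have "is_nat m" "\<exists>y. c m y" using kmx(2) unfolding c_def by auto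
    then show "\<exists>m x. is_nat m \<and> n \<in> els (suc m) \<and> c m x" using kmx(1) by blast
  qed
qed

lemma matching_chooses:
  assumes matching_principle
  shows "\<exists>c. chooses A c"
proof -
  obtain V E where VE: "inf_lf_conn_graph V E"
    and E: "\<And>e. e \<in> els E \<longleftrightarrow>
      (\<exists>k m x. is_nat k \<and> is_nat m \<and> A m x \<and> (m = k \<or> m = suc k) \<and> els e = {hub k, point m x}) \<or>
      (\<exists>m x. is_nat m \<and> A m x \<and> False \<and> els e = {point m x, pendant m x})"
    by (rule hub_graph[of False]) (rule that)
  obtain M where "maximal_matching E M"
    using assms VE unfolding matching_principle_def by blast
  then have M: "matching E M" and Mmax: "\<And>M'. els M \<subset> els M' \<Longrightarrow> \<not> matching E M'"
    unfolding maximal_matching_def by blast+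
  have ME: "els M \<subseteq> els E"
    and Mdisj: "\<And>e e' x. e \<in> els M \<Longrightarrow> e' \<in> els M \<Longrightarrow> x \<in> els e \<Longrightarrow> x \<in> els e' \<Longrightarrow> e = e'"
    using M unfolding matching_def by blast+
  define T where "T k m x \<longleftrightarrow> is_nat k \<and> A m x \<and> (m = k \<or> m = suc k) \<and>
    (\<exists>e\<in>els M. els e = {hub k, point m x})" for k m x
  show ?thesis
  proof (rule hub_choice[OF T_def])
    fix k m x m' x'
    assume "T k m x" "T k m' x'"
    then obtain e e' where e: "e \<in> els M" "els e = {hub k, point m x}" and e': "e' \<in> els M" "els e' = {hub k, point m' x'}"
      unfolding T_def by blast
    then have "e = e'" using Mdisj[of e e' "hub k"] by simp
    then have "{hub k, point m x} = {hub k, point m' x'}" using e(2) e'(2) by simp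
    then show "x = x'" by (simp add: doubleton_eq_iff)
  next
    fix n
    assume n: "is_nat n"
    then obtain x where x: "A (suc n) x" using A_ne[of "suc n"] by auto
    \<comment> \<open>By maximality this edge meets an edge of the matching, possibly itself.
      Sharing hub \<open>n\<close> or a point of layer \<open>n + 1\<close> forces that edge to end
      in a layer of index at least \<open>n\<close>.\<close>
    obtain e where e: "els e = {hub n, point (suc n) x}" using pairing by blast
    have eE: "e \<in> els E" using E n x e is_nat_suc[OF n] by blast
    have "\<exists>e'\<in>els M. els e' \<inter> els e \<noteq> {}"
    proof (rule ccontr)
      assume no: "\<not> ?thesis"
      then have "matching E (ins e M)"
        using M eE unfolding matching_def by (auto simp: Int_commute)
      moreover have "e \<notin> els M" using no e by auto
      then have "els M \<subset> els (ins e M)" by auto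
      ultimately show False using Mmax by blast
    qed
    then obtain e' where e': "e' \<in> els M" "els e' \<inter> els e \<noteq> {}" by blast
    then obtain k m y where kmy: "is_nat k" "A m y" "m = k \<or> m = suc k" "els e' = {hub k, point m y}"
      using ME E by blast
    then have "T k m y" unfolding T_def using e'(1) by blast
    moreover have "k = n \<or> m = suc n" using e'(2) unfolding e kmy(4) by auto
    then have "n \<in> els (suc m)" using kmy(3) by auto
    ultimately show "\<exists>k m x. n \<in> els (suc m) \<and> T k m x" by blast
  qed
qed

lemma edge_cover_chooses:
  assumes edge_cover_principle
  shows "\<exists>c. chooses A c"
proof -
  obtain V E where VE: "inf_lf_conn_graph V E"
    and Vhub: "\<And>n. hub n \<in> els V \<longleftrightarrow> is_nat n"
    and Vpd: "\<And>n x. pendant n x \<in> els V \<longleftrightarrow> is_nat n \<and> A n x \<and> True"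
    and E: "\<And>e. e \<in> els E \<longleftrightarrow>
      (\<exists>k m x. is_nat k \<and> is_nat m \<and> A m x \<and> (m = k \<or> m = suc k) \<and> els e = {hub k, point m x}) \<or>
      (\<exists>m x. is_nat m \<and> A m x \<and> True \<and> els e = {point m x, pendant m x})"
    by (rule hub_graph[of True]) (rule that)
  obtain F where "minimal_edge_cover V E F"
    using assms VE unfolding edge_cover_principle_def by blast
  then have F: "edge_cover V E F" and Fmin: "\<And>F'. els F' \<subset> els F \<Longrightarrow> \<not> edge_cover V E F'"
    unfolding minimal_edge_cover_def by blast+
  have FE: "els F \<subseteq> els E" and cov: "\<And>v. v \<in> els V \<Longrightarrow> \<exists>e\<in>els F. v \<in> els e"
    using F unfolding edge_cover_iff by blast+
  define T where "T k m x \<longleftrightarrow> is_nat k \<and> A m x \<and> (m = k \<or> m = suc k) \<and>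
    (\<exists>e\<in>els F. els e = {hub k, point m x})" for k m x
  show ?thesis
  proof (rule hub_choice[OF T_def])
    fix k m x m' x'
    assume kmx: "T k m x" "T k m' x'"
    then obtain e e' where e: "e \<in> els F" "els e = {hub k, point m x}" and e': "e' \<in> els F" "els e' = {hub k, point m' x'}"
      unfolding T_def by blast
    show "x = x'"
    proof (rule ccontr)
      assume "x \<noteq> x'"
      then have "els e \<noteq> els e'" unfolding e(2) e'(2) by (simp add: doubleton_eq_iff)
      then have ne: "e \<noteq> e'" by blast
      have "small (els F - {e})"
        by (rule small_subset[OF small_els[of F]]) (blast, (rule definable_intros)+)
      then obtain F' where F': "els F' = els F - {e}" by (rule ex_small)
      have "is_nat m" "A m x" using kmx(1) unfolding T_def by auto
      then have "pendant m x \<in> els V" using Vpd by blast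
      then obtain d where d: "d \<in> els F" "pendant m x \<in> els d" using cov by blast
      then have "d \<in> els E" using FE by blast
      then consider k l y where "els d = {hub k, point l y}" | l y where "els d = {point l y, pendant l y}"
        using E[of d] by blast
      then have "point m x \<in> els d" using d(2) by cases auto
      moreover have "d \<noteq> e" using d(2) e(2) by auto
      moreover have "hub k \<in> els e'" unfolding e'(2) by simp
      moreover have "d \<in> els F'" if "d \<noteq> e" using that d(1) unfolding F' by blast
      moreover have "e' \<in> els F'" using e'(1) ne unfolding F' by blast
      ultimately have "\<exists>d\<in>els F'. v \<in> els d" if "v \<in> els e" for v
        using that unfolding e(2) by auto
      then have "\<exists>d\<in>els F'. v \<in> els d" if "v \<in> els V" for v
        using cov[OF that] F' by blast
      then have "edge_cover V E F'" unfolding edge_cover_iff using FE F' by blast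
      moreover have "els F' \<subset> els F" using e(1) F' by blast
      ultimately show False using Fmin by blast
    qed
  next
    fix n
    assume n: "is_nat n"
    then obtain e where e: "e \<in> els F" "hub n \<in> els e" using cov Vhub by blast
    then obtain k m x where kmx: "is_nat k" "A m x" "m = k \<or> m = suc k" "els e = {hub k, point m x}"
      using FE E[of e] by auto
    then have "k = n" using e(2) by simp
    then have "n \<in> els (suc m)" using kmx(3) by auto
    moreover have "T k m x" unfolding T_def using kmx e(1) by blast
    ultimately show "\<exists>k m x. n \<in> els (suc m) \<and> T k m x" by blast
  qed
qed

end

lemma partial_choice_iff_Koenig: "Koenig_lemma \<longleftrightarrow> partial_choice"
  and partial_choice_iff_coloring: "coloring_principle \<longleftrightarrow> partial_choice"
  and partial_choice_iff_dominating: "dominating_set_principle \<longleftrightarrow> partial_choice"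
  and partial_choice_iff_edge_cover: "edge_cover_principle \<longleftrightarrow> partial_choice"
  and partial_choice_iff_matching: "matching_principle \<longleftrightarrow> partial_choice"
proof -
  have wo: "\<exists>lt. wo (els V) lt" if pc: partial_choice and G: "inf_lf_conn_graph V E" for V E
  proof -
    have "els V \<noteq> {}" using G Fin_empty unfolding inf_lf_conn_graph_def Fin_els[symmetric] by auto
    then obtain x0 where "x0 \<in> els V" by blast
    then show ?thesis by (rule partial_choice_wo[OF G _ pc])
  qed
  show "Koenig_lemma \<longleftrightarrow> partial_choice"
  proof
    show Koenig_lemma if pc: partial_choice
      unfolding Koenig_lemma_def using wo[OF pc] wo_ray by blast
  qed (simp add: partial_choice_def ray_chooses)
  show "coloring_principle \<longleftrightarrow> partial_choice"
  proof
    show coloring_principle if pc: partial_choice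
      unfolding coloring_principle_def using wo[OF pc] wo_irreducible_coloring by blast
  qed (simp add: partial_choice_def coloring_chooses)
  show "dominating_set_principle \<longleftrightarrow> partial_choice"
  proof
    show dominating_set_principle if pc: partial_choice
      unfolding dominating_set_principle_def using wo[OF pc] wo_minimal_dominating by blast
  qed (simp add: partial_choice_def dominating_chooses)
  show "edge_cover_principle \<longleftrightarrow> partial_choice"
  proof
    show edge_cover_principle if pc: partial_choice
      unfolding edge_cover_principle_def using wo[OF pc] wo_minimal_edge_cover by blast
  qed (simp add: partial_choice_def edge_cover_chooses)
  show "matching_principle \<longleftrightarrow> partial_choice"
  proof
    show matching_principle if pc: partial_choice
      unfolding matching_principle_def using wo[OF pc] wo_maximal_matching by blast
  qed (simp add: partial_choice_def matching_chooses)
qed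

end

theorem theorem5p1:
  fixes mem :: "'a \<Rightarrow> 'a \<Rightarrow> bool"
  assumes "ZF_model mem"
  shows "(membership.Koenig_lemma mem \<longleftrightarrow> membership.coloring_principle mem) \<and>
         (membership.Koenig_lemma mem \<longleftrightarrow> membership.dominating_set_principle mem) \<and>
         (membership.Koenig_lemma mem \<longleftrightarrow> membership.edge_cover_principle mem) \<and>
         (membership.Koenig_lemma mem \<longleftrightarrow> membership.matching_principle mem)"
proof -
  interpret ZF_model mem by (rule assms)
  show ?thesis
    using partial_choice_iff_Koenig partial_choice_iff_coloring partial_choice_iff_dominating
      partial_choice_iff_edge_cover partial_choice_iff_matching by blast
qed

end
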